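(* Let $\tau>0$, let $\lambda>0$ with $\lambda^{-1}$ an integer $\ge 2$, let $0<\theta\le\frac12$, $a>0$, $1<p\le\infty$ and $s>1$. Put $T_n=\sum_{i=0}^{n-1}\tau^i$. Let $u\in L^\infty_t(\dot W^{s,p}(\mathbb{R}^2))$ be a divergence-free velocity field and $\rho$ a corresponding solution of the continuity equation such that the pair $(u,\rho)$ is of $(\lambda,a,p,\theta,s)$-cellular type (with time parameter $\tau$). Then there is a constant $C=C(a,\lambda,s)>0$ such that for all integers $n\ge 1$ $$\mathcal{G}(\rho(T_n,\cdot))\ \ge\ C\,T_n^{-\frac{1}{s-1}}\qquad\text{and}\qquad \|\rho(T_n,\cdot)\|_{\dot H^{-1}(\mathbb{R}^2)}\ \ge\ C\,T_n^{-\frac{2}{s-1}} .$$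
   Context: Setting. $\mathcal{Q}=(-\frac12,\frac12)^2\subset\mathbb{R}^2$. All velocity fields are time-dependent, divergence-free, vanish on $\partial\mathcal{Q}$ and are identically zero outside $\mathcal{Q}$. Given a bounded initial datum $\bar\rho$ with $\bar\rho=0$ outside $\mathcal Q$ and $\int_{\mathcal Q}\bar\rho=0$, the solution $\rho$ (bounded, identically zero outside $\mathcal Q$) solves $\partial_t\rho+\operatorname{div}(u\rho)=0$, $\rho(0,\cdot)=\bar\rho$, in the sense of distributions; equivalently $\rho$ is transported by the (measure-preserving) regular Lagrangian flow of $u$, and $\rho(t,\cdot)$ is thus defined for every $t$. The parameters $\kappa\in(0,1)$ and $\bar s\in(0,1)$ are fixed once and for all; constants may depend on them without mention. Sobolev seminorms. For an integer $k$, $\|f\|_{\dot W^{k,p}}=\|\nabla^k f\|_{L^p(\mathbb{R}^2)}$. For $s=k+r$ with $k\ge1$ an integer and $r\in(0,1)$, $\|f\|^p_{\dot W^{s,p}(\mathbb{R}^2)}=\iint_{\mathbb{R}^2\times\mathbb{R}^2}\frac{|\nabla^kf(x)-\nabla^kf(y)|^p}{|x-y|^{2+rp}}\,dx\,dy$ (for $p=\infty$: the $r$-Hölder seminorm of $\nabla^k f$). $u\in L^\infty_t(\dot W^{s,p})$ means $\operatorname{ess\,sup}_t\|u(t,\cdot)\|_{\dot W^{s,p}(\mathbb{R}^2)}<\infty$. Mixing scales. For a bounded function $f$ on $\mathbb{R}^2$, the geometric mixing scale $\mathcal{G}(f)$ is the infimum of all $\epsilon>0$ such that for every $x\in\mathbb{R}^2$,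 $\left|\frac{1}{|B_\epsilon(x)|}\int_{B_\epsilon(x)}f(y)\,dy\right|\le\kappa\|f\|_\infty$. The functional mixing scale is $\|f\|_{\dot H^{-1}(\mathbb{R}^2)}=\sup\{\int_{\mathbb{R}^2}f\xi\,dx:\ \|\nabla\xi\|_{L^2(\mathbb{R}^2)}\le1\}$. Tilings. For $\lambda>0$ with $\lambda^{-1}$ an integer $\ge2$ (and $\mathcal T_1=\{\mathcal Q\}$), $\mathcal{T}_\lambda$ is the family of the $\lambda^{-2}$ open squares $\{(x,y): -\frac12+k\lambda<x<-\frac12+(k+1)\lambda,\ -\frac12+h\lambda<y<-\frac12+(h+1)\lambda\}$, $k,h=0,\dots,\lambda^{-1}-1$. Characteristic length scale. For $A\subset E\subset\mathbb{R}^2$ with $A$ measurable of positive measure, $LS_E(A)$ is the supremum of all $r>0$ for which there is a ball $B(x,r)\subset E$ with $\frac{|A\cap B(x,r)|}{|B(x,r)|}>1-\frac{1-\kappa}{2}\bar s$. Cellular basic building blocks. $\mathcal{B}_{\lambda,a,p,\theta,s}$ is the set of all pairs $(u_0,\rho_0)$ defined on the time interval $0\le t\le1$ such that: (i) $u_0\in L^\infty_t(\dot W^{s,p}_x)$ is divergence-free, $u_0=0$ on $\partial\mathcal{Q}$ and $u_0=0$ outside $\mathcal{Q}$; (ii) $\rho_0$ solves the continuity equation on $[0,1]$ with velocity $u_0$ and initial value equal to $1$ on a set $A\subset\mathcal{Q}$ and to a constant $c$ on $\mathcal{Q}\setminus A$ (and $0$ outside $\mathcal Q$), where $LS_{\mathcal{Q}}(A)\ge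 a$ and $|A|=\theta$ (the constant $c$ being such that $\int_{\mathcal{Q}}\rho_0(0,\cdot)=0$); (iii) $\int_Q\rho_0(1,x)\,dx=0$ for every $Q\in\mathcal{T}_\lambda$. Cellular type. Given $\tau>0$, let $T_0=0$ and $T_n=\sum_{i=0}^{n-1}\tau^i$. A pair $(u,\rho)$ of a velocity field and a corresponding solution is of $(\lambda,a,p,\theta,s)$-cellular type if for every $n\ge0$ and every tile $Q\in\mathcal{T}_{\lambda^n}$ there exists $(u_0,\rho_0)\in\mathcal{B}_{\lambda,a,p,\theta,s}$ (depending on $n$ and $Q$) such that for $T_n\le t<T_{n+1}$ and $x\in Q$ $$u(t,x)=\frac{\lambda^n}{\tau^n}u_0\Big(\frac{t-T_n}{\tau^n},\frac{x-r_Q}{\lambda^n}\Big),\qquad \rho(t,x)=\rho_0\Big(\frac{t-T_n}{\tau^n},\frac{x-r_Q}{\lambda^n}\Big),$$ where $r_Q$ is the center of $Q$. *)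

theory Defs
  imports "HOL-Analysis.Analysis" "HOL-Probability.Essential_Supremum"
begin

type_synonym plane = "real^2"

section \<open>Test functions and weak derivatives\<close>

text \<open>Iterated partial derivatives are indexed by lists of basis vectors. A function all of whose
  iterated partial derivatives are everywhere differentiable is smooth, and conversely.\<close>

fun iter_deriv :: "'a list \<Rightarrow> ('a::euclidean_space \<Rightarrow> real) \<Rightarrow> 'a \<Rightarrow> real" where
  "iter_deriv [] f = f"
| "iter_deriv (v # vs) f = (\<lambda>x. frechet_derivative (iter_deriv vs f) (at x) v)"

definition smooth :: "('a::euclidean_space \<Rightarrow> real) \<Rightarrow> bool" where
  "smooth f \<longleftrightarrow> (\<forall>vs\<in>lists Basis. \<forall>x. iter_deriv vs f differentiable (at x))"

definition test_function :: "'a::euclidean_space set \<Rightarrow> ('a \<Rightarrow> real) \<Rightarrow> bool" where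
  "test_function U f \<longleftrightarrow> smooth f \<and> (\<exists>K. compact K \<and> K \<subseteq> U \<and> (\<forall>x. x \<notin> K \<longrightarrow> f x = 0))"

definition locally_integrable_on ::
  "('a::euclidean_space \<Rightarrow> 'b::euclidean_space) \<Rightarrow> 'a set \<Rightarrow> bool" where
  "locally_integrable_on f S \<longleftrightarrow> (\<forall>K. compact K \<and> K \<subseteq> S \<longrightarrow> f absolutely_integrable_on K)"

definition dirs :: "nat \<Rightarrow> plane list set" where
  "dirs k = {vs. set vs \<subseteq> Basis \<and> length vs = k}"

text \<open>\<open>G\<close> is (a version of) the weak \<open>k\<close>-th gradient of \<open>f\<close>: the component along
  the directions \<open>vs\<close> is the function \<open>G vs\<close>.\<close>

definition weak_gradient ::
  "nat \<Rightarrow> (plane \<Rightarrow> 'b::euclidean_space) \<Rightarrow> (plane list \<Rightarrow> plane \<Rightarrow> 'b) \<Rightarrow> bool" where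
  "weak_gradient k f G \<longleftrightarrow>
     locally_integrable_on f UNIV \<and>
     (\<forall>vs\<in>dirs k. locally_integrable_on (G vs) UNIV \<and>
        (\<forall>\<phi>. test_function UNIV \<phi> \<longrightarrow>
           (LINT x|lebesgue. iter_deriv vs \<phi> x *\<^sub>R f x) =
           (-1) ^ k *\<^sub>R (LINT x|lebesgue. \<phi> x *\<^sub>R G vs x)))"

definition tensor_norm :: "nat \<Rightarrow> (plane list \<Rightarrow> 'b::euclidean_space) \<Rightarrow> real" where
  "tensor_norm k T = L2_set (\<lambda>vs. norm (T vs)) (dirs k)"


section \<open>Homogeneous Sobolev seminorms\<close>

definition ennreal_root :: "real \<Rightarrow> ennreal \<Rightarrow> ennreal" where
  "ennreal_root p x = (if x = \<infinity> then \<infinity> else ennreal (enn2real x powr (1 / p)))"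

definition Lp_norm :: "ennreal \<Rightarrow> (plane \<Rightarrow> real) \<Rightarrow> ennreal" where
  "Lp_norm p f =
     (if p = \<infinity> then esssup lebesgue (\<lambda>x. ennreal \<bar>f x\<bar>)
      else ennreal_root (enn2real p) (\<integral>\<^sup>+x. ennreal (\<bar>f x\<bar> powr enn2real p) \<partial>lebesgue))"

definition frac_seminorm ::
  "nat \<Rightarrow> real \<Rightarrow> ennreal \<Rightarrow> (plane list \<Rightarrow> plane \<Rightarrow> 'b::euclidean_space) \<Rightarrow> ennreal" where
  "frac_seminorm k r p G =
     (if p = \<infinity> then
        (SUP x. SUP y. ennreal (tensor_norm k (\<lambda>vs. G vs x - G vs y) / norm (x - y) powr r))
      else
        ennreal_root (enn2real p)
          (\<integral>\<^sup>+x. (\<integral>\<^sup>+y. ennreal (tensor_norm k (\<lambda>vs. G vs x - G vs y) powr enn2real p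
                / norm (x - y) powr (2 + r * enn2real p)) \<partial>lebesgue) \<partial>lebesgue))"

text \<open>The infimum runs over the versions of the weak gradient, which agree almost everywhere, so
  that it matters only for the Hoelder seminorm (the best version is taken). It is \<open>\<infinity>\<close> if there
  is no weak gradient.\<close>

definition sobolev_seminorm ::
  "real \<Rightarrow> ennreal \<Rightarrow> (plane \<Rightarrow> 'b::euclidean_space) \<Rightarrow> ennreal" where
  "sobolev_seminorm s p f =
     (let k = nat \<lfloor>s\<rfloor> in
      INF G\<in>{G. weak_gradient k f G}.
        if frac s = 0 then Lp_norm p (\<lambda>x. tensor_norm k (\<lambda>vs. G vs x))
        else frac_seminorm k (frac s) p G)"

text \<open>The essential supremum in time is spelled out as an almost everywhere bound, since
  \<^const>\<open>esssup\<close> would require measurability of the seminorm as a function of time.\<close>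

definition Linfty_sobolev ::
  "real set \<Rightarrow> real \<Rightarrow> ennreal \<Rightarrow> (real \<Rightarrow> plane \<Rightarrow> plane) \<Rightarrow> bool" where
  "Linfty_sobolev I s p u \<longleftrightarrow>
     (\<exists>M::real. AE t in lebesgue. t \<in> I \<longrightarrow> sobolev_seminorm s p (u t) \<le> ennreal M)"


section \<open>Velocity fields and the continuity equation\<close>

definition unit_square :: "plane set" where
  "unit_square = {x. -1/2 < x$1 \<and> x$1 < 1/2 \<and> -1/2 < x$2 \<and> x$2 < 1/2}"

definition div_free :: "(plane \<Rightarrow> plane) \<Rightarrow> bool" where
  "div_free v \<longleftrightarrow>
     (\<forall>\<phi>. test_function UNIV \<phi> \<longrightarrow> (LINT x|lebesgue. frechet_derivative \<phi> (at x) (v x)) = 0)"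

text \<open>The square is open, so the last condition includes vanishing on its boundary.\<close>

definition velocity_field :: "real set \<Rightarrow> (real \<Rightarrow> plane \<Rightarrow> plane) \<Rightarrow> bool" where
  "velocity_field I u \<longleftrightarrow>
     locally_integrable_on (\<lambda>(t, x). u t x) (I \<times> UNIV) \<and>
     (AE t in lebesgue. t \<in> I \<longrightarrow> div_free (u t)) \<and>
     (\<forall>t\<in>I. \<forall>x. x \<notin> unit_square \<longrightarrow> u t x = 0)"

definition initial_datum :: "(plane \<Rightarrow> real) \<Rightarrow> bool" where
  "initial_datum f \<longleftrightarrow>
     f \<in> borel_measurable lebesgue \<and> bounded (range f) \<and>
     (\<forall>x. x \<notin> unit_square \<longrightarrow> f x = 0) \<and>
     (LINT x:unit_square|lebesgue. f x) = 0"

text \<open>Bounded solutions, in the sense of distributions, of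
  \<open>\<partial>\<^sub>t \<rho> + div (u \<rho>) = 0\<close>, \<open>\<rho>(0) = f\<close> on a time interval \<open>I\<close> starting at \<open>0\<close>; test functions are
  supported in times before the end of \<open>I\<close>, and
  \<open>frechet_derivative \<phi> (at (t, x)) (1, u t x)\<close> is \<open>\<partial>\<^sub>t \<phi> + u \<bullet> \<nabla>\<phi>\<close>.
  The distributional equation determines \<open>\<rho>\<close> only up to null sets of space-time; the last two
  conditions select the representative that is weakly continuous in time, which is the one
  transported by the regular Lagrangian flow, and so give a meaning to \<open>\<rho> t\<close> for every \<open>t\<close>.\<close>

definition continuity_solution ::
  "real set \<Rightarrow> (real \<Rightarrow> plane \<Rightarrow> plane) \<Rightarrow> (plane \<Rightarrow> real) \<Rightarrow> (real \<Rightarrow> plane \<Rightarrow> real) \<Rightarrow> bool" where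
  "continuity_solution I u f \<rho> \<longleftrightarrow>
     (\<lambda>(t, x). \<rho> t x) \<in> borel_measurable (lebesgue_on (I \<times> UNIV)) \<and>
     (\<forall>t\<in>I. \<rho> t \<in> borel_measurable lebesgue) \<and>
     (\<exists>M. \<forall>t\<in>I. \<forall>x. \<bar>\<rho> t x\<bar> \<le> M) \<and>
     (\<forall>t\<in>I. \<forall>x. x \<notin> unit_square \<longrightarrow> \<rho> t x = 0) \<and>
     (\<forall>\<phi>. test_function ({t. \<exists>t'\<in>I. t < t'} \<times> UNIV) \<phi> \<longrightarrow>
        (LINT (t, x):I \<times> UNIV|lebesgue.
            \<rho> t x * frechet_derivative \<phi> (at (t, x)) (1, u t x)) +
        (LINT x|lebesgue. f x * \<phi> (0, x)) = 0) \<and>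
     (\<forall>\<phi>. test_function UNIV \<phi> \<longrightarrow> continuous_on I (\<lambda>t. LINT x|lebesgue. \<rho> t x * \<phi> x)) \<and>
     (AE x in lebesgue. \<rho> 0 x = f x)"


section \<open>Mixing scales and characteristic length scale\<close>

definition geometric_mixing_scale :: "real \<Rightarrow> (plane \<Rightarrow> real) \<Rightarrow> ereal" where
  "geometric_mixing_scale \<kappa> f =
     Inf {ereal \<epsilon> | \<epsilon>. \<epsilon> > 0 \<and>
       (\<forall>x. ennreal \<bar>(LINT y:ball x \<epsilon>|lebesgue. f y) / measure lebesgue (ball x \<epsilon>)\<bar>
              \<le> ennreal \<kappa> * Lp_norm \<infinity> f)}"

definition functional_mixing_scale :: "(plane \<Rightarrow> real) \<Rightarrow> ereal" where
  "functional_mixing_scale f =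
     Sup {ereal (LINT x|lebesgue. f x * \<xi> x) | \<xi>.
       sobolev_seminorm 1 2 \<xi> \<le> 1 \<and> integrable lebesgue (\<lambda>x. f x * \<xi> x)}"

definition length_scale :: "real \<Rightarrow> real \<Rightarrow> plane set \<Rightarrow> plane set \<Rightarrow> ereal" where
  "length_scale \<kappa> sbar E A =
     Sup {ereal r | r. r > 0 \<and> (\<exists>x. ball x r \<subseteq> E \<and>
       measure lebesgue (A \<inter> ball x r) / measure lebesgue (ball x r) > 1 - (1 - \<kappa>) / 2 * sbar)}"


section \<open>Tilings, building blocks and cellular type\<close>

text \<open>Tiles are addressed by their indices; for \<open>lam = 1\<close> the only tile is the whole square.\<close>

definition tile_index :: "real \<Rightarrow> (nat \<times> nat) set" where
  "tile_index lam = {(k, h). real k \<le> 1 / lam - 1 \<and> real h \<le> 1 / lam - 1}"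

definition tile :: "real \<Rightarrow> nat \<times> nat \<Rightarrow> plane set" where
  "tile lam = (\<lambda>(k, h). {x. -1/2 + real k * lam < x$1 \<and> x$1 < -1/2 + (real k + 1) * lam \<and>
                            -1/2 + real h * lam < x$2 \<and> x$2 < -1/2 + (real h + 1) * lam})"

definition tile_center :: "real \<Rightarrow> nat \<times> nat \<Rightarrow> plane" where
  "tile_center lam = (\<lambda>(k, h). vector [-1/2 + (real k + 1/2) * lam, -1/2 + (real h + 1/2) * lam])"

definition building_block ::
  "real \<Rightarrow> real \<Rightarrow> real \<Rightarrow> real \<Rightarrow> ennreal \<Rightarrow> real \<Rightarrow> real \<Rightarrow>
   (real \<Rightarrow> plane \<Rightarrow> plane) \<Rightarrow> (real \<Rightarrow> plane \<Rightarrow> real) \<Rightarrow> bool" where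
  "building_block \<kappa> sbar lam a p \<theta> s u0 \<rho>0 \<longleftrightarrow>
     velocity_field {0..1} u0 \<and> Linfty_sobolev {0..1} s p u0 \<and>
     (\<exists>A c f. A \<in> sets lebesgue \<and> A \<subseteq> unit_square \<and>
        length_scale \<kappa> sbar unit_square A \<ge> ereal a \<and> measure lebesgue A = \<theta> \<and>
        f = (\<lambda>x. if x \<in> A then 1 else if x \<in> unit_square then c else 0) \<and>
        initial_datum f \<and> continuity_solution {0..1} u0 f \<rho>0) \<and>
     (\<forall>q\<in>tile_index lam. (LINT x:tile lam q|lebesgue. \<rho>0 1 x) = 0)"

definition step_time :: "real \<Rightarrow> nat \<Rightarrow> real" where
  "step_time \<tau> n = (\<Sum>i<n. \<tau> ^ i)"

text \<open>The time interval covered by the steps. It is \<open>[0, \<infinity>)\<close> if \<open>\<tau> \<ge> 1\<close>, and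
  \<open>[0, 1 / (1 - \<tau>))\<close> if \<open>\<tau> < 1\<close>; nothing is required of a pair at later times.\<close>

definition cellular_times :: "real \<Rightarrow> real set" where
  "cellular_times \<tau> = {t. 0 \<le> t \<and> (\<exists>n. t < step_time \<tau> n)}"

definition cellular_type ::
  "real \<Rightarrow> real \<Rightarrow> real \<Rightarrow> real \<Rightarrow> real \<Rightarrow> ennreal \<Rightarrow> real \<Rightarrow> real \<Rightarrow>
   (real \<Rightarrow> plane \<Rightarrow> plane) \<Rightarrow> (real \<Rightarrow> plane \<Rightarrow> real) \<Rightarrow> bool" where
  "cellular_type \<kappa> sbar \<tau> lam a p \<theta> s u \<rho> \<longleftrightarrow>
     (\<forall>n. \<forall>q\<in>tile_index (lam ^ n). \<exists>u0 \<rho>0.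
        building_block \<kappa> sbar lam a p \<theta> s u0 \<rho>0 \<and>
        (\<forall>t x. step_time \<tau> n \<le> t \<and> t < step_time \<tau> (Suc n) \<and> x \<in> tile (lam ^ n) q \<longrightarrow>
           u t x = (lam ^ n / \<tau> ^ n) *\<^sub>R
             u0 ((t - step_time \<tau> n) / \<tau> ^ n) ((1 / lam ^ n) *\<^sub>R (x - tile_center (lam ^ n) q)) \<and>
           \<rho> t x =
             \<rho>0 ((t - step_time \<tau> n) / \<tau> ^ n) ((1 / lam ^ n) *\<^sub>R (x - tile_center (lam ^ n) q))))"

end

theory Submission
  imports Defs
begin

text \<open>At time \<open>T n\<close> every tile of side \<open>l = lam ^ n\<close> contains a ball of radius at least \<open>a * l / 2\<close> on
  which \<open>\<rho>\<close> is equal to \<open>1\<close> up to a small proportion. This bounds the two mixing scales below by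
  multiples of \<open>l\<close> and \<open>l\<^sup>2\<close> respectively, so it remains to show \<open>\<tau> \<ge> lam powr (1 - s)\<close>.

  Suppose that \<open>\<tau> < lam powr (1 - s)\<close>. As \<open>u\<close> vanishes outside each tile in the Sobolev sense, a
  Poincare inequality on the tiles bounds \<open>u\<close> during step \<open>n\<close> by a multiple of \<open>lam powr (n * s)\<close>, so
  that the displacement \<open>\<tau> ^ n * lam powr (n * s)\<close> of the step is small compared to \<open>lam ^ n\<close>. The same
  holds for the displacement over the steps from \<open>n\<close> to \<open>n + m\<close>. But then testing \<open>\<rho>\<close> against a sum of
  bumps, one on a good ball of each tile of side \<open>lam ^ n\<close>, gives a contradiction: the result is bounded
  below at time \<open>T n\<close>, and of order \<open>lam ^ m\<close> at time \<open>T (n + m)\<close>, when \<open>\<rho>\<close> has mean zero on the tiles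
  of side \<open>lam ^ (n + m)\<close>.\<close>

section \<open>Differential calculus of smooth functions\<close>

subsection \<open>Smooth functions\<close>

text \<open>The constant must not depend on \<open>u\<close>, \<open>p\<close>,
  \<open>\<theta>\<close> or \<open>\<tau>\<close>, although every estimate of \<open>u\<close>
  involves its seminorm bound. This is possible because regularity serves only to exclude a range of
  \<open>\<tau>\<close>: the displacement in units of the tile size is of order
  \<open>\<sigma> ^ n\<close> with \<open>\<sigma> = \<tau> * lam powr (s - 1)\<close>, and if
  \<open>\<sigma> < 1\<close> this beats every prefactor for large \<open>n\<close>. Constants in
  the energy estimates therefore only have to be finite, and crude inequalities suffice there. The
  lower bounds in terms of \<open>lam ^ n\<close> come from the profiles alone.

  Two obstacles shape the rest. There is only the weak equation, so the displacement of a step is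
  expressed by the change of the integral of \<open>\<rho> (T n) x * \<psi> x\<close> for test
  functions \<open>\<psi>\<close> with a bounded gradient. And the seminorm sees only the gradient
  of order \<open>nat \<lfloor>s\<rfloor>\<close>, for fractional \<open>s\<close> only through its
  differences. The size of this gradient is recovered from its vanishing mean on each tile, and the
  size of \<open>u\<close> from the gradient by a duality that skips all intermediate
  orders.\<close>

abbreviation partial :: "'a::euclidean_space \<Rightarrow> ('a \<Rightarrow> real) \<Rightarrow> 'a \<Rightarrow> real" where
  "partial b f \<equiv> (\<lambda>x. frechet_derivative f (at x) b)"

lemma partial_eqI: "(f has_derivative f') (at x) \<Longrightarrow> partial b f x = f' b"
  by (metis frechet_derivative_at)

text \<open>Coinduction principle: smooth functions form the largest family of differentiable
  functions that is stable under partial derivatives. Each closure property below amounts to finding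
  a suitable stable family, with no induction over lists of directions.\<close>

lemma smooth_coinduct:
  assumes "f \<in> F"
    and "\<And>g x. g \<in> F \<Longrightarrow> g differentiable (at x)"
    and "\<And>g b. g \<in> F \<Longrightarrow> b \<in> Basis \<Longrightarrow> partial b g \<in> F"
  shows "smooth f"
proof -
  have "vs \<in> lists Basis \<Longrightarrow> iter_deriv vs f \<in> F" for vs
    by (induction vs) (auto simp: assms)
  then show ?thesis
    unfolding smooth_def using assms(2) by blast
qed

lemma smooth_differentiable: "smooth f \<Longrightarrow> f differentiable (at x)"
  unfolding smooth_def by (metis iter_deriv.simps(1) lists.Nil)

lemma smooth_has_derivative: "smooth f \<Longrightarrow> (f has_derivative frechet_derivative f (at x)) (at x)"
  using smooth_differentiable frechet_derivative_works by (simp flip: frechet_derivative_works add: smooth_differentiable)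

lemma iter_deriv_append: "iter_deriv (vs @ ws) (f::'a::euclidean_space \<Rightarrow> real) = iter_deriv vs (iter_deriv ws f)"
  by (induction vs) auto

lemma smooth_partial:
  assumes "smooth f" "b \<in> Basis"
  shows "smooth (partial b f)"
  unfolding smooth_def
proof (intro ballI allI)
  fix vs :: "'a list" and x assume "vs \<in> lists Basis"
  then have "vs @ [b] \<in> lists Basis" using assms by auto
  then have "iter_deriv (vs @ [b]) f differentiable (at x)"
    using assms unfolding smooth_def by blast
  then show "iter_deriv vs (partial b f) differentiable (at x)"
    using iter_deriv_append[of vs "[b]" f] by simp
qed

lemma smooth_iter_deriv: "smooth f \<Longrightarrow> set vs \<subseteq> Basis \<Longrightarrow> smooth (iter_deriv vs f)"
  by (induction vs) (auto intro: smooth_partial)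

lemma smooth_continuous_on: "smooth f \<Longrightarrow> continuous_on S f"
  by (meson differentiable_imp_continuous_on differentiable_at_imp_differentiable_on smooth_differentiable)

lemma smooth_measurable: "smooth f \<Longrightarrow> f \<in> borel_measurable borel"
  by (simp add: borel_measurable_continuous_onI smooth_continuous_on)

lemma frechet_derivative_sum_partial:
  assumes "f differentiable (at x)"
  shows "frechet_derivative f (at x) v = (\<Sum>b\<in>Basis. (v \<bullet> b) * partial b f x)"
proof -
  have l: "linear (frechet_derivative f (at x))"
    using assms by (simp add: linear_frechet_derivative)
  have "frechet_derivative f (at x) v = frechet_derivative f (at x) (\<Sum>b\<in>Basis. (v \<bullet> b) *\<^sub>R b)"
    by (simp add: euclidean_representation)
  also have "\<dots> = (\<Sum>b\<in>Basis. (v \<bullet> b) * partial b f x)"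
    using l by (simp add: linear_sum linear_cmul o_def)
  finally show ?thesis .
qed

lemma smooth_real_DERIV: "smooth f \<Longrightarrow> (f has_real_derivative partial 1 f t) (at t)" for f :: "real \<Rightarrow> real"
proof -
  assume f: "smooth f"
  have "frechet_derivative f (at t) = (\<lambda>y. partial 1 f t * y)"
    by (rule ext, subst frechet_derivative_sum_partial[OF smooth_differentiable[OF f]]) simp
  then show ?thesis
    using smooth_has_derivative[OF f] unfolding has_field_derivative_def by metis
qed

subsection \<open>Closure properties\<close>

lemma smooth_const [simp, intro]: "smooth (\<lambda>x. c)"
proof (rule smooth_coinduct[where F = "range (\<lambda>c x. c)"])
  fix g :: "'a \<Rightarrow> real" and b :: 'a assume "g \<in> range (\<lambda>c x. c)"
  then obtain d where "g = (\<lambda>x. d)" by auto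
  then show "partial b g \<in> range (\<lambda>c x. c)" by (simp add: frechet_derivative_const)
qed auto

lemma smooth_if_partial:
  assumes "\<And>x. f differentiable (at x)" "\<And>b. b \<in> Basis \<Longrightarrow> smooth (partial b f)"
  shows "smooth f"
proof (rule smooth_coinduct[where F = "insert f (Collect smooth)"])
qed (use assms in \<open>auto intro: smooth_differentiable smooth_partial\<close>)

lemma smooth_bounded_linear:
  assumes "bounded_linear f" shows "smooth f"
proof (rule smooth_if_partial)
  show "f differentiable (at x)" for x
    using assms bounded_linear_imp_differentiable by blast
  show "smooth (partial b f)" for b
    using partial_eqI[OF bounded_linear_imp_has_derivative[OF assms]] by simp
qed

lemma partial_add:
  "f differentiable (at x) \<Longrightarrow> g differentiable (at x) \<Longrightarrow>
    partial b (\<lambda>x. f x + g x) x = partial b f x + partial b g x"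
  by (rule partial_eqI) (intro has_derivative_add; simp flip: frechet_derivative_works)

lemma partial_mult:
  "f differentiable (at x) \<Longrightarrow> g differentiable (at x) \<Longrightarrow>
    partial b (\<lambda>x. f x * g x) x = f x * partial b g x + partial b f x * g x"
  by (rule partial_eqI) (intro has_derivative_mult; simp flip: frechet_derivative_works)

lemma smooth_add [intro]:
  assumes "smooth f" "smooth g" shows "smooth (\<lambda>x. f x + g x)"
proof (rule smooth_coinduct[where F = "{\<lambda>x. f x + g x | f g. smooth f \<and> smooth g}"])
  fix h :: "'a \<Rightarrow> real" and b :: 'a
  assume "h \<in> {\<lambda>x. f x + g x | f g. smooth f \<and> smooth g}" and b: "b \<in> Basis"
  then obtain f g where h: "h = (\<lambda>x. f x + g x)" "smooth f" "smooth g" by auto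
  then have "partial b h = (\<lambda>x. partial b f x + partial b g x)"
    by (simp add: partial_add smooth_differentiable)
  moreover have "smooth (partial b f)" "smooth (partial b g)"
    using h b by (simp_all add: smooth_partial)
  ultimately show "partial b h \<in> {\<lambda>x. f x + g x | f g. smooth f \<and> smooth g}"
    unfolding mem_Collect_eq by (intro exI[of _ "partial b f"] exI[of _ "partial b g"]) simp
qed (use assms in \<open>auto simp: smooth_differentiable\<close>)

text \<open>By Leibniz's rule the derivative of a product is a sum of two products, so a family that
  is stable under differentiation must contain finite sums.\<close>

inductive_set smooth_products :: "('a::euclidean_space \<Rightarrow> real) set" where
  prod: "smooth f \<Longrightarrow> smooth g \<Longrightarrow> (\<lambda>x. f x * g x) \<in> smooth_products"
| add: "f \<in> smooth_products \<Longrightarrow> g \<in> smooth_products \<Longrightarrow> (\<lambda>x. f x + g x) \<in> smooth_products"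

lemma smooth_products_differentiable: "h \<in> smooth_products \<Longrightarrow> h differentiable (at x)"
  by (induction rule: smooth_products.induct) (simp_all add: smooth_differentiable)

lemma smooth_mult [intro]:
  assumes "smooth f" "smooth g" shows "smooth (\<lambda>x. f x * g x)"
proof (rule smooth_coinduct[where F = smooth_products])
  show "(\<lambda>x. f x * g x) \<in> smooth_products" using assms by (rule smooth_products.prod)
  fix h :: "'a \<Rightarrow> real" and b :: 'a assume "h \<in> smooth_products" and b: "b \<in> Basis"
  then show "partial b h \<in> smooth_products"
  proof (induction rule: smooth_products.induct)
    case (prod f g)
    then have "partial b (\<lambda>x. f x * g x) = (\<lambda>x. f x * partial b g x + partial b f x * g x)"
      by (simp add: partial_mult smooth_differentiable)
    then show ?case
      using prod b by (auto intro!: smooth_products.intros smooth_partial)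
  next
    case (add f g)
    then have "partial b (\<lambda>x. f x + g x) = (\<lambda>x. partial b f x + partial b g x)"
      by (simp add: partial_add smooth_products_differentiable)
    then show ?case
      using add by (auto intro!: smooth_products.intros)
  qed
qed (rule smooth_products_differentiable)

lemma smooth_cmult: "smooth f \<Longrightarrow> smooth (\<lambda>x. c * f x)"
  by (intro smooth_mult smooth_const)

lemma smooth_diff:
  assumes "smooth f" "smooth g" shows "smooth (\<lambda>x. f x - g x)"
  using smooth_add[OF assms(1) smooth_cmult[OF assms(2), of "-1"]] by simp

lemma smooth_power: "smooth f \<Longrightarrow> smooth (\<lambda>x. f x ^ n)"
  by (induction n) (auto intro: smooth_mult)

lemma smooth_sum: "(\<And>i. i \<in> I \<Longrightarrow> smooth (f i)) \<Longrightarrow> smooth (\<lambda>x. \<Sum>i\<in>I. f i x)"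
  by (induction I rule: infinite_finite_induct) auto

lemma partial_compose:
  fixes g :: "real \<Rightarrow> real"
  assumes "f differentiable (at x)" "g differentiable (at (f x))"
  shows "partial b (\<lambda>x. g (f x)) x = partial 1 g (f x) * partial b f x"
proof (rule partial_eqI)
  have 1: "(f has_derivative frechet_derivative f (at x)) (at x)"
    and 2: "(g has_derivative frechet_derivative g (at (f x))) (at (f x))"
    using assms by (simp_all flip: frechet_derivative_works)
  define d where "d = partial 1 g (f x)"
  have "frechet_derivative g (at (f x)) = (\<lambda>y. d * y)"
    by (rule ext, subst frechet_derivative_sum_partial[OF assms(2)]) (simp add: d_def)
  with has_derivative_compose[OF 1 2]
  show "((\<lambda>x. g (f x)) has_derivative (\<lambda>y. partial 1 g (f x) * frechet_derivative f (at x) y)) (at x)"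
    by (simp flip: d_def)
qed

text \<open>The chain rule produces a factor that is a partial derivative of \<open>f\<close>; the
  weight \<open>h\<close> absorbs it, and sums are added as for products.\<close>

inductive_set smooth_compositions :: "('a::euclidean_space \<Rightarrow> real) \<Rightarrow> ('a \<Rightarrow> real) set"
  for f where
  comp: "smooth h \<Longrightarrow> smooth g \<Longrightarrow> (\<lambda>x. h x * (g :: real \<Rightarrow> real) (f x)) \<in> smooth_compositions f"
| add: "k \<in> smooth_compositions f \<Longrightarrow> l \<in> smooth_compositions f \<Longrightarrow>
    (\<lambda>x. k x + l x) \<in> smooth_compositions f"

lemma smooth_compose:
  fixes g :: "real \<Rightarrow> real"
  assumes "smooth g" "smooth f" shows "smooth (\<lambda>x. g (f x))"
proof (rule smooth_coinduct[where F = "smooth_compositions f"])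
  have df: "f differentiable (at x)" for x
    using assms smooth_differentiable by blast
  have dgf: "(\<lambda>x. g (f x)) differentiable (at x)" if "smooth g" for x and g :: "real \<Rightarrow> real"
    by (rule differentiable_compose[OF smooth_differentiable[OF that] df])
  show "(\<lambda>x. g (f x)) \<in> smooth_compositions f"
    using smooth_compositions.comp[OF smooth_const[of 1] assms(1)] by simp
  show diff: "k differentiable (at x)" if "k \<in> smooth_compositions f" for k x
    using that by induction (simp_all add: smooth_differentiable dgf)
  fix k and b :: 'a assume "k \<in> smooth_compositions f" and b: "b \<in> Basis"
  then show "partial b k \<in> smooth_compositions f"
  proof induction
    case (comp h g)
    then have "partial b (\<lambda>x. h x * g (f x)) =
        (\<lambda>x. (h x * partial b f x) * partial 1 g (f x) + partial b h x * g (f x))"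
      by (simp add: partial_mult partial_compose smooth_differentiable dgf df algebra_simps)
    then show ?case
      using comp b assms(2)
      by (auto intro!: smooth_compositions.intros smooth_partial smooth_mult)
  next
    case (add k l)
    then have "partial b (\<lambda>x. k x + l x) = (\<lambda>x. partial b k x + partial b l x)"
      by (simp add: partial_add diff)
    then show ?case using add by (auto intro!: smooth_compositions.intros)
  qed
qed

subsection \<open>Locality and rescaling of iterated derivatives\<close>

lemma iter_deriv_cong_open:
  assumes "open U" "\<And>x. x \<in> U \<Longrightarrow> f x = g x" "x \<in> U"
  shows "iter_deriv vs f x = iter_deriv vs g x"
  using assms(3)
proof (induction vs arbitrary: x)
  case (Cons v vs)
  \<comment> \<open>\<open>frechet_derivative\<close> chooses some \<open>D\<close> with this
    property. Equality of the properties gives equality of the chosen values, also at points where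
    there is no derivative.\<close>
  have "(iter_deriv vs f has_derivative D) (at x) \<longleftrightarrow> (iter_deriv vs g has_derivative D) (at x)" for D
    using has_derivative_transform_within_open[OF _ assms(1) Cons.prems] Cons.IH by metis
  then show ?case
    by (simp add: frechet_derivative_def)
qed (use assms in auto)

lemma partial_affine:
  fixes f :: "'a::euclidean_space \<Rightarrow> real"
  assumes "f differentiable (at (c + l *\<^sub>R x))"
  shows "partial b (\<lambda>x. f (c + l *\<^sub>R x)) x = l * partial b f (c + l *\<^sub>R x)"
proof (rule partial_eqI)
  have *: "((\<lambda>x. c + l *\<^sub>R x) has_derivative (\<lambda>y. l *\<^sub>R y)) (at x)"
    by (auto intro!: derivative_eq_intros)
  have f: "(f has_derivative frechet_derivative f (at (c + l *\<^sub>R x))) (at (c + l *\<^sub>R x))"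
    using assms by (simp flip: frechet_derivative_works)
  have "frechet_derivative f (at (c + l *\<^sub>R x)) (l *\<^sub>R y) = l * frechet_derivative f (at (c + l *\<^sub>R x)) y" for y
    using linear_frechet_derivative[OF assms] by (simp add: linear_cmul)
  with has_derivative_compose[OF * f]
  show "((\<lambda>x. f (c + l *\<^sub>R x)) has_derivative (\<lambda>y. l * frechet_derivative f (at (c + l *\<^sub>R x)) y)) (at x)"
    by simp
qed

lemma smooth_affine:
  fixes f :: "'a::euclidean_space \<Rightarrow> real"
  assumes "smooth f" shows "smooth (\<lambda>x. f (c + l *\<^sub>R x))"
proof (rule smooth_coinduct[where F = "{\<lambda>x. d * g (c + l *\<^sub>R x) | d g. smooth g}"])
  show "(\<lambda>x. f (c + l *\<^sub>R x)) \<in> {\<lambda>x. d * g (c + l *\<^sub>R x) | d g. smooth g}"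
    using assms by (auto intro!: exI[of _ 1] exI[of _ f])
next
  fix h :: "'a \<Rightarrow> real" and x b :: 'a
  assume "h \<in> {\<lambda>x. d * g (c + l *\<^sub>R x) | d g. smooth g}"
  then obtain d g where h: "h = (\<lambda>x. d * g (c + l *\<^sub>R x))" and g: "smooth g" by blast
  have 1: "(\<lambda>x. g (c + l *\<^sub>R x)) differentiable (at x)" for x
    by (rule differentiable_compose[OF smooth_differentiable[OF g]]) simp
  then show "h differentiable (at x)" unfolding h by simp
  assume b: "b \<in> Basis"
  have "partial b h = (\<lambda>x. (d * l) * partial b g (c + l *\<^sub>R x))"
    unfolding h by (rule ext, subst partial_mult)
      (auto simp: 1 partial_affine smooth_differentiable g frechet_derivative_const)
  then show "partial b h \<in> {\<lambda>x. d * g (c + l *\<^sub>R x) | d g. smooth g}"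
    unfolding mem_Collect_eq
    by (intro exI[of _ "d * l"] exI[of _ "partial b g"]) (simp add: smooth_partial[OF g b])
qed

lemma iter_deriv_affine:
  fixes f :: "'a::euclidean_space \<Rightarrow> real"
  assumes "smooth f" "set vs \<subseteq> Basis"
  shows "iter_deriv vs (\<lambda>x. f (c + l *\<^sub>R x)) = (\<lambda>x. l ^ length vs * iter_deriv vs f (c + l *\<^sub>R x))"
  using assms(2)
proof (induction vs)
  case (Cons v vs)
  define g where "g = iter_deriv vs f"
  have g: "smooth g" using assms Cons by (auto simp: g_def intro: smooth_iter_deriv)
  have 1: "(\<lambda>x. g (c + l *\<^sub>R x)) differentiable (at x)" for x
    using smooth_affine[OF g] smooth_differentiable by blast
  show ?case
    using Cons by (auto simp: partial_mult 1 partial_affine smooth_differentiable g frechet_derivative_const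
      simp flip: g_def)
qed simp

subsection \<open>A smooth step\<close>

text \<open>The quotients of smooth functions by powers of \<open>g\<close> are stable under
  differentiation: the derivative of \<open>h / g ^ n\<close> has numerator
  \<open>h' * g - n * h * g'\<close> over \<open>g ^ (n + 1)\<close>.\<close>

lemma smooth_divide:
  assumes "smooth f" "smooth g" "\<And>x. g x \<noteq> 0"
  shows "smooth (\<lambda>x. f x / g x)"
proof -
  let ?F = "{\<lambda>x. h x * inverse (g x) ^ n | h n. smooth h}"
  have d: "(\<lambda>x. h x * inverse (g x) ^ n) differentiable (at x)" if "smooth h" for h n x
    using smooth_differentiable[OF that] smooth_differentiable[OF assms(2)] assms(3)
    by (intro derivative_intros) auto
  have "smooth (\<lambda>x. f x * inverse (g x) ^ 1)"
  proof (rule smooth_coinduct[where F = ?F])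
    show "(\<lambda>x. f x * inverse (g x) ^ 1) \<in> ?F"
      using assms(1) by blast
    fix k and b :: 'a assume "k \<in> ?F" and b: "b \<in> Basis"
    then obtain h n where k: "k = (\<lambda>x. h x * inverse (g x) ^ n)" and h: "smooth h" by blast
    define h' where "h' = (\<lambda>x. partial b h x * g x - of_nat n * (h x * partial b g x))"
    have h': "smooth h'"
      unfolding h'_def using h assms b
      by (intro smooth_diff smooth_mult smooth_partial smooth_const) auto
    have "partial b k x = h' x * inverse (g x) ^ Suc n" for x
    proof -
      have i: "((\<lambda>x. inverse (g x)) has_derivative
          (\<lambda>y. - (inverse (g x) * frechet_derivative g (at x) y * inverse (g x)))) (at x)"
        by (rule Deriv.has_derivative_inverse[OF assms(3) smooth_has_derivative[OF assms(2)]])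
      note this = has_derivative_mult[OF smooth_has_derivative[OF h, of x] has_derivative_power[OF i, of n]]
      from partial_eqI[OF this, where b = b] show ?thesis
        unfolding k h'_def using assms(3)[of x] by (cases n) (auto simp: field_simps)
    qed
    then have "partial b k = (\<lambda>x. h' x * inverse (g x) ^ Suc n)" by blast
    with h' show "partial b k \<in> ?F" by blast
  qed (use d in blast)
  then show ?thesis by (simp add: divide_inverse)
qed

text \<open>The functions \<open>p (1 / t) * exp (- 1 / t)\<close>, extended by zero to
  \<open>t \<le> 0\<close>. Carrying the polynomial makes the family stable under differentiation,
  which turns smoothness at the origin into a single computation of a first derivative.\<close>

definition flat_exp :: "real poly \<Rightarrow> real \<Rightarrow> real" where
  "flat_exp p t = (if t > 0 then poly p (inverse t) * exp (- inverse t) else 0)"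

lemma poly_over_exp_tendsto_0: "((\<lambda>x::real. poly p x * exp (- x)) \<longlongrightarrow> 0) at_top"
proof -
  have "((\<lambda>x::real. \<Sum>i\<le>degree p. coeff p i * (x ^ i / exp x)) \<longlongrightarrow> (\<Sum>i\<le>degree p. coeff p i * 0)) at_top"
    by (intro tendsto_sum tendsto_mult tendsto_const tendsto_power_div_exp_0)
  then show ?thesis
    by (simp add: poly_altdef sum_distrib_right exp_minus divide_inverse mult.assoc)
qed

lemma flat_exp_DERIV:
  "(flat_exp p has_real_derivative flat_exp ([:0, 0, 1:] * (p - pderiv p)) t) (at t)"
proof -
  consider "t > 0" | "t < 0" | "t = 0" by linarith
  then show ?thesis
  proof cases
    case 1
    have "((\<lambda>t. poly p (inverse t) * exp (- inverse t)) has_real_derivative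
        poly p (inverse t) * (exp (- inverse t) * (inverse t * inverse t)) +
        (poly (pderiv p) (inverse t) * (- (inverse t * inverse t))) * exp (- inverse t)) (at t)"
      using 1 by (auto intro!: derivative_eq_intros DERIV_chain2[OF poly_DERIV] simp: power2_eq_square)
    then have "(flat_exp p has_real_derivative
        poly p (inverse t) * (exp (- inverse t) * (inverse t * inverse t)) +
        (poly (pderiv p) (inverse t) * (- (inverse t * inverse t))) * exp (- inverse t)) (at t)"
      by (rule has_field_derivative_transform_within_open[where S = "{0<..}"])
        (use 1 in \<open>auto simp: flat_exp_def\<close>)
    then show ?thesis
      by (rule DERIV_cong) (use 1 in \<open>simp add: flat_exp_def algebra_simps\<close>)
  next
    case 2
    have "((\<lambda>t. 0) has_real_derivative 0) (at t)" by simp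
    then have "(flat_exp p has_real_derivative 0) (at t)"
      by (rule has_field_derivative_transform_within_open[where S = "{..<0}"])
        (use 2 in \<open>auto simp: flat_exp_def\<close>)
    then show ?thesis using 2 by (simp add: flat_exp_def)
  next
    case 3
    \<comment> \<open>The right difference quotient at \<open>0\<close> has the same shape again,
      with \<open>p\<close> multiplied by the indeterminate.\<close>
    have "((\<lambda>t. poly ([:0, 1:] * p) (inverse t) * exp (- inverse t)) \<longlongrightarrow> 0) (at_right 0)"
      by (rule filterlim_compose[OF poly_over_exp_tendsto_0 filterlim_inverse_at_top_right])
    then have r: "((\<lambda>t. (flat_exp p t - flat_exp p 0) / (t - 0)) \<longlongrightarrow> 0) (at_right 0)"
      by (rule Lim_transform_eventually)
        (auto simp: flat_exp_def eventually_at_right_less divide_inverse intro!: eventually_at_right_less[THEN eventually_mono])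
    have "((\<lambda>t. (flat_exp p t - flat_exp p 0) / (t - 0)) \<longlongrightarrow> 0) (at_left (0::real))"
      by (rule Lim_transform_eventually[OF tendsto_const])
        (auto simp: flat_exp_def eventually_at_filter intro!: always_eventually)
    with r show ?thesis
      unfolding 3 has_field_derivative_iff by (simp add: filterlim_split_at flat_exp_def)
  qed
qed

lemma smooth_flat_exp: "smooth (flat_exp p)"
proof (rule smooth_coinduct[where F = "range flat_exp"])
  fix g assume "g \<in> range flat_exp"
  then obtain q where g: "g = flat_exp q" by blast
  show "g differentiable (at x)" for x
    unfolding g using flat_exp_DERIV real_differentiable_def by blast
  fix b :: real assume "b \<in> Basis"
  then have [simp]: "b = 1" by simp
  have "partial b g = flat_exp ([:0, 0, 1:] * (q - pderiv q))"
    unfolding g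
    by (rule ext, rule trans[OF partial_eqI[OF flat_exp_DERIV[unfolded has_field_derivative_def]]]) simp
  then show "partial b g \<in> range flat_exp" by blast
qed auto

definition smooth_step :: "real \<Rightarrow> real" where
  "smooth_step t = flat_exp 1 t / (flat_exp 1 t + flat_exp 1 (1 - t))"

lemma flat_exp_1: "flat_exp 1 t \<ge> 0" "flat_exp 1 t > 0 \<longleftrightarrow> t > 0" "t \<le> 0 \<Longrightarrow> flat_exp 1 t = 0"
  by (auto simp: flat_exp_def)

lemma flat_exp_denominator_pos: "flat_exp 1 t + flat_exp 1 (1 - t) > 0"
  using flat_exp_1(1)[of t] flat_exp_1(1)[of "1 - t"] flat_exp_1(2)[of t] flat_exp_1(2)[of "1 - t"]
  by (smt (verit))

lemma smooth_smooth_step: "smooth smooth_step"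
proof -
  have 1: "smooth (\<lambda>t. flat_exp 1 (1 - t))"
    using smooth_affine[OF smooth_flat_exp, of 1 1 "-1"] by simp
  have "smooth (\<lambda>t. flat_exp 1 t / (flat_exp 1 t + flat_exp 1 (1 - t)))"
    using flat_exp_denominator_pos by (intro smooth_divide smooth_add smooth_flat_exp 1) (metis less_irrefl)
  then show ?thesis by (simp add: smooth_step_def[abs_def])
qed

lemma smooth_step_eq_0 [simp]: "t \<le> 0 \<Longrightarrow> smooth_step t = 0"
  by (simp add: smooth_step_def flat_exp_1)

lemma smooth_step_eq_1 [simp]: "t \<ge> 1 \<Longrightarrow> smooth_step t = 1"
  using flat_exp_1(2)[of t] by (simp add: smooth_step_def flat_exp_1(3))

lemma smooth_step_pos: "t > 0 \<Longrightarrow> smooth_step t > 0"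
  using flat_exp_denominator_pos[of t] flat_exp_1(2)[of t] by (simp add: smooth_step_def)

lemma smooth_step_range: "0 \<le> smooth_step t" "smooth_step t \<le> 1" "\<bar>smooth_step t\<bar> \<le> 1"
  using flat_exp_denominator_pos[of t] flat_exp_1(1)[of t] flat_exp_1(1)[of "1 - t"]
  by (auto simp: smooth_step_def field_simps)

lemma smooth_step_DERIV: "(smooth_step has_real_derivative partial 1 smooth_step t) (at t)"
  by (rule smooth_real_DERIV[OF smooth_smooth_step])

text \<open>The step takes its global minimum at every \<open>t \<le> 0\<close> and its global
  maximum at every \<open>t \<ge> 1\<close>. This treats the two end points together with the
  constant parts.\<close>

lemma partial_smooth_step_eq_0:
  assumes "t \<le> 0 \<or> t \<ge> 1" shows "partial 1 smooth_step t = 0"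
  using assms
proof
  assume "t \<le> 0"
  then show ?thesis
    using DERIV_local_min[OF smooth_step_DERIV[of t], of 1] smooth_step_range by simp
next
  assume "t \<ge> 1"
  then show ?thesis
    using DERIV_local_max[OF smooth_step_DERIV[of t], of 1] smooth_step_range by simp
qed

lemma partial_smooth_step_bounded: "\<exists>K>0. \<forall>t. \<bar>partial 1 smooth_step t\<bar> \<le> K"
proof -
  have "continuous_on {0..1} (partial 1 smooth_step)"
    by (rule smooth_continuous_on[OF smooth_partial[OF smooth_smooth_step]]) simp
  then have "bounded (partial 1 smooth_step ` {0..1})"
    using compact_Icc compact_continuous_image compact_imp_bounded by blast
  then obtain K where "K > 0" and K: "\<And>t. t \<in> {0..1} \<Longrightarrow> \<bar>partial 1 smooth_step t\<bar> \<le> K"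
    unfolding bounded_pos by auto
  have "\<bar>partial 1 smooth_step t\<bar> \<le> K" for t
    using K[of t] partial_smooth_step_eq_0[of t] \<open>K > 0\<close> by (cases "t \<in> {0..1}") auto
  with \<open>K > 0\<close> show ?thesis by blast
qed

section \<open>Polynomials and cutoffs as a source of test functions\<close>

subsection \<open>Polynomials on the plane\<close>

abbreviation e1 :: plane where "e1 \<equiv> axis 1 1"

lemma e1_Basis [simp]: "e1 \<in> Basis" by (simp add: axis_in_Basis_iff)

lemma smooth_nth [simp, intro]: "smooth (\<lambda>x::plane. x $ i)"
  by (rule smooth_bounded_linear) (rule bounded_linear_vec_nth)

text \<open>Polynomials are dense by the Stone-Weierstrass theorem and have explicit antiderivatives
  in the direction \<open>e1\<close> within the same class. The second property is what the duality
  proof of Poincare's inequality relies on.\<close>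

inductive poly2 :: "(plane \<Rightarrow> real) \<Rightarrow> bool" where
  monom: "poly2 (\<lambda>x. c * (x $ 1) ^ i * (x $ 2) ^ j)"
| add: "poly2 f \<Longrightarrow> poly2 g \<Longrightarrow> poly2 (\<lambda>x. f x + g x)"

lemma poly2_const: "poly2 (\<lambda>x. c)"
  using poly2.monom[of c 0 0] by simp

lemma poly2_monom_mult: "poly2 g \<Longrightarrow> poly2 (\<lambda>x. (c * (x $ 1) ^ i * (x $ 2) ^ j) * g x)"
proof (induction rule: poly2.induct)
  case (monom d k l)
  have "(\<lambda>x::plane. (c * (x $ 1) ^ i * (x $ 2) ^ j) * (d * (x $ 1) ^ k * (x $ 2) ^ l))
      = (\<lambda>x. (c * d) * (x $ 1) ^ (i + k) * (x $ 2) ^ (j + l))"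
    by (simp add: power_add mult_ac)
  then show ?case by (metis poly2.monom)
next
  case (add f g)
  from poly2.add[OF add.IH] show ?case by (simp add: distrib_left)
qed

lemma poly2_mult: "poly2 f \<Longrightarrow> poly2 g \<Longrightarrow> poly2 (\<lambda>x. f x * g x)"
proof (induction rule: poly2.induct)
  case (add f h)
  from poly2.add[OF add.IH(1)[OF add.prems] add.IH(2)[OF add.prems]] show ?case
    by (simp add: distrib_right)
qed (rule poly2_monom_mult)

lemma poly2_smooth: "poly2 f \<Longrightarrow> smooth f"
  by (induction rule: poly2.induct)
    (intro smooth_mult smooth_add smooth_power smooth_const smooth_nth; assumption)+

lemma poly2_approximates_continuous:
  assumes "compact K" "continuous_on K f" "e > 0"
  shows "\<exists>g. poly2 g \<and> (\<forall>x\<in>K. \<bar>f x - g x\<bar> < e)"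
proof (rule Stone_Weierstrass_HOL[OF assms(1), where P = poly2])
  fix x y :: plane assume xy: "x \<in> K \<and> y \<in> K \<and> x \<noteq> y"
  then obtain i where i: "x $ i \<noteq> y $ i" by (auto simp: vec_eq_iff)
  have "poly2 (\<lambda>x. x $ i)"
    using exhaust_2[of i] poly2.monom[of 1 1 0] poly2.monom[of 1 0 1] by auto
  with i show "\<exists>f. poly2 f \<and> f x \<noteq> f y" by blast
qed (use assms in \<open>auto intro: poly2_const poly2.add poly2_mult poly2_smooth smooth_continuous_on\<close>)

text \<open>A measurable function is an almost everywhere limit of continuous functions. Truncating
  these to \<open>[-B, B]\<close> makes them uniformly bounded and does not change the limit, and
  each is then approximated on \<open>K\<close> within \<open>1 / (n + 1)\<close>. The uniform bound
  allows dominated convergence later.\<close>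

lemma poly2_approximates_measurable:
  fixes h :: "plane \<Rightarrow> real"
  assumes h: "h \<in> borel_measurable lebesgue" and B: "\<And>x. \<bar>h x\<bar> \<le> B" and K: "compact K"
  obtains P where "\<And>n. poly2 (P n)" "\<And>n x. x \<in> K \<Longrightarrow> \<bar>P n x\<bar> \<le> B + 1"
    "AE x in lebesgue. x \<in> K \<longrightarrow> (\<lambda>n::nat. P n x) \<longlonglongrightarrow> h x"
proof -
  have "h measurable_on UNIV"
    using h by (simp add: measurable_on_iff_borel_measurable)
  then obtain N g where N: "negligible N" and g: "\<And>n. continuous_on UNIV (g n)"
    and lim: "\<And>x. x \<notin> N \<Longrightarrow> (\<lambda>n. g n x) \<longlonglongrightarrow> h x"
    unfolding measurable_on_def by auto
  have B0: "B \<ge> 0" using B[of 0] by linarith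
  define c where "c n x = max (- B) (min B (g n x))" for n :: nat and x
  have c: "continuous_on K (c n)" for n
    unfolding c_def by (intro continuous_intros continuous_on_subset[OF g]) auto
  have "\<exists>p. poly2 p \<and> (\<forall>x\<in>K. \<bar>c n x - p x\<bar> < 1 / real (Suc n))" for n
    by (rule poly2_approximates_continuous[OF K c]) simp
  then obtain P where P: "\<And>n. poly2 (P n)" "\<And>n x. x \<in> K \<Longrightarrow> \<bar>c n x - P n x\<bar> < 1 / real (Suc n)"
    by metis
  show thesis
  proof
    show "poly2 (P n)" for n by (rule P)
    show "\<bar>P n x\<bar> \<le> B + 1" if "x \<in> K" for n x
    proof -
      have "1 / real (Suc n) \<le> 1" by simp
      moreover have "\<bar>c n x\<bar> \<le> B" using B0 by (auto simp: c_def)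
      ultimately show ?thesis using P(2)[OF that, of n] by linarith
    qed
    have "(\<lambda>n. P n x) \<longlonglongrightarrow> h x" if x: "x \<notin> N" "x \<in> K" for x
    proof -
      have "(\<lambda>n. c n x) \<longlonglongrightarrow> max (- B) (min B (h x))"
        unfolding c_def by (intro tendsto_intros lim x)
      also have "max (- B) (min B (h x)) = h x" using B[of x] by auto
      finally have "(\<lambda>n. c n x) \<longlonglongrightarrow> h x" .
      moreover have "(\<lambda>n. P n x - c n x) \<longlonglongrightarrow> 0"
      proof (rule Lim_null_comparison)
        show "\<forall>\<^sub>F n in sequentially. norm (P n x - c n x) \<le> 1 / real (Suc n)"
          using P(2)[OF x(2)] by (intro always_eventually allI) (simp add: abs_minus_commute less_imp_le)
        show "(\<lambda>n. 1 / real (Suc n)) \<longlonglongrightarrow> 0" by (rule LIMSEQ_Suc[OF lim_1_over_n])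
      qed
      ultimately have "(\<lambda>n. c n x + (P n x - c n x)) \<longlonglongrightarrow> h x + 0" by (rule tendsto_add)
      then show ?thesis by simp
    qed
    then have "{x. \<not> (x \<in> K \<longrightarrow> (\<lambda>n. P n x) \<longlonglongrightarrow> h x)} \<subseteq> N" by blast
    with N show "AE x in lebesgue. x \<in> K \<longrightarrow> (\<lambda>n. P n x) \<longlonglongrightarrow> h x"
      by (intro AE_I'[where N = N]) (auto simp: negligible_iff_null_sets)
  qed
qed

lemma poly2_antiderivative:
  "poly2 f \<Longrightarrow> \<exists>F. poly2 F \<and> partial e1 F = f \<and> (\<forall>x. x $ 1 = c \<longrightarrow> F x = 0)"
proof (induction rule: poly2.induct)
  case (monom d i j)
  define k where "k = d / real (Suc i)"
  have d: "d = k * real (Suc i)" by (simp add: k_def)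
  \<comment> \<open>The second monomial has degree \<open>0\<close> in the first coordinate. It is
    the constant of integration that makes the antiderivative vanish on the line
    \<open>x $ 1 = c\<close>.\<close>
  let ?F = "\<lambda>x::plane. k * (x $ 1) ^ Suc i * (x $ 2) ^ j + (- k * c ^ Suc i) * (x $ 1) ^ 0 * (x $ 2) ^ j"
  have "(?F has_derivative (\<lambda>y. d * (x $ 1) ^ i * (x $ 2) ^ j * y $ 1 +
      (k * (x $ 1) ^ Suc i - k * c ^ Suc i) * (real j * (x $ 2) ^ (j - 1) * y $ 2))) (at x)" for x
    unfolding d
    by (rule derivative_eq_intros bounded_linear_imp_has_derivative[OF bounded_linear_vec_nth] refl)+
      (auto simp: algebra_simps fun_eq_iff)
  then have "partial e1 ?F x = d * (x $ 1) ^ i * (x $ 2) ^ j" for x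
    by (subst partial_eqI) (assumption, simp add: axis_def)
  moreover have "poly2 ?F" by (intro poly2.intros)
  moreover have "?F x = 0" if "x $ 1 = c" for x using that by simp
  ultimately show ?case by (intro exI[of _ ?F]) blast
next
  case (add f g)
  then obtain F G where "poly2 F" "partial e1 F = f" "\<And>x. x $ 1 = c \<Longrightarrow> F x = 0"
    and "poly2 G" "partial e1 G = g" "\<And>x. x $ 1 = c \<Longrightarrow> G x = 0" by blast
  then show ?case
    by (intro exI[of _ "\<lambda>x. F x + G x"])
      (auto intro: poly2.add simp: partial_add smooth_differentiable poly2_smooth)
qed

text \<open>Boxes with lower left corner \<open>c\<close>, in two versions: functions that vanish on
  the open box have vanishing derivatives there, while the closed box is compact and so a domain of
  integration for locally integrable functions.\<close>

definition Box :: "plane \<Rightarrow> real \<Rightarrow> plane set" where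
  "Box c l = {x. c $ 1 < x $ 1 \<and> x $ 1 < c $ 1 + l \<and> c $ 2 < x $ 2 \<and> x $ 2 < c $ 2 + l}"

definition CBox :: "plane \<Rightarrow> real \<Rightarrow> plane set" where
  "CBox c l = {x. c $ 1 \<le> x $ 1 \<and> x $ 1 \<le> c $ 1 + l \<and> c $ 2 \<le> x $ 2 \<and> x $ 2 \<le> c $ 2 + l}"

lemma Box_eq_box: "Box c l = box c (c + vector [l, l])"
  by (auto simp: Box_def mem_box_cart forall_2)

lemma CBox_eq_cbox: "CBox c l = cbox c (c + vector [l, l])"
  by (auto simp: CBox_def mem_box_cart forall_2)

lemma Box_subset_CBox: "Box c l \<subseteq> CBox c l"
  by (auto simp: Box_def CBox_def)

text \<open>Mean value inequality along the horizontal segment from the left side of the box, where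
  \<open>F\<close> vanishes, to \<open>x\<close>.\<close>

lemma partial_bound_imp_bound:
  assumes F: "smooth F" and F0: "\<And>x. x $ 1 = c $ 1 \<Longrightarrow> F x = 0"
    and B: "\<And>x. x \<in> CBox c l \<Longrightarrow> \<bar>partial e1 F x\<bar> \<le> B" and x: "x \<in> CBox c l"
  shows "\<bar>F x\<bar> \<le> l * B"
proof -
  define \<gamma> where "\<gamma> t = x + (t - x $ 1) *\<^sub>R e1" for t
  have \<gamma>: "\<gamma> t $ 1 = t" "\<gamma> t $ 2 = x $ 2" for t by (simp_all add: \<gamma>_def axis_def)
  have d: "((\<lambda>t. F (\<gamma> t)) has_real_derivative partial e1 F (\<gamma> t)) (at t)" for t
  proof -
    have 1: "(\<gamma> has_derivative (\<lambda>h. h *\<^sub>R e1)) (at t)"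
      unfolding \<gamma>_def by (auto intro!: derivative_eq_intros)
    from has_derivative_compose[OF 1 smooth_has_derivative[OF F]]
    have "((\<lambda>t. F (\<gamma> t)) has_derivative (\<lambda>h. frechet_derivative F (at (\<gamma> t)) (h *\<^sub>R e1))) (at t)" .
    also have "(\<lambda>h. frechet_derivative F (at (\<gamma> t)) (h *\<^sub>R e1)) = (*) (partial e1 F (\<gamma> t))"
      using linear_frechet_derivative[OF smooth_differentiable[OF F]] by (auto simp: linear_cmul)
    finally show ?thesis by (simp add: has_field_derivative_def)
  qed
  have x1: "c $ 1 \<le> x $ 1" "x $ 1 - c $ 1 \<le> l" using x by (auto simp: CBox_def)
  have B0: "B \<ge> 0" using B[OF x] by linarith
  have "norm (F (\<gamma> (x $ 1)) - F (\<gamma> (c $ 1))) \<le> B * norm (x $ 1 - c $ 1)"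
  proof (rule field_differentiable_bound[of "{c $ 1..x $ 1}" "\<lambda>t. F (\<gamma> t)" "\<lambda>t. partial e1 F (\<gamma> t)"])
    show "norm (partial e1 F (\<gamma> t)) \<le> B" if "t \<in> {c $ 1..x $ 1}" for t
      using B[of "\<gamma> t"] that x by (auto simp: CBox_def \<gamma>)
  qed (use x1 d in \<open>auto intro: has_field_derivative_at_within\<close>)
  moreover have "F (\<gamma> (c $ 1)) = 0" by (rule F0) (simp add: \<gamma>)
  moreover have "\<gamma> (x $ 1) = x" by (simp add: \<gamma>_def)
  ultimately have "\<bar>F x\<bar> \<le> B * (x $ 1 - c $ 1)" using x1 by simp
  also have "\<dots> \<le> B * l" using B0 x1 by (intro mult_left_mono)
  finally show ?thesis by (simp add: mult.commute)
qed

text \<open>Every integration starts at the left side of the box and hence costs one factor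
  \<open>l\<close>.\<close>

lemma poly2_iterated_antiderivative:
  assumes "poly2 f" "\<And>x. x \<in> CBox c l \<Longrightarrow> \<bar>f x\<bar> \<le> B"
  shows "\<exists>F. poly2 F \<and> iter_deriv (replicate k e1) F = f \<and> (\<forall>x\<in>CBox c l. \<bar>F x\<bar> \<le> l ^ k * B)"
  using assms
proof (induction k arbitrary: f B)
  case (Suc k)
  from poly2_antiderivative[OF Suc.prems(1), of "c $ 1"] obtain G where
    G: "poly2 G" "partial e1 G = f" "\<And>x. x $ 1 = c $ 1 \<Longrightarrow> G x = 0" by blast
  have "\<bar>G x\<bar> \<le> l * B" if "x \<in> CBox c l" for x
    by (rule partial_bound_imp_bound[OF poly2_smooth[OF G(1)] G(3) _ that]) (use G(2) Suc.prems(2) in auto)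
  from Suc.IH[OF G(1) this] G(2) show ?case by (auto simp: mult_ac)
qed auto

subsection \<open>Cutoff functions\<close>

definition cutoff :: "real \<Rightarrow> plane \<Rightarrow> real" where
  "cutoff R x = smooth_step (R + 2 + x $ 1) * smooth_step (R + 2 - x $ 1) *
     (smooth_step (R + 2 + x $ 2) * smooth_step (R + 2 - x $ 2))"

lemma cutoff_eq_1: "\<bar>x $ 1\<bar> \<le> R + 1 \<Longrightarrow> \<bar>x $ 2\<bar> \<le> R + 1 \<Longrightarrow> cutoff R x = 1"
  by (simp add: cutoff_def abs_le_iff)

lemma cutoff_range: "0 \<le> cutoff R x" "cutoff R x \<le> 1"
  unfolding cutoff_def using smooth_step_range
  by (auto intro!: mult_nonneg_nonneg mult_le_one)

lemma smooth_cutoff: "smooth (cutoff R)"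
  unfolding cutoff_def
  by (intro smooth_mult smooth_compose[OF smooth_smooth_step] smooth_add smooth_diff smooth_const smooth_nth)

lemma cutoff_test_function: "test_function UNIV (cutoff R)"
  unfolding test_function_def
proof (intro conjI exI[of _ "cbox (vector [- R - 2, - R - 2]) (vector [R + 2, R + 2]) :: plane set"] allI impI)
  fix x :: plane assume "x \<notin> cbox (vector [- R - 2, - R - 2]) (vector [R + 2, R + 2])"
  then consider "R + 2 + x $ 1 \<le> 0" | "R + 2 - x $ 1 \<le> 0" | "R + 2 + x $ 2 \<le> 0" | "R + 2 - x $ 2 \<le> 0"
    by (fastforce simp: mem_box_cart forall_2 not_le)
  then show "cutoff R x = 0" by cases (simp_all add: cutoff_def)
qed (auto simp: smooth_cutoff)

lemma test_function_mult:
  assumes "test_function U f" "smooth g"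
  shows "test_function U (\<lambda>x. f x * g x)"
  using assms unfolding test_function_def by (metis mult_zero_left smooth_mult)

text \<open>The cutoff is one on an open neighbourhood, not merely on \<open>K\<close>, so that
  multiplication by it leaves all derivatives on \<open>K\<close> unchanged.\<close>

lemma cutoff_eq_1_nbhd:
  assumes "bounded K"
  obtains R W where "open W" "K \<subseteq> W" "\<And>x. x \<in> W \<Longrightarrow> cutoff R x = 1"
proof -
  obtain R where R: "\<And>x. x \<in> K \<Longrightarrow> norm x \<le> R" using assms unfolding bounded_iff by blast
  show thesis
  proof (rule that[of "ball 0 (R + 1)" R])
    show "K \<subseteq> ball 0 (R + 1)" using R by force
    show "cutoff R x = 1" if "x \<in> ball 0 (R + 1)" for x
      using that component_le_norm_cart[of x 1] component_le_norm_cart[of x 2]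
      by (intro cutoff_eq_1) auto
  qed auto
qed

section \<open>Rescaling, localisation and size of weak gradients\<close>

subsection \<open>Lebesgue measure under dilations\<close>

lemma lebesgue_dilation:
  fixes d :: "'a::euclidean_space" and l :: real
  assumes l: "l \<noteq> 0"
  shows lebesgue_dilation_measurable: "(\<lambda>x. d + l *\<^sub>R x) \<in> lebesgue \<rightarrow>\<^sub>M lebesgue"
    and lebesgue_dilation_density: "lebesgue = density (distr lebesgue lebesgue (\<lambda>x. d + l *\<^sub>R x)) (\<lambda>_. ennreal (\<bar>l\<bar> ^ DIM('a)))"
proof -
  have eq: "(\<lambda>x. d + (\<Sum>j\<in>Basis. (l * (x \<bullet> j)) *\<^sub>R j)) = (\<lambda>x. d + l *\<^sub>R x)"
    unfolding scaleR_scaleR[symmetric] scaleR_sum_right[symmetric] euclidean_representation ..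
  show "(\<lambda>x. d + l *\<^sub>R x) \<in> lebesgue \<rightarrow>\<^sub>M lebesgue"
    using lebesgue_affine_measurable[of "\<lambda>_. l" d] l unfolding eq by simp
  show "lebesgue = density (distr lebesgue lebesgue (\<lambda>x. d + l *\<^sub>R x)) (\<lambda>_. ennreal (\<bar>l\<bar> ^ DIM('a)))"
    using lebesgue_affine_euclidean[of "\<lambda>_. l" d] l unfolding eq by simp
qed

lemma nn_integral_dilation:
  fixes d :: "'a::euclidean_space" and l :: real
  assumes l: "l \<noteq> 0" and f[measurable]: "f \<in> borel_measurable lebesgue"
  shows "(\<integral>\<^sup>+x. f x \<partial>lebesgue) = ennreal (\<bar>l\<bar> ^ DIM('a)) * (\<integral>\<^sup>+x. f (d + l *\<^sub>R x) \<partial>lebesgue)"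
proof -
  note [measurable] = lebesgue_dilation_measurable[OF l, of d]
  have "(\<integral>\<^sup>+x. f x \<partial>lebesgue) = (\<integral>\<^sup>+x. f x \<partial>density (distr lebesgue lebesgue (\<lambda>x. d + l *\<^sub>R x)) (\<lambda>_. ennreal (\<bar>l\<bar> ^ DIM('a))))"
    using lebesgue_dilation_density[OF l, of d] by simp
  also have "\<dots> = ennreal (\<bar>l\<bar> ^ DIM('a)) * (\<integral>\<^sup>+x. f (d + l *\<^sub>R x) \<partial>lebesgue)"
    by (subst nn_integral_density) (auto simp: nn_integral_distr nn_integral_cmult)
  finally show ?thesis .
qed

lemma AE_dilation:
  fixes d :: "'a::euclidean_space" and l :: real
  assumes l: "l \<noteq> 0" and P: "AE x in lebesgue. P x"
  shows "AE x in lebesgue. P (d + l *\<^sub>R x)"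
proof -
  obtain N where N: "N \<in> null_sets lebesgue" "{x. \<not> P x} \<subseteq> N"
    using P by (auto simp: eventually_ae_filter)
  have m: "(\<lambda>x. indicator N (d + l *\<^sub>R x) :: ennreal) \<in> borel_measurable lebesgue"
    using N(1) by (intro measurable_compose[OF lebesgue_dilation_measurable[OF l]] borel_measurable_indicator) auto
  have "ennreal (\<bar>l\<bar> ^ DIM('a)) * (\<integral>\<^sup>+x. indicator N (d + l *\<^sub>R x) \<partial>lebesgue) = 0"
    using N(1) by (subst nn_integral_dilation[OF l, symmetric]) (auto simp: null_sets_def)
  then have "(\<integral>\<^sup>+x. indicator N (d + l *\<^sub>R x) \<partial>lebesgue) = 0"
    using l by simp
  then have "AE x in lebesgue. (indicator N (d + l *\<^sub>R x) :: ennreal) = 0"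
    using nn_integral_0_iff_AE[OF m] by simp
  then show ?thesis using N(2) by (auto elim!: eventually_mono split: split_indicator_asm)
qed

lemma borel_measurable_dilation:
  fixes d :: "'a::euclidean_space"
  assumes "l \<noteq> 0" "f \<in> borel_measurable lebesgue"
  shows "(\<lambda>x. f (d + l *\<^sub>R x)) \<in> borel_measurable lebesgue"
  using measurable_compose[OF lebesgue_dilation_measurable[OF assms(1)] assms(2)] .

lemma integrable_dilation:
  fixes d :: "'a::euclidean_space" and f :: "'a \<Rightarrow> 'b::euclidean_space"
  assumes l: "l \<noteq> 0" and f: "integrable lebesgue f"
  shows "integrable lebesgue (\<lambda>x. f (d + l *\<^sub>R x))"
proof (rule integrableI_bounded)
  have m: "f \<in> borel_measurable lebesgue" using f by auto
  then show "(\<lambda>x. f (d + l *\<^sub>R x)) \<in> borel_measurable lebesgue" by (rule borel_measurable_dilation[OF l])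
  have "(\<integral>\<^sup>+x. ennreal (norm (f x)) \<partial>lebesgue) < \<infinity>"
    using f by (simp add: integrable_iff_bounded)
  then show "(\<integral>\<^sup>+x. ennreal (norm (f (d + l *\<^sub>R x))) \<partial>lebesgue) < \<infinity>"
    using l m by (subst (asm) nn_integral_dilation[OF l, of _ d]) (auto simp: ennreal_mult_less_top)
qed

lemma integral_dilation:
  fixes d :: "'a::euclidean_space" and f :: "'a \<Rightarrow> 'b::euclidean_space"
  assumes l: "l \<noteq> 0"
  shows "(LINT x|lebesgue. f x) = (\<bar>l\<bar> ^ DIM('a)) *\<^sub>R (LINT x|lebesgue. f (d + l *\<^sub>R x))"
proof (cases "integrable lebesgue f")
  case True
  note [measurable] = lebesgue_dilation_measurable[OF l, of d]
  have m[measurable]: "f \<in> borel_measurable lebesgue" using True by auto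
  have "(LINT x|lebesgue. f x) = (LINT x|density (distr lebesgue lebesgue (\<lambda>x. d + l *\<^sub>R x)) (\<lambda>_. ennreal (\<bar>l\<bar> ^ DIM('a))). f x)"
    using lebesgue_dilation_density[OF l, of d] by simp
  also have "\<dots> = (\<bar>l\<bar> ^ DIM('a)) *\<^sub>R (LINT x|lebesgue. f (d + l *\<^sub>R x))"
    by (subst integral_density) (auto simp: integral_distr)
  finally show ?thesis .
next
  case False
  \<comment> \<open>Both integrals are \<open>0\<close> by convention once neither function is
    integrable; the inverse dilation carries integrability back.\<close>
  have "\<not> integrable lebesgue (\<lambda>x. f (d + l *\<^sub>R x))"
  proof
    assume "integrable lebesgue (\<lambda>x. f (d + l *\<^sub>R x))"
    from integrable_dilation[OF _ this, of "inverse l" "- inverse l *\<^sub>R d"] l False show False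
      by (simp add: algebra_simps)
  qed
  with False show ?thesis by (simp add: not_integrable_integral_eq)
qed

subsection \<open>Locally integrable functions\<close>

lemma locally_integrable_UNIV:
  "locally_integrable_on g UNIV \<longleftrightarrow> (\<forall>K. compact K \<longrightarrow> integrable lebesgue (\<lambda>x. indicat_real K x *\<^sub>R g x))"
  by (simp add: locally_integrable_on_def set_integrable_def)

lemma locally_integrable_1: "locally_integrable_on (\<lambda>x. 1::real) UNIV"
  unfolding locally_integrable_UNIV
  by (auto simp: lmeasurable_compact simp flip: lmeasurable_iff_integrable)

lemma locally_integrable_measurable:
  assumes "locally_integrable_on g UNIV"
  shows "g \<in> borel_measurable lebesgue"
proof (rule borel_measurable_LIMSEQ_metric)
  show "(\<lambda>x. indicat_real (cball 0 (real n)) x *\<^sub>R g x) \<in> borel_measurable lebesgue" for n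
    using assms unfolding locally_integrable_UNIV by (metis compact_cball borel_measurable_integrable)
  fix x
  have "\<forall>\<^sub>F n in sequentially. indicat_real (cball 0 (real n)) x *\<^sub>R g x = g x"
    using eventually_ge_at_top[of "nat \<lceil>norm x\<rceil>"]
  proof eventually_elim
    case (elim n)
    then have "norm x \<le> real n" by linarith
    then show ?case by simp
  qed
  then show "(\<lambda>n. indicat_real (cball 0 (real n)) x *\<^sub>R g x) \<longlonglongrightarrow> g x"
    by (rule tendsto_eventually)
qed

text \<open>The product is required to vanish outside \<open>K\<close>, since either factor can be
  the compactly supported one: a test function, or a velocity field that lives on a tile.\<close>

lemma locally_integrable_times:
  assumes g: "locally_integrable_on g UNIV" and K: "compact K"
    and m: "f \<in> borel_measurable lebesgue" and B: "\<And>x. x \<in> K \<Longrightarrow> \<bar>f x\<bar> \<le> B"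
    and 0: "\<And>x. x \<notin> K \<Longrightarrow> f x *\<^sub>R g x = 0"
  shows "integrable lebesgue (\<lambda>x. f x *\<^sub>R g x)"
proof (rule Bochner_Integration.integrable_bound)
  show "integrable lebesgue (\<lambda>x. B *\<^sub>R (indicat_real K x *\<^sub>R g x))"
    by (intro integrable_scaleR_right) (use g K in \<open>simp add: locally_integrable_UNIV\<close>)
  show "(\<lambda>x. f x *\<^sub>R g x) \<in> borel_measurable lebesgue"
    by (intro borel_measurable_scaleR m locally_integrable_measurable[OF g])
  have "norm (f x *\<^sub>R g x) \<le> norm (B *\<^sub>R (indicat_real K x *\<^sub>R g x))" for x
    using B[of x] 0[of x] by (cases "x \<in> K") (auto intro!: mult_right_mono)
  then show "AE x in lebesgue. norm (f x *\<^sub>R g x) \<le> norm (B *\<^sub>R (indicat_real K x *\<^sub>R g x))" by simp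
qed

lemma smooth_lebesgue_measurable: "smooth f \<Longrightarrow> f \<in> borel_measurable lebesgue"
  using smooth_measurable measurable_completion by (metis lborelD measurable_lborel2)

lemma locally_integrable_times_test:
  assumes "locally_integrable_on g UNIV" "test_function UNIV f"
  shows "integrable lebesgue (\<lambda>x. f x *\<^sub>R g x)"
proof -
  obtain K where K: "compact K" "\<And>x. x \<notin> K \<Longrightarrow> f x = 0" and s: "smooth f"
    using assms(2) unfolding test_function_def by blast
  have "bounded (f ` K)"
    using compact_continuous_image[OF smooth_continuous_on[OF s] K(1)] compact_imp_bounded by blast
  then obtain B where "\<And>x. x \<in> K \<Longrightarrow> \<bar>f x\<bar> \<le> B" unfolding bounded_iff by auto
  then show ?thesis
    using K by (intro locally_integrable_times[OF assms(1) K(1) smooth_lebesgue_measurable[OF s]]) auto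
qed

lemma iter_deriv_const:
  "vs \<noteq> [] \<Longrightarrow> iter_deriv vs (\<lambda>x. c) = (\<lambda>x. 0)"
proof (induction vs)
  case (Cons v vs)
  then show ?case by (cases "vs = []") (auto simp: frechet_derivative_const)
qed simp

lemma iter_deriv_zero_open:
  assumes "open U" "\<And>x. x \<in> U \<Longrightarrow> f x = 0" "x \<in> U"
  shows "iter_deriv vs f x = 0"
proof -
  have "iter_deriv vs (\<lambda>x. 0) x = 0" for x :: 'a
    using iter_deriv_const[of vs 0] by (cases "vs = []") simp_all
  then show ?thesis using iter_deriv_cong_open[of U f "\<lambda>x. 0", OF assms(1) _ assms(3)] assms(2) by simp
qed

lemma test_function_iter_deriv:
  assumes "test_function UNIV f" "set vs \<subseteq> Basis"
  shows "test_function UNIV (iter_deriv vs f)"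
proof -
  obtain K where K: "compact K" "\<And>x. x \<notin> K \<Longrightarrow> f x = 0" and s: "smooth f"
    using assms(1) unfolding test_function_def by blast
  have "iter_deriv vs f x = 0" if "x \<notin> K" for x
    by (rule iter_deriv_zero_open[of "- K"]) (use K that in \<open>auto simp: compact_imp_closed open_Compl\<close>)
  then show ?thesis
    unfolding test_function_def using K(1) smooth_iter_deriv[OF s assms(2)] by blast
qed

text \<open>It suffices to test with polynomials times a cutoff, because the bounded measurable function
  \<open>sgn (g x \<bullet> b)\<close> is an almost everywhere limit of bounded polynomials on compact sets.\<close>

lemma fundamental_lemma:
  fixes g :: "plane \<Rightarrow> 'b::euclidean_space"
  assumes g: "locally_integrable_on g UNIV" and \<eta>: "smooth \<eta>" "\<And>x. \<eta> x \<ge> 0"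
    and zero: "\<And>\<phi>. test_function UNIV \<phi> \<Longrightarrow> (LINT x|lebesgue. (\<phi> x * \<eta> x) *\<^sub>R g x) = 0"
  shows "AE x in lebesgue. \<eta> x \<noteq> 0 \<longrightarrow> g x = 0"
proof -
  have gm[measurable]: "g \<in> borel_measurable lebesgue" by (rule locally_integrable_measurable[OF g])
  have *: "AE x in lebesgue. cutoff (real N) x * \<eta> x * \<bar>g x \<bullet> b\<bar> = 0" if b: "b \<in> Basis" for N b
  proof -
    define h where "h x = sgn (g x \<bullet> b)" for x
    obtain K where K: "compact K" "\<And>x. x \<notin> K \<Longrightarrow> cutoff (real N) x = 0"
      using cutoff_test_function unfolding test_function_def by blast
    have hm: "h \<in> borel_measurable lebesgue" unfolding h_def by measurable
    have "\<bar>h x\<bar> \<le> 1" for x by (simp add: h_def sgn_if)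
    from poly2_approximates_measurable[OF hm this K(1)] obtain P where
      P: "\<And>n. poly2 (P n)" "\<And>n x. x \<in> K \<Longrightarrow> \<bar>P n x\<bar> \<le> 1 + 1"
      "AE x in lebesgue. x \<in> K \<longrightarrow> (\<lambda>n. P n x) \<longlonglongrightarrow> h x" by blast
    define w where "w x = cutoff (real N) x * \<eta> x" for x
    have w0: "w x = 0" if "x \<notin> K" for x using K(2)[OF that] by (simp add: w_def)
    have wnn: "w x \<ge> 0" for x using \<eta>(2) cutoff_range by (simp add: w_def)
    have wt: "test_function UNIV w"
      unfolding w_def by (rule test_function_mult[OF cutoff_test_function \<eta>(1)])
    have wint: "integrable lebesgue (\<lambda>x. w x *\<^sub>R g x)"
      by (rule locally_integrable_times_test[OF g wt])
    have [measurable]: "w \<in> borel_measurable lebesgue" "P n \<in> borel_measurable lebesgue" for n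
      using wt P(1) by (auto simp: test_function_def poly2_smooth smooth_lebesgue_measurable)
    note [measurable] = hm
    have z: "(LINT x|lebesgue. w x * P n x * (g x \<bullet> b)) = 0" for n
    proof -
      have "test_function UNIV (\<lambda>x. cutoff (real N) x * P n x)"
        by (rule test_function_mult[OF cutoff_test_function poly2_smooth[OF P(1)]])
      from zero[OF this] have "(LINT x|lebesgue. (w x * P n x) *\<^sub>R g x) = 0"
        by (simp add: w_def mult_ac)
      moreover have "integrable lebesgue (\<lambda>x. (w x * P n x) *\<^sub>R g x)"
        by (rule locally_integrable_times_test[OF g test_function_mult[OF wt poly2_smooth[OF P(1)]]])
      ultimately show ?thesis
        by (metis (no_types, lifting) inner_scaleR_left inner_zero_left integral_inner_left Bochner_Integration.integral_cong)
    qed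
    have lim: "(\<lambda>n. LINT x|lebesgue. w x * P n x * (g x \<bullet> b)) \<longlonglongrightarrow> (LINT x|lebesgue. w x * h x * (g x \<bullet> b))"
    proof (rule integral_dominated_convergence[where w = "\<lambda>x. 2 * norm (w x *\<^sub>R g x)"])
      show "integrable lebesgue (\<lambda>x. 2 * norm (w x *\<^sub>R g x))"
        by (intro integrable_mult_right integrable_norm wint)
      show "AE x in lebesgue. (\<lambda>n. w x * P n x * (g x \<bullet> b)) \<longlonglongrightarrow> w x * h x * (g x \<bullet> b)"
        using P(3)
      proof eventually_elim
        case (elim x)
        then show ?case
          using w0[of x] by (cases "x \<in> K") (auto intro!: tendsto_intros)
      qed
      show "AE x in lebesgue. norm (w x * P n x * (g x \<bullet> b)) \<le> 2 * norm (w x *\<^sub>R g x)" for n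
      proof (intro always_eventually allI)
        fix x
        show "norm (w x * P n x * (g x \<bullet> b)) \<le> 2 * norm (w x *\<^sub>R g x)"
        proof (cases "x \<in> K")
          case True
          have "\<bar>w x\<bar> * (\<bar>P n x\<bar> * \<bar>g x \<bullet> b\<bar>) \<le> \<bar>w x\<bar> * (2 * norm (g x))"
            using P(2)[OF True, of n] Basis_le_norm[OF b, of "g x"] by (intro mult_left_mono mult_mono) auto
          then show ?thesis by (simp add: abs_mult mult_ac)
        qed (simp add: w0)
      qed
    qed measurable
    have eq: "w x * h x * (g x \<bullet> b) = w x * \<bar>g x \<bullet> b\<bar>" for x
      by (simp add: h_def sgn_if)
    have "(LINT x|lebesgue. w x * \<bar>g x \<bullet> b\<bar>) = 0"
      using LIMSEQ_unique[OF lim] by (simp add: z eq)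
    moreover have "integrable lebesgue (\<lambda>x. w x * \<bar>g x \<bullet> b\<bar>)"
      using integrable_abs[OF integrable_inner_left[OF wint, of b]] wnn by (simp add: abs_mult)
    ultimately show ?thesis
      using integral_nonneg_eq_0_iff_AE[of lebesgue "\<lambda>x. w x * \<bar>g x \<bullet> b\<bar>"] wnn
      by (simp add: w_def)
  qed
  then have "AE x in lebesgue. \<forall>N. \<forall>b\<in>Basis. cutoff (real N) x * \<eta> x * \<bar>g x \<bullet> b\<bar> = 0"
    by (intro AE_all_countable[THEN iffD2] allI AE_finite_allI finite_Basis)
  then show ?thesis
  proof eventually_elim
    case (elim x)
    define N where "N = nat \<lceil>norm x\<rceil>"
    have "norm x \<le> real N" unfolding N_def by linarith
    then have "cutoff (real N) x = 1"
      using component_le_norm_cart[of x 1] component_le_norm_cart[of x 2] by (intro cutoff_eq_1) auto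
    with elim show ?case by (metis abs_eq_0 euclidean_all_zero_iff mult_1 mult_eq_0_iff)
  qed
qed

subsection \<open>Weak gradients\<close>

lemma dirs_Basis: "vs \<in> dirs k \<Longrightarrow> set vs \<subseteq> Basis" by (simp add: dirs_def)

lemma dirs_replicate [simp]: "replicate k e1 \<in> dirs k" by (auto simp: dirs_def)

lemma finite_dirs: "finite (dirs k)"
  unfolding dirs_def using finite_lists_length_eq[of "Basis :: plane set" k] by simp

lemma weak_gradientD:
  assumes "weak_gradient k f G"
  shows "locally_integrable_on f UNIV" "vs \<in> dirs k \<Longrightarrow> locally_integrable_on (G vs) UNIV"
    "vs \<in> dirs k \<Longrightarrow> test_function UNIV \<phi> \<Longrightarrow>
      (LINT x|lebesgue. iter_deriv vs \<phi> x *\<^sub>R f x) = (-1) ^ k *\<^sub>R (LINT x|lebesgue. \<phi> x *\<^sub>R G vs x)"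
  using assms unfolding weak_gradient_def by blast+

lemma weak_gradient_test_integrable:
  assumes "weak_gradient k f G" "vs \<in> dirs k" "test_function UNIV \<phi>"
  shows "integrable lebesgue (\<lambda>x. iter_deriv vs \<phi> x *\<^sub>R f x)" "integrable lebesgue (\<lambda>x. \<phi> x *\<^sub>R G vs x)"
  using assms by (auto intro!: locally_integrable_times_test test_function_iter_deriv
    intro: weak_gradientD dest: dirs_Basis)

lemma locally_integrable_AE_cong:
  assumes "locally_integrable_on f UNIV" "AE x in lebesgue. f x = g x"
  shows "locally_integrable_on g UNIV"
proof -
  have f: "f \<in> borel_measurable lebesgue" by (rule locally_integrable_measurable[OF assms(1)])
  then have g: "g \<in> borel_measurable lebesgue"
    using assms(2) by (rule borel_measurable_AE)
  show ?thesis
    unfolding locally_integrable_UNIV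
  proof safe
    fix K :: "'a set" assume K: "compact K"
    show "integrable lebesgue (\<lambda>x. indicat_real K x *\<^sub>R g x)"
    proof (rule integrable_cong_AE_imp)
      show "integrable lebesgue (\<lambda>x. indicat_real K x *\<^sub>R f x)"
        using assms(1) K by (simp add: locally_integrable_UNIV)
      have "indicat_real K \<in> borel_measurable lebesgue"
        using K by (intro borel_measurable_indicator) (simp add: lmeasurable_compact fmeasurableD)
      then show "(\<lambda>x. indicat_real K x *\<^sub>R g x) \<in> borel_measurable lebesgue"
        using g by (rule borel_measurable_scaleR)
      show "AE x in lebesgue. indicat_real K x *\<^sub>R f x = indicat_real K x *\<^sub>R g x"
        using assms(2) by eventually_elim simp
    qed
  qed
qed

lemma weak_gradient_AE_cong:
  assumes "weak_gradient k f G" "AE x in lebesgue. f x = g x"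
  shows "weak_gradient k g G"
proof -
  have g: "locally_integrable_on g UNIV"
    using locally_integrable_AE_cong[OF weak_gradientD(1)[OF assms(1)] assms(2)] .
  have "(LINT x|lebesgue. iter_deriv vs \<phi> x *\<^sub>R g x) = (LINT x|lebesgue. iter_deriv vs \<phi> x *\<^sub>R f x)"
    if "vs \<in> dirs k" "test_function UNIV \<phi>" for vs \<phi>
  proof (rule integral_cong_AE)
    have "iter_deriv vs \<phi> \<in> borel_measurable lebesgue"
      using that by (auto simp: test_function_def intro!: smooth_lebesgue_measurable smooth_iter_deriv dest: dirs_Basis)
    then show "(\<lambda>x. iter_deriv vs \<phi> x *\<^sub>R g x) \<in> borel_measurable lebesgue"
      "(\<lambda>x. iter_deriv vs \<phi> x *\<^sub>R f x) \<in> borel_measurable lebesgue"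
      using locally_integrable_measurable[OF g] locally_integrable_measurable[OF weak_gradientD(1)[OF assms(1)]]
      by (auto intro!: borel_measurable_scaleR)
  qed (use assms(2) in \<open>auto elim!: eventually_mono\<close>)
  with assms(1) g show ?thesis unfolding weak_gradient_def by auto
qed

lemma locally_integrable_add:
  "locally_integrable_on f UNIV \<Longrightarrow> locally_integrable_on g UNIV \<Longrightarrow> locally_integrable_on (\<lambda>x. f x + g x) UNIV"
  unfolding locally_integrable_UNIV by (simp add: scaleR_add_right)

lemma locally_integrable_scaleR:
  "locally_integrable_on f UNIV \<Longrightarrow> locally_integrable_on (\<lambda>x. c *\<^sub>R f x) UNIV"
  unfolding locally_integrable_UNIV scaleR_left_commute[of _ c] by (intro allI impI integrable_scaleR_right) blast

lemma locally_integrable_diff: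
  "locally_integrable_on f UNIV \<Longrightarrow> locally_integrable_on g UNIV \<Longrightarrow> locally_integrable_on (\<lambda>x. f x - g x) UNIV"
  unfolding locally_integrable_UNIV by (simp add: scaleR_diff_right)

lemma weak_gradient_add:
  assumes "weak_gradient k f F" "weak_gradient k g G"
  shows "weak_gradient k (\<lambda>x. f x + g x) (\<lambda>vs x. F vs x + G vs x)"
  using assms weak_gradient_test_integrable[OF assms(1)] weak_gradient_test_integrable[OF assms(2)]
  unfolding weak_gradient_def by (simp add: locally_integrable_add scaleR_add_right)

lemma weak_gradient_0: "weak_gradient k (\<lambda>x. 0) (\<lambda>vs x. 0)"
  by (simp add: weak_gradient_def locally_integrable_UNIV)

lemma weak_gradient_sum:
  "finite I \<Longrightarrow> (\<And>i. i \<in> I \<Longrightarrow> weak_gradient k (f i) (F i)) \<Longrightarrow>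
    weak_gradient k (\<lambda>x. \<Sum>i\<in>I. f i x) (\<lambda>vs x. \<Sum>i\<in>I. F i vs x)"
  by (induction I rule: finite_induct) (auto intro: weak_gradient_0 weak_gradient_add)

lemma locally_integrable_dilation:
  assumes l: "l \<noteq> 0" and f: "locally_integrable_on f UNIV"
  shows "locally_integrable_on (\<lambda>x. f (d + l *\<^sub>R x)) UNIV"
  unfolding locally_integrable_UNIV
proof safe
  fix K :: "'a set" assume "compact K"
  define T where "T = (\<lambda>x. d + l *\<^sub>R x) ` K"
  have "compact T" unfolding T_def
    by (intro compact_continuous_image continuous_intros \<open>compact K\<close>)
  then have "integrable lebesgue (\<lambda>x. indicat_real T x *\<^sub>R f x)"
    using f by (simp add: locally_integrable_UNIV)
  from integrable_dilation[OF l this, of d]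
  have "integrable lebesgue (\<lambda>x. indicat_real T (d + l *\<^sub>R x) *\<^sub>R f (d + l *\<^sub>R x))" .
  moreover have "indicat_real T (d + l *\<^sub>R x) = indicat_real K x" for x
    using l by (auto simp: T_def indicator_def)
  ultimately show "integrable lebesgue (\<lambda>x. indicat_real K x *\<^sub>R f (d + l *\<^sub>R x))" by simp
qed

lemma test_function_dilation:
  assumes "test_function UNIV \<phi>" "l \<noteq> 0"
  shows "test_function UNIV (\<lambda>x. \<phi> (d + l *\<^sub>R x))"
proof -
  obtain K where K: "compact K" "\<And>x. x \<notin> K \<Longrightarrow> \<phi> x = 0" and s: "smooth \<phi>"
    using assms(1) unfolding test_function_def by blast
  define T where "T = (\<lambda>y. inverse l *\<^sub>R (y - d)) ` K"
  have "compact T" unfolding T_def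
    by (intro compact_continuous_image continuous_intros K)
  moreover have "\<phi> (d + l *\<^sub>R x) = 0" if "x \<notin> T" for x
  proof (rule K(2), rule notI)
    assume "d + l *\<^sub>R x \<in> K"
    then have "inverse l *\<^sub>R ((d + l *\<^sub>R x) - d) \<in> T" unfolding T_def by (rule imageI)
    with that assms(2) show False by simp
  qed
  ultimately show ?thesis
    unfolding test_function_def using smooth_affine[OF s] by blast
qed

lemma weak_gradient_dilation:
  assumes G: "weak_gradient k f G" and l: "l > 0"
  shows "weak_gradient k (\<lambda>x. \<mu> *\<^sub>R f (d + l *\<^sub>R x)) (\<lambda>vs x. (\<mu> * l ^ k) *\<^sub>R G vs (d + l *\<^sub>R x))"
  unfolding weak_gradient_def
proof (intro conjI ballI allI impI)
  show "locally_integrable_on (\<lambda>x. \<mu> *\<^sub>R f (d + l *\<^sub>R x)) UNIV"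
    using l by (intro locally_integrable_scaleR locally_integrable_dilation weak_gradientD(1)[OF G]) auto
  fix vs assume vs: "vs \<in> dirs k"
  show "locally_integrable_on (\<lambda>x. (\<mu> * l ^ k) *\<^sub>R G vs (d + l *\<^sub>R x)) UNIV"
    using l by (intro locally_integrable_scaleR locally_integrable_dilation weak_gradientD(2)[OF G vs]) auto
  fix \<phi> :: "plane \<Rightarrow> real" assume \<phi>: "test_function UNIV \<phi>"
  \<comment> \<open>The test function is moved back by the inverse dilation. Differentiating it
    gives the factor \<open>l ^ k\<close>, and the Jacobian \<open>l ^ 2\<close> occurs on both
    sides and cancels.\<close>
  define \<psi> where "\<psi> y = \<phi> (- (inverse l *\<^sub>R d) + inverse l *\<^sub>R y)" for y
  have \<psi>: "test_function UNIV \<psi>"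
    unfolding \<psi>_def using l by (intro test_function_dilation \<phi>) auto
  have \<psi>\<phi>: "\<psi> (d + l *\<^sub>R x) = \<phi> x" for x
    using l by (simp add: \<psi>_def algebra_simps)
  then have "\<phi> = (\<lambda>x. \<psi> (d + l *\<^sub>R x))" by auto
  then have it: "iter_deriv vs \<phi> x = l ^ k * iter_deriv vs \<psi> (d + l *\<^sub>R x)" for x
    using iter_deriv_affine[of \<psi> vs d l] \<psi> vs by (simp add: test_function_def dirs_def)
  have l0: "l \<noteq> 0" using l by simp
  define A where "A = (LINT x|lebesgue. iter_deriv vs \<psi> (d + l *\<^sub>R x) *\<^sub>R f (d + l *\<^sub>R x))"
  define B where "B = (LINT x|lebesgue. \<psi> (d + l *\<^sub>R x) *\<^sub>R G vs (d + l *\<^sub>R x))"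
  have "(l ^ 2) *\<^sub>R A = (-1) ^ k *\<^sub>R ((l ^ 2) *\<^sub>R B)"
    using weak_gradientD(3)[OF G vs \<psi>] l
      integral_dilation[OF l0, of "\<lambda>x. iter_deriv vs \<psi> x *\<^sub>R f x" d]
      integral_dilation[OF l0, of "\<lambda>x. \<psi> x *\<^sub>R G vs x" d] by (simp add: A_def B_def)
  then have AB: "A = (-1) ^ k *\<^sub>R B" using l by (metis l0 power_not_zero scaleR_left_commute scaleR_cancel_left)
  have "(LINT x|lebesgue. iter_deriv vs \<phi> x *\<^sub>R \<mu> *\<^sub>R f (d + l *\<^sub>R x)) = (\<mu> * l ^ k) *\<^sub>R A"
    unfolding A_def integral_scaleR_right[symmetric] it by (simp add: mult_ac)
  also have "\<dots> = (-1) ^ k *\<^sub>R ((\<mu> * l ^ k) *\<^sub>R B)" unfolding AB by (simp add: mult_ac)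
  also have "(\<mu> * l ^ k) *\<^sub>R B = (LINT x|lebesgue. \<phi> x *\<^sub>R (\<mu> * l ^ k) *\<^sub>R G vs (d + l *\<^sub>R x))"
    unfolding B_def integral_scaleR_right[symmetric] \<psi>\<phi> by (simp add: mult_ac)
  finally show "(LINT x|lebesgue. iter_deriv vs \<phi> x *\<^sub>R \<mu> *\<^sub>R f (d + l *\<^sub>R x)) =
    (-1) ^ k *\<^sub>R (LINT x|lebesgue. \<phi> x *\<^sub>R (\<mu> * l ^ k) *\<^sub>R G vs (d + l *\<^sub>R x))" .
qed

lemma weak_gradient_unique:
  assumes "weak_gradient k f F" "weak_gradient k f G" "vs \<in> dirs k"
  shows "AE x in lebesgue. F vs x = G vs x"
proof -
  have "AE x in lebesgue. (\<lambda>x. 1) x \<noteq> (0::real) \<longrightarrow> F vs x - G vs x = 0"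
  proof (rule fundamental_lemma)
    show "locally_integrable_on (\<lambda>x. F vs x - G vs x) UNIV"
      using assms by (intro locally_integrable_diff weak_gradientD)
    fix \<phi> :: "plane \<Rightarrow> real" assume \<phi>: "test_function UNIV \<phi>"
    have "(-1) ^ k *\<^sub>R (LINT x|lebesgue. \<phi> x *\<^sub>R F vs x) = (-1) ^ k *\<^sub>R (LINT x|lebesgue. \<phi> x *\<^sub>R G vs x)"
      using weak_gradientD(3)[OF assms(1,3) \<phi>] weak_gradientD(3)[OF assms(2,3) \<phi>] by simp
    then show "(LINT x|lebesgue. (\<phi> x * 1) *\<^sub>R (F vs x - G vs x)) = 0"
      using weak_gradient_test_integrable(2)[OF assms(1,3) \<phi>] weak_gradient_test_integrable(2)[OF assms(2,3) \<phi>]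
      by (simp add: scaleR_diff_right)
  qed auto
  then show ?thesis by simp
qed

lemma bounded_CBox: "bounded (CBox c l)" by (simp add: CBox_eq_cbox)

lemma compact_CBox: "compact (CBox c l)" by (simp add: CBox_eq_cbox)

lemma CBox_lmeasurable: "CBox c l \<in> sets lebesgue" by (simp add: CBox_eq_cbox)

lemma open_Box: "open (Box c l)" by (simp add: Box_eq_box open_box)

text \<open>The weight \<open>\<eta>\<close> vanishes on the open box and is positive off the closed
  one. All derivatives of \<open>\<phi> * \<eta>\<close> vanish where \<open>v\<close> lives, so the
  weak gradient integrates to zero against every weighted test function, and the fundamental lemma
  applies.\<close>

lemma weak_gradient_support:
  assumes G: "weak_gradient k v G" and v: "\<And>x. x \<notin> Box c l \<Longrightarrow> v x = 0" and vs: "vs \<in> dirs k"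
  shows "AE x in lebesgue. x \<notin> CBox c l \<longrightarrow> G vs x = 0"
proof -
  define \<eta> :: "plane \<Rightarrow> real" where "\<eta> x = smooth_step (c $ 1 - x $ 1) + smooth_step (x $ 1 - (c $ 1 + l)) +
    (smooth_step (c $ 2 - x $ 2) + smooth_step (x $ 2 - (c $ 2 + l)))" for x
  have \<eta>s: "smooth \<eta>"
    unfolding \<eta>_def by (intro smooth_add smooth_compose[OF smooth_smooth_step] smooth_diff smooth_const smooth_nth)
  have \<eta>Box: "\<eta> x = 0" if "x \<in> Box c l" for x
    using that by (simp add: \<eta>_def Box_def)
  have \<eta>nz: "\<eta> x \<noteq> 0" if x: "x \<notin> CBox c l" for x
  proof -
    have "c $ 1 - x $ 1 > 0 \<or> x $ 1 - (c $ 1 + l) > 0 \<or> c $ 2 - x $ 2 > 0 \<or> x $ 2 - (c $ 2 + l) > 0"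
      using x unfolding CBox_def by auto
    then show ?thesis
      unfolding \<eta>_def
      using smooth_step_range(1)[of "c $ 1 - x $ 1"] smooth_step_range(1)[of "x $ 1 - (c $ 1 + l)"]
        smooth_step_range(1)[of "c $ 2 - x $ 2"] smooth_step_range(1)[of "x $ 2 - (c $ 2 + l)"]
        smooth_step_pos[of "c $ 1 - x $ 1"] smooth_step_pos[of "x $ 1 - (c $ 1 + l)"]
        smooth_step_pos[of "c $ 2 - x $ 2"] smooth_step_pos[of "x $ 2 - (c $ 2 + l)"] by linarith
  qed
  have "AE x in lebesgue. \<eta> x \<noteq> 0 \<longrightarrow> G vs x = 0"
  proof (rule fundamental_lemma[OF weak_gradientD(2)[OF G vs] \<eta>s])
    show "\<eta> x \<ge> 0" for x unfolding \<eta>_def by (intro add_nonneg_nonneg smooth_step_range)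
    fix \<phi> :: "plane \<Rightarrow> real" assume "test_function UNIV \<phi>"
    then have \<psi>: "test_function UNIV (\<lambda>x. \<phi> x * \<eta> x)" by (rule test_function_mult[OF _ \<eta>s])
    have "iter_deriv vs (\<lambda>x. \<phi> x * \<eta> x) x *\<^sub>R v x = 0" for x
      using v[of x] iter_deriv_zero_open[OF open_Box[of c l], where f = "\<lambda>x. \<phi> x * \<eta> x" and x = x and vs = vs] \<eta>Box by auto
    with weak_gradientD(3)[OF G vs \<psi>] show "(LINT x|lebesgue. (\<phi> x * \<eta> x) *\<^sub>R G vs x) = 0" by simp
  qed
  then show ?thesis by eventually_elim (use \<eta>nz in blast)
qed

text \<open>Test with a cutoff that is one near the box: its derivatives of order
  \<open>k \<ge> 1\<close> vanish where \<open>v\<close> lives, while on the support of the weak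
  gradient it is one. The vanishing mean is what later permits estimating the gradient by its own
  differences.\<close>

lemma weak_gradient_mean_zero:
  assumes G: "weak_gradient k v G" and v: "\<And>x. x \<notin> Box c l \<Longrightarrow> v x = 0" and vs: "vs \<in> dirs k"
    and k: "k \<ge> 1"
  shows "(LINT x:CBox c l|lebesgue. G vs x) = 0"
proof -
  obtain R W where W: "open W" "CBox c l \<subseteq> W" "\<And>x. x \<in> W \<Longrightarrow> cutoff R x = 1"
    using cutoff_eq_1_nbhd[OF bounded_CBox] by metis
  have AE: "AE x in lebesgue. x \<notin> CBox c l \<longrightarrow> G vs x = 0"
    by (rule weak_gradient_support[OF G v vs])
  have "vs \<noteq> []" using vs k by (auto simp: dirs_def)
  have "iter_deriv vs (cutoff R) x *\<^sub>R v x = 0" for x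
  proof (cases "x \<in> W")
    case True
    then show ?thesis
      using iter_deriv_cong_open[OF W(1,3) True, where vs = vs] iter_deriv_const[OF \<open>vs \<noteq> []\<close>, of 1] by simp
  next
    case False
    then show ?thesis using W(2) v[of x] Box_subset_CBox by force
  qed
  with weak_gradientD(3)[OF G vs cutoff_test_function[of R]]
  have "(LINT x|lebesgue. cutoff R x *\<^sub>R G vs x) = 0" by simp
  moreover have "(LINT x:CBox c l|lebesgue. G vs x) = (LINT x|lebesgue. cutoff R x *\<^sub>R G vs x)"
    unfolding set_lebesgue_integral_def
  proof (rule integral_cong_AE)
    have m: "G vs \<in> borel_measurable lebesgue" by (rule locally_integrable_measurable[OF weak_gradientD(2)[OF G vs]])
    show "(\<lambda>x. indicat_real (CBox c l) x *\<^sub>R G vs x) \<in> borel_measurable lebesgue"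
      by (intro borel_measurable_scaleR m borel_measurable_indicator CBox_lmeasurable)
    show "(\<lambda>x. cutoff R x *\<^sub>R G vs x) \<in> borel_measurable lebesgue"
      by (intro borel_measurable_scaleR m smooth_lebesgue_measurable smooth_cutoff)
    show "AE x in lebesgue. indicat_real (CBox c l) x *\<^sub>R G vs x = cutoff R x *\<^sub>R G vs x"
      using AE
    proof eventually_elim
      case (elim x)
      then show ?case using W(2,3) by (cases "x \<in> CBox c l") auto
    qed
  qed
  ultimately show ?thesis by simp
qed

text \<open>Poincare's inequality by duality: a polynomial \<open>f\<close> has a \<open>k\<close>-fold antiderivative in the
  direction \<open>e1\<close> which is at most \<open>l ^ k\<close> times larger on the box, and is a test function after a
  cutoff. This needs only the \<open>k\<close>-th order weak derivatives, not those of lower order.\<close>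

lemma weak_gradient_Poincare:
  fixes v :: "plane \<Rightarrow> 'b::euclidean_space" and h :: "plane \<Rightarrow> real"
  assumes G: "weak_gradient k v G" and v: "\<And>x. x \<notin> Box c l \<Longrightarrow> v x = 0"
    and h: "h \<in> borel_measurable lebesgue" "\<And>x. \<bar>h x\<bar> \<le> 1" and l: "l \<ge> 0"
  shows "norm (LINT x|lebesgue. h x *\<^sub>R v x)
    \<le> 2 * l ^ k * (LINT x:CBox c l|lebesgue. norm (G (replicate k e1) x))"
proof -
  let ?vs = "replicate k e1" and ?Q = "CBox c l"
  define I where "I = (LINT x:?Q|lebesgue. norm (G ?vs x))"
  obtain R W where W: "open W" "?Q \<subseteq> W" "\<And>x. x \<in> W \<Longrightarrow> cutoff R x = 1"
    using cutoff_eq_1_nbhd[OF bounded_CBox] by metis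
  from poly2_approximates_measurable[OF h compact_CBox[of c l]] obtain P where
    P: "\<And>n. poly2 (P n)" "\<And>n x. x \<in> ?Q \<Longrightarrow> \<bar>P n x\<bar> \<le> 1 + 1"
    "AE x in lebesgue. x \<in> ?Q \<longrightarrow> (\<lambda>n. P n x) \<longlonglongrightarrow> h x" by blast
  have v0: "v x = 0" if "x \<notin> ?Q" for x
    using that Box_subset_CBox v by blast
  have vm: "v \<in> borel_measurable lebesgue" by (rule locally_integrable_measurable[OF weak_gradientD(1)[OF G]])
  have vi: "integrable lebesgue v"
  proof -
    have "integrable lebesgue (\<lambda>x. indicat_real ?Q x *\<^sub>R v x)"
      using weak_gradientD(1)[OF G] compact_CBox unfolding locally_integrable_UNIV by blast
    also have "(\<lambda>x. indicat_real ?Q x *\<^sub>R v x) = v"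
      using v0 by (auto simp: indicator_def)
    finally show ?thesis .
  qed
  have Gi: "integrable lebesgue (\<lambda>x. indicat_real ?Q x *\<^sub>R G ?vs x)"
    using weak_gradientD(2)[OF G dirs_replicate] compact_CBox unfolding locally_integrable_UNIV by blast
  have AE: "AE x in lebesgue. x \<notin> ?Q \<longrightarrow> G ?vs x = 0"
    by (rule weak_gradient_support[OF G v dirs_replicate])
  have bound: "norm (LINT x|lebesgue. P n x *\<^sub>R v x) \<le> 2 * l ^ k * I" for n
  proof -
    from poly2_iterated_antiderivative[OF P(1)[of n] P(2)[of _ n], where k = k] obtain F where
      F: "poly2 F" "iter_deriv ?vs F = P n" "\<And>x. x \<in> ?Q \<Longrightarrow> \<bar>F x\<bar> \<le> l ^ k * (1 + 1)" by blast
    have t: "test_function UNIV (\<lambda>x. cutoff R x * F x)"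
      by (rule test_function_mult[OF cutoff_test_function poly2_smooth[OF F(1)]])
    \<comment> \<open>Near the box the cutoff is one and the \<open>k\<close>-fold derivative of
      \<open>F\<close> is \<open>P n\<close>; away from it \<open>v\<close> vanishes.\<close>
    have "P n x *\<^sub>R v x = iter_deriv ?vs (\<lambda>x. cutoff R x * F x) x *\<^sub>R v x" for x
    proof (cases "x \<in> W")
      case True
      then show ?thesis
        using iter_deriv_cong_open[OF W(1) _ True, where f = "\<lambda>x. cutoff R x * F x" and g = F and vs = ?vs] W(3) F(2) by simp
    next
      case False
      then show ?thesis using W(2) v[of x] Box_subset_CBox by force
    qed
    then have "(LINT x|lebesgue. P n x *\<^sub>R v x) =
        (LINT x|lebesgue. iter_deriv ?vs (\<lambda>x. cutoff R x * F x) x *\<^sub>R v x)"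
      by (simp only:)
    then have "norm (LINT x|lebesgue. P n x *\<^sub>R v x) = norm (LINT x|lebesgue. (cutoff R x * F x) *\<^sub>R G ?vs x)"
      using weak_gradientD(3)[OF G dirs_replicate t] by simp
    also have "\<dots> \<le> (LINT x|lebesgue. norm ((cutoff R x * F x) *\<^sub>R G ?vs x))"
      by (rule integral_norm_bound)
    also have "\<dots> \<le> (LINT x|lebesgue. 2 * l ^ k * norm (indicat_real ?Q x *\<^sub>R G ?vs x))"
    proof (rule integral_mono_AE)
      show "integrable lebesgue (\<lambda>x. norm ((cutoff R x * F x) *\<^sub>R G ?vs x))"
        by (intro integrable_norm weak_gradient_test_integrable(2)[OF G dirs_replicate t])
      show "integrable lebesgue (\<lambda>x. 2 * l ^ k * norm (indicat_real ?Q x *\<^sub>R G ?vs x))"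
        by (intro integrable_mult_right integrable_norm Gi)
      show "AE x in lebesgue. norm ((cutoff R x * F x) *\<^sub>R G ?vs x) \<le> 2 * l ^ k * norm (indicat_real ?Q x *\<^sub>R G ?vs x)"
        using AE
      proof eventually_elim
        case (elim x)
        show ?case
        proof (cases "x \<in> ?Q")
          case True
          have "\<bar>cutoff R x\<bar> * \<bar>F x\<bar> \<le> 1 * (l ^ k * (1 + 1))"
            using cutoff_range F(3)[OF True] by (intro mult_mono) auto
          then have "\<bar>cutoff R x\<bar> * \<bar>F x\<bar> * norm (G ?vs x) \<le> (2 * l ^ k) * norm (G ?vs x)"
            by (intro mult_right_mono) auto
          then show ?thesis using True by (simp add: abs_mult)
        qed (use elim in simp)
      qed
    qed
    also have "\<dots> = 2 * l ^ k * I" by (simp add: I_def set_lebesgue_integral_def)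
    finally show ?thesis .
  qed
  have "(\<lambda>n. LINT x|lebesgue. P n x *\<^sub>R v x) \<longlonglongrightarrow> (LINT x|lebesgue. h x *\<^sub>R v x)"
  proof (rule integral_dominated_convergence[where w = "\<lambda>x. 2 * norm (v x)"])
    show "(\<lambda>x. h x *\<^sub>R v x) \<in> borel_measurable lebesgue" by (intro borel_measurable_scaleR h vm)
    show "(\<lambda>x. P n x *\<^sub>R v x) \<in> borel_measurable lebesgue" for n
      by (intro borel_measurable_scaleR smooth_lebesgue_measurable poly2_smooth P vm)
    show "integrable lebesgue (\<lambda>x. 2 * norm (v x))" by (intro integrable_mult_right integrable_norm vi)
    show "AE x in lebesgue. (\<lambda>n. P n x *\<^sub>R v x) \<longlonglongrightarrow> h x *\<^sub>R v x"
      using P(3)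
    proof eventually_elim
      case (elim x)
      then show ?case
        using v0[of x] by (cases "x \<in> ?Q") (auto intro!: tendsto_intros)
    qed
    show "AE x in lebesgue. norm (P n x *\<^sub>R v x) \<le> 2 * norm (v x)" for n
    proof (intro always_eventually allI)
      fix x show "norm (P n x *\<^sub>R v x) \<le> 2 * norm (v x)"
        using P(2)[of x n] v0[of x] by (cases "x \<in> ?Q") (auto intro!: mult_right_mono)
    qed
  qed
  then have "(\<lambda>n. norm (LINT x|lebesgue. P n x *\<^sub>R v x)) \<longlonglongrightarrow> norm (LINT x|lebesgue. h x *\<^sub>R v x)"
    by (rule tendsto_norm)
  then show ?thesis
    unfolding I_def[symmetric] using bound by (intro LIMSEQ_le_const2) auto
qed

section \<open>Size of a Sobolev field that splits along a tiling\<close>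

subsection \<open>Energy estimates on a tiled region\<close>

lemma measure_CBox: "l \<ge> 0 \<Longrightarrow> measure lebesgue (CBox c l) = l ^ 2"
proof -
  assume l: "l \<ge> 0"
  have "c \<in> CBox c l" using l by (simp add: CBox_def)
  then have "cbox c (c + vector [l, l]) \<noteq> {}" unfolding CBox_eq_cbox by blast
  then show ?thesis
    by (simp add: CBox_eq_cbox content_cbox_if_cart UNIV_2 power2_eq_square)
qed

lemma CBox_minus_Box_null: "CBox c l - Box c l \<in> null_sets lebesgue"
  unfolding CBox_eq_cbox Box_eq_box using negligible_frontier_interval negligible_iff_null_sets by blast

lemma AE_Box_CBox: "AE x in lebesgue. x \<in> Box c l \<longleftrightarrow> x \<in> CBox c l"
  by (rule AE_I'[OF CBox_minus_Box_null[of c l]]) (use Box_subset_CBox in auto)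

lemma Box_lmeasurable: "Box c l \<in> sets lebesgue" by (simp add: Box_eq_box)

lemma emeasure_Box:
  assumes "l \<ge> 0" shows "emeasure lebesgue (Box c l) = ennreal (l ^ 2)"
proof -
  have "emeasure lebesgue (Box c l) = emeasure lebesgue (CBox c l)"
    using AE_Box_CBox by (intro emeasure_eq_AE Box_lmeasurable CBox_lmeasurable) auto
  also have "\<dots> = ennreal (l ^ 2)"
    using measure_CBox[OF assms] lmeasurable_compact[OF compact_CBox] by (metis emeasure_eq_measure2)
  finally show ?thesis .
qed

lemma measure_Box: "l \<ge> 0 \<Longrightarrow> measure lebesgue (Box c l) = l ^ 2"
  by (simp add: emeasure_Box measure_def)

lemma set_integral_Box_CBox:
  fixes f g :: "plane \<Rightarrow> 'b::euclidean_space"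
  assumes "f \<in> borel_measurable lebesgue" "g \<in> borel_measurable lebesgue"
    "AE x in lebesgue. x \<in> Box c l \<longrightarrow> f x = g x"
  shows "(LINT x:Box c l|lebesgue. f x) = (LINT x:CBox c l|lebesgue. g x)"
  unfolding set_lebesgue_integral_def
proof (rule integral_cong_AE)
  show "AE x in lebesgue. indicat_real (Box c l) x *\<^sub>R f x = indicat_real (CBox c l) x *\<^sub>R g x"
    using assms(3) AE_Box_CBox[of c l] by eventually_elim (auto simp: indicator_def)
qed (intro borel_measurable_scaleR borel_measurable_indicator Box_lmeasurable CBox_lmeasurable assms)+

text \<open>\<open>J\<close> stands for the inner integral of the Gagliardo seminorm, which need not be measurable.
  The integral of \<open>a + b * J\<close> is therefore avoided: where \<open>g\<close> exceeds \<open>2 * a\<close>, it is at most \<open>2 * b * J\<close>.\<close>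

lemma nn_integral_bound_split:
  fixes g :: "'a \<Rightarrow> real" and J :: "'a \<Rightarrow> ennreal"
  assumes g[measurable]: "g \<in> borel_measurable M" and U[measurable]: "U \<in> sets M" and U1: "emeasure M U \<le> 1"
    and a: "a \<ge> 0" and b: "b > 0" and B: "B \<ge> 0"
    and le: "AE x in M. x \<in> U \<longrightarrow> ennreal (g x) \<le> ennreal a + ennreal b * J x"
    and J: "(\<integral>\<^sup>+x. J x \<partial>M) \<le> ennreal B"
  shows "(\<integral>\<^sup>+x. indicator U x * ennreal (g x) \<partial>M) \<le> ennreal (2 * a + 2 * b * B)"
proof -
  define g' where "g' x = (if x \<in> U \<and> g x > 2 * a then g x else 0)" for x
  have [measurable]: "g' \<in> borel_measurable M" unfolding g'_def[abs_def] by measurable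
  have g'nn: "g' x \<ge> 0" for x using a by (simp add: g'_def)
  have "AE x in M. ennreal (g' x / (2 * b)) \<le> J x"
    using le
  proof eventually_elim
    case (elim x)
    show ?case
    proof (cases "x \<in> U \<and> g x > 2 * a")
      case True
      show ?thesis
      proof (cases "J x")
        case (real j)
        have "ennreal a + ennreal b * J x = ennreal (a + b * j)"
          using real a b by (simp add: ennreal_mult)
        then have "ennreal (g x) \<le> ennreal (a + b * j)" using elim True by simp
        then have "g x \<le> a + b * j" using real a b by (subst (asm) ennreal_le_iff) auto
        then have "g x / (2 * b) \<le> j" using True b by (simp add: field_simps)
        then show ?thesis using True real by (simp add: g'_def ennreal_leI)
      qed simp
    next
      case False
      then have "g' x = 0" by (auto simp: g'_def)
      then show ?thesis by simp
    qed
  qed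
  then have "(\<integral>\<^sup>+x. ennreal (g' x / (2 * b)) \<partial>M) \<le> (\<integral>\<^sup>+x. J x \<partial>M)" by (rule nn_integral_mono_AE)
  then have *: "(\<integral>\<^sup>+x. ennreal (g' x / (2 * b)) \<partial>M) \<le> ennreal B" using J by (rule order_trans)
  have "(\<integral>\<^sup>+x. ennreal (g' x) \<partial>M) = (\<integral>\<^sup>+x. ennreal (2 * b) * ennreal (g' x / (2 * b)) \<partial>M)"
    using b g'nn by (intro nn_integral_cong) (simp add: ennreal_mult[symmetric])
  also have "\<dots> = ennreal (2 * b) * (\<integral>\<^sup>+x. ennreal (g' x / (2 * b)) \<partial>M)"
    by (rule nn_integral_cmult) measurable
  also have "\<dots> \<le> ennreal (2 * b) * ennreal B" using * by (rule mult_left_mono) simp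
  also have "\<dots> = ennreal (2 * b * B)" using b B by (simp add: ennreal_mult)
  finally have 1: "(\<integral>\<^sup>+x. ennreal (g' x) \<partial>M) \<le> ennreal (2 * b * B)" .
  have "(\<integral>\<^sup>+x. indicator U x * ennreal (g x) \<partial>M) \<le> (\<integral>\<^sup>+x. ennreal (2 * a) * indicator U x + ennreal (g' x) \<partial>M)"
    by (intro nn_integral_mono) (auto simp: g'_def indicator_def not_less intro!: ennreal_leI)
  also have "\<dots> = (\<integral>\<^sup>+x. ennreal (2 * a) * indicator U x \<partial>M) + (\<integral>\<^sup>+x. ennreal (g' x) \<partial>M)"
    by (rule nn_integral_add) measurable
  also have "(\<integral>\<^sup>+x. ennreal (2 * a) * indicator U x \<partial>M) = ennreal (2 * a) * emeasure M U"
    by (rule nn_integral_cmult_indicator[OF U])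
  also have "\<dots> \<le> ennreal (2 * a) * 1" using U1 by (rule mult_left_mono) simp
  also have "ennreal (2 * a) * 1 + (\<integral>\<^sup>+x. ennreal (g' x) \<partial>M) \<le> ennreal (2 * a) * 1 + ennreal (2 * b * B)"
    using 1 by (rule add_left_mono)
  also have "\<dots> = ennreal (2 * a + 2 * b * B)" using a b B by (simp add: ennreal_plus)
  finally show ?thesis by (simp add: add_mono)
qed

lemma ennreal_root_le_imp:
  assumes "ennreal_root q X \<le> ennreal M" "q > 0" "M \<ge> 0"
  shows "X \<le> ennreal (M powr q)"
proof -
  have X: "X \<noteq> \<infinity>" using assms(1) by (auto simp: ennreal_root_def top_unique)
  then have "ennreal (enn2real X powr (1 / q)) \<le> ennreal M" using assms(1) by (simp add: ennreal_root_def)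
  then have "enn2real X powr (1 / q) \<le> M" using assms(3) by (simp add: ennreal_le_iff)
  then have "(enn2real X powr (1 / q)) powr q \<le> M powr q" using assms(2) by (intro powr_mono2) auto
  then have "enn2real X \<le> M powr q" using assms(2) by (simp add: powr_powr)
  then show ?thesis using X by (metis ennreal_enn2real ennreal_leI infinity_ennreal_def top.not_eq_extremum)
qed

lemma norm_le_tensor_norm: "vs \<in> dirs k \<Longrightarrow> norm (T vs) \<le> tensor_norm k T"
  unfolding tensor_norm_def using member_le_L2_set[OF finite_dirs, of vs k "\<lambda>vs. norm (T vs)"] by simp

lemma tensor_norm_nonneg: "tensor_norm k T \<ge> 0"
  unfolding tensor_norm_def by (rule L2_set_nonneg)

text \<open>A substitute for Hoelder's inequality: on a set of measure at most one, it turns a bound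
  of the \<open>q\<close>-th power into a bound of the integral, up to an additive constant.\<close>

lemma le_1_plus_powr:
  assumes "X \<ge> 0" "q \<ge> 1" shows "X \<le> 1 + X powr (q::real)"
proof (cases "X \<le> 1")
  case True
  then show ?thesis using powr_ge_zero[of X q] by linarith
next
  case False
  then have "X powr 1 \<le> X powr q" using assms by (intro powr_mono) auto
  then show ?thesis using False by simp
qed

lemma norm_diff_le_CBox:
  assumes "x \<in> CBox c l" "y \<in> CBox c l" shows "norm (x - y) \<le> 2 * l"
proof -
  have "norm (x - y) \<le> (\<Sum>i\<in>UNIV. \<bar>(x - y) $ i\<bar>)" by (rule norm_le_l1_cart)
  also have "\<dots> \<le> l + l" unfolding UNIV_2 using assms by (auto simp: CBox_def)
  finally show ?thesis by simp
qed

text \<open>By the vanishing mean, \<open>g x\<close> is the average of \<open>g x - g y\<close>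
  over the box. Dividing by the area \<open>l ^ 2\<close> removes the factor \<open>l ^ 2\<close>
  carried by the bound on the differences.\<close>

lemma norm_le_average_of_differences:
  fixes g :: "plane \<Rightarrow> 'b::euclidean_space"
  assumes g: "locally_integrable_on g UNIV" and l: "l > 0" and mean: "(LINT y:Box c l|lebesgue. g y) = 0"
    and le: "\<And>y. y \<in> Box c l \<Longrightarrow> ennreal (norm (g x - g y)) \<le> ennreal a + ennreal (b * l ^ 2) * K y" and a: "a \<ge> 0" and b: "b > 0"
    and K[measurable]: "K \<in> borel_measurable lebesgue"
  shows "ennreal (norm (g x)) \<le> ennreal a + ennreal b * (\<integral>\<^sup>+y. K y \<partial>lebesgue)"
proof -
  let ?Q = "Box c l"
  have gi: "set_integrable lebesgue ?Q g"
  proof -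
    have "set_integrable lebesgue (CBox c l) g"
      using g compact_CBox unfolding locally_integrable_UNIV set_integrable_def by blast
    then show ?thesis by (rule set_integrable_subset[OF _ Box_lmeasurable Box_subset_CBox])
  qed
  have ci: "set_integrable lebesgue ?Q (\<lambda>y. g x)"
    unfolding set_integrable_def using emeasure_Box[of l c] l
    by (intro integrable_scaleR_left) (auto simp: Box_lmeasurable integrable_indicator_iff)
  have c: "(LINT y:?Q|lebesgue. g x) = (l ^ 2) *\<^sub>R g x"
    using has_bochner_integral_integral_eq[OF has_bochner_integral_indicator[OF Box_lmeasurable, of c l "g x"]] l
    by (simp add: set_lebesgue_integral_def emeasure_Box measure_Box)
  have "(LINT y:?Q|lebesgue. g x - g y) = (LINT y:?Q|lebesgue. g x) - (LINT y:?Q|lebesgue. g y)"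
    by (rule set_integral_diff(2)[OF ci gi])
  also have "\<dots> = (l ^ 2) *\<^sub>R g x" by (simp add: c mean)
  finally have eq: "(LINT y:?Q|lebesgue. g x - g y) = (l ^ 2) *\<^sub>R g x" .
  have di: "set_integrable lebesgue ?Q (\<lambda>y. g x - g y)" by (rule set_integral_diff(1)[OF ci gi])
  have "ennreal (l ^ 2) * ennreal (norm (g x)) = ennreal (norm (LINT y:?Q|lebesgue. g x - g y))"
    unfolding eq using l by (simp add: ennreal_mult)
  also have "\<dots> \<le> (\<integral>\<^sup>+y. ennreal (norm (indicat_real ?Q y *\<^sub>R (g x - g y))) \<partial>lebesgue)"
    unfolding set_lebesgue_integral_def
    by (rule integral_norm_bound_ennreal) (use di in \<open>simp add: set_integrable_def\<close>)
  also have "\<dots> \<le> (\<integral>\<^sup>+y. ennreal a * indicator ?Q y + ennreal (b * l ^ 2) * K y \<partial>lebesgue)"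
    using le by (intro nn_integral_mono) (auto simp: indicator_def)
  also have "\<dots> = (\<integral>\<^sup>+y. ennreal a * indicator ?Q y \<partial>lebesgue) + (\<integral>\<^sup>+y. ennreal (b * l ^ 2) * K y \<partial>lebesgue)"
    using Box_lmeasurable by (intro nn_integral_add) auto
  also have "(\<integral>\<^sup>+y. ennreal a * indicator ?Q y \<partial>lebesgue) = ennreal a * ennreal (l ^ 2)"
    using l by (simp only: nn_integral_cmult_indicator[OF Box_lmeasurable] emeasure_Box less_imp_le)
  also have "(\<integral>\<^sup>+y. ennreal (b * l ^ 2) * K y \<partial>lebesgue) = ennreal (b * l ^ 2) * (\<integral>\<^sup>+y. K y \<partial>lebesgue)"
    by (rule nn_integral_cmult[OF K])
  also have "ennreal a * ennreal (l ^ 2) + ennreal (b * l ^ 2) * (\<integral>\<^sup>+y. K y \<partial>lebesgue)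
      = ennreal (l ^ 2) * (ennreal a + ennreal b * (\<integral>\<^sup>+y. K y \<partial>lebesgue))"
    using b l by (simp add: ennreal_mult distrib_left mult_ac)
  finally have "ennreal (l ^ 2) * ennreal (norm (g x)) \<le> ennreal (l ^ 2) * (ennreal a + ennreal b * (\<integral>\<^sup>+y. K y \<partial>lebesgue))" .
  moreover have "ennreal (l ^ 2) \<noteq> 0" using l by simp
  moreover have "ennreal (l ^ 2) \<noteq> top" by simp
  ultimately show ?thesis
    by (metis ennreal_mult_le_mult_iff)
qed

text \<open>Apply \<open>le_1_plus_powr\<close> to \<open>norm X / l powr r\<close>; this
  normalisation yields the scaling \<open>l powr r\<close> of the estimate. As
  \<open>d \<le> 2 * l\<close>, the factor \<open>1 / l powr (r * q)\<close> is at most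
  \<open>2 powr (2 + r * q) * l ^ 2 / d powr (2 + r * q)\<close>, which brings in the Gagliardo
  kernel.\<close>

lemma powr_difference_bound:
  fixes X :: "'b::real_normed_vector"
  assumes q: "q \<ge> 1" and l: "l > 0" and d: "0 < d" "d \<le> 2 * l" and r: "r \<ge> 0"
  shows "norm X \<le> l powr r + (l powr r * 2 powr (2 + r * q)) * l ^ 2 * (norm X powr q / d powr (2 + r * q))"
proof -
  define Y where "Y = norm X / l powr r"
  have Yq: "Y powr q = norm X powr q * (1 / l powr (r * q))"
    using l by (simp add: Y_def powr_divide powr_powr)
  have "1 / l powr (r * q) \<le> 2 powr (2 + r * q) * l ^ 2 * (1 / d powr (2 + r * q))"
  proof -
    have "d powr (2 + r * q) \<le> (2 * l) powr (2 + r * q)"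
      using d r q by (intro powr_mono2) auto
    also have "\<dots> = 2 powr (2 + r * q) * (l powr 2 * l powr (r * q))"
      using l by (simp add: powr_mult powr_add)
    also have "l powr 2 = l ^ 2" using l by (simp add: powr_numeral)
    finally show ?thesis using l d by (simp add: field_simps)
  qed
  from mult_left_mono[OF this, of "norm X powr q"]
  have "Y powr q \<le> 2 powr (2 + r * q) * l ^ 2 * (norm X powr q / d powr (2 + r * q))"
    unfolding Yq by (simp add: mult_ac)
  then have "Y \<le> 1 + 2 powr (2 + r * q) * l ^ 2 * (norm X powr q / d powr (2 + r * q))"
    using le_1_plus_powr[of Y q] q by (simp add: Y_def)
  then have "l powr r * Y \<le> l powr r * (1 + 2 powr (2 + r * q) * l ^ 2 * (norm X powr q / d powr (2 + r * q)))"
    by (rule mult_left_mono) simp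
  moreover have "l powr r * Y = norm X" using l by (simp add: Y_def)
  ultimately show ?thesis by (simp add: distrib_left mult_ac)
qed

text \<open>The value \<open>2 * a + 2 * b * B\<close> of \<open>nn_integral_bound_split\<close> for
  \<open>a = 2 * (M + 2)\<close>, \<open>b = 2 powr (2 + frac s * q)\<close> and
  \<open>B = (M + 1) powr q\<close>, where \<open>q = enn2real p\<close>. It is large enough for
  finite and infinite \<open>p\<close> and for integer and fractional \<open>s\<close> at
  once.\<close>

definition energy_const :: "real \<Rightarrow> ennreal \<Rightarrow> real \<Rightarrow> real" where
  "energy_const s p M = 2 * (M + 2) * 2 + 2 * 2 powr (2 + frac s * enn2real p) * (M + 1) powr enn2real p"

text \<open>The gain is the factor \<open>l powr frac s\<close>. For fractional \<open>s\<close> the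
  seminorm only controls differences of the gradient; pairs of points in one tile are at distance at
  most \<open>2 * l\<close>, and the vanishing mean on the tile converts differences into sizes.
  Summing over tiles costs nothing, because only the total area enters. The gradient is a near
  minimiser chosen before the tiles, so its vanishing mean has to be a hypothesis on each family of
  tiles.\<close>

lemma sobolev_energy:
  fixes u :: "plane \<Rightarrow> 'b::euclidean_space"
  assumes M: "sobolev_seminorm s p u \<le> ennreal M" "M \<ge> 0" and p: "p > 1"
  obtains G where "weak_gradient (nat \<lfloor>s\<rfloor>) u G"
    "\<And>l (I::'i set) c g. 0 < l \<Longrightarrow> finite I \<Longrightarrow> emeasure lebesgue (\<Union>i\<in>I. Box (c i) l) \<le> 1 \<Longrightarrow>
      g = G (replicate (nat \<lfloor>s\<rfloor>) e1) \<Longrightarrow>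
      (\<And>i. i \<in> I \<Longrightarrow> (LINT y:Box (c i) l|lebesgue. g y) = 0) \<Longrightarrow>
      (\<integral>\<^sup>+x. indicator (\<Union>i\<in>I. Box (c i) l) x * ennreal (norm (g x)) \<partial>lebesgue)
        \<le> ennreal (energy_const s p M * l powr frac s)"
proof -
  define k where "k = nat \<lfloor>s\<rfloor>"
  define r where "r = frac s"
  define q where "q = enn2real p"
  define vs where "vs = replicate k e1"
  define F where "F G = (if r = 0 then Lp_norm p (\<lambda>x. tensor_norm k (\<lambda>vs. G vs x)) else frac_seminorm k r p G)"
    for G :: "plane list \<Rightarrow> plane \<Rightarrow> 'b"
  have vs: "vs \<in> dirs k" by (simp add: vs_def)
  have r: "0 \<le> r" "r < 1" by (simp_all add: r_def frac_lt_1)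
  have "(INF G\<in>{G. weak_gradient k u G}. F G) \<le> ennreal M"
    using M(1) unfolding sobolev_seminorm_def Let_def F_def r_def k_def .
  \<comment> \<open>The infimum over versions of the gradient need not be attained; one unit of room
    provides a version with a bounded functional.\<close>
  also have "ennreal M < ennreal (M + 1)" using M(2) by (simp add: ennreal_less_iff)
  finally obtain G where G: "weak_gradient k u G" and FG: "F G < ennreal (M + 1)"
    by (auto simp: INF_less_iff)
  have gl: "locally_integrable_on (G vs) UNIV" by (rule weak_gradientD(2)[OF G vs])
  have gm[measurable]: "G vs \<in> borel_measurable lebesgue" by (rule locally_integrable_measurable[OF gl])
  define Ce where "Ce = energy_const s p M"
  have energy: "(\<integral>\<^sup>+x. indicator U x * ennreal (norm (G vs x)) \<partial>lebesgue) \<le> ennreal (Ce * l powr r)"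
    if l: "0 < l" and fin: "finite (I::'i set)" and U: "U = (\<Union>i\<in>I. Box (c i) l)" and U1: "emeasure lebesgue U \<le> 1"
      and mean: "\<And>i. i \<in> I \<Longrightarrow> (LINT y:Box (c i) l|lebesgue. G vs y) = 0" for l I c U
  proof -
    have Um: "U \<in> sets lebesgue" unfolding U using fin Box_lmeasurable by auto
    \<comment> \<open>All four cases are brought to this form. \<open>J\<close> is the part of the
      bound that is controlled only after integration; it is \<open>0\<close> for
      \<open>p = \<infinity>\<close>.\<close>
    have key: ?thesis
      if J: "AE x in lebesgue. x \<in> U \<longrightarrow> ennreal (norm (G vs x)) \<le> ennreal (l powr r * (2 * (M + 2))) + ennreal (l powr r * 2 powr (2 + r * q)) * J x"
        "(\<integral>\<^sup>+x. J x \<partial>lebesgue) \<le> ennreal ((M + 1) powr q)" for J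
    proof -
      have "(\<integral>\<^sup>+x. indicator U x * ennreal (norm (G vs x)) \<partial>lebesgue)
        \<le> ennreal (2 * (l powr r * (2 * (M + 2))) + 2 * (l powr r * 2 powr (2 + r * q)) * (M + 1) powr q)"
        by (rule nn_integral_bound_split[OF _ Um U1 _ _ _ J]) (use l M(2) in auto)
      also have "2 * (l powr r * (2 * (M + 2))) + 2 * (l powr r * 2 powr (2 + r * q)) * (M + 1) powr q = Ce * l powr r"
        by (simp add: Ce_def energy_const_def r_def q_def algebra_simps)
      finally show ?thesis .
    qed
    have M2: "l powr r * (2 * (M + 2)) \<ge> 0" using M(2) by simp
    consider "p = \<infinity>" "r = 0" | "p = \<infinity>" "r \<noteq> 0" | "p \<noteq> \<infinity>" "r = 0" | "p \<noteq> \<infinity>" "r \<noteq> 0" by blast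
    then show ?thesis
    proof cases
      case 1
      show ?thesis
      proof (rule key[where J = "\<lambda>x. 0"])
        have "AE x in lebesgue. ennreal \<bar>tensor_norm k (\<lambda>vs. G vs x)\<bar> \<le> F G"
          unfolding F_def using 1 by (simp add: Lp_norm_def esssup_AE)
        then show "AE x in lebesgue. x \<in> U \<longrightarrow> ennreal (norm (G vs x)) \<le> ennreal (l powr r * (2 * (M + 2))) + ennreal (l powr r * 2 powr (2 + r * q)) * 0"
        proof eventually_elim
          case (elim x)
          then have "ennreal \<bar>tensor_norm k (\<lambda>vs. G vs x)\<bar> \<le> ennreal (M + 1)" using FG by order
          then have "tensor_norm k (\<lambda>vs. G vs x) \<le> M + 1" using M(2) by (subst (asm) ennreal_le_iff) auto
          then have "norm (G vs x) \<le> l powr r * (2 * (M + 2))"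
            using norm_le_tensor_norm[OF vs, of "\<lambda>vs. G vs x"] M(2) l 1 by simp
          then show ?case by (simp add: ennreal_leI)
        qed
      qed simp
    next
      case 2
      have FG2: "(SUP x. SUP y. ennreal (tensor_norm k (\<lambda>vs. G vs x - G vs y) / norm (x - y) powr r)) < ennreal (M + 1)"
        using FG 2 by (simp add: F_def frac_seminorm_def)
      have diff: "norm (G vs x - G vs y) \<le> (M + 1) * (2 * l powr r)" if xy: "x \<in> CBox d l" "y \<in> CBox d l" for x y d
      proof (cases "x = y")
        case True
        then show ?thesis using M(2) by simp
      next
        case False
        have "ennreal (tensor_norm k (\<lambda>vs. G vs x - G vs y) / norm (x - y) powr r)
            \<le> (SUP x. SUP y. ennreal (tensor_norm k (\<lambda>vs. G vs x - G vs y) / norm (x - y) powr r))"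
          by (rule SUP_upper2[OF UNIV_I], rule SUP_upper[OF UNIV_I])
        then have "ennreal (tensor_norm k (\<lambda>vs. G vs x - G vs y) / norm (x - y) powr r) \<le> ennreal (M + 1)"
          using FG2 by order
        then have "tensor_norm k (\<lambda>vs. G vs x - G vs y) / norm (x - y) powr r \<le> M + 1"
          using M(2) by (subst (asm) ennreal_le_iff) auto
        then have "tensor_norm k (\<lambda>vs. G vs x - G vs y) \<le> (M + 1) * norm (x - y) powr r"
          using False by (simp add: field_simps)
        also have "norm (x - y) powr r \<le> (2 * l) powr r"
          using norm_diff_le_CBox[OF xy] r by (intro powr_mono2) auto
        also have "(2 * l) powr r = 2 powr r * l powr r" using l by (simp add: powr_mult)
        also have "(2::real) powr r \<le> 2 powr 1" using r by (intro powr_mono) auto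
        finally have "tensor_norm k (\<lambda>vs. G vs x - G vs y) \<le> (M + 1) * (2 powr 1 * l powr r)"
          using M(2) by (simp add: mult_left_mono mult_right_mono)
        then show ?thesis
          using norm_le_tensor_norm[OF vs, of "\<lambda>vs. G vs x - G vs y"] by simp
      qed
      show ?thesis
      proof (rule key[where J = "\<lambda>x. 0"])
        \<comment> \<open>The Hoelder bound is uniform over a tile, so averaging takes place with
          \<open>K = 0\<close> and only the additive term remains.\<close>
        have "ennreal (norm (G vs x)) \<le> ennreal (l powr r * (2 * (M + 2))) + ennreal 1 * (\<integral>\<^sup>+y. 0 \<partial>(lebesgue :: plane measure))" if "x \<in> U" for x
        proof -
          obtain i where i: "i \<in> I" "x \<in> Box (c i) l" using \<open>x \<in> U\<close> unfolding U by blast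
          show ?thesis
          proof (rule norm_le_average_of_differences[OF gl l mean[OF i(1)]])
            fix y assume "y \<in> Box (c i) l"
            then have "norm (G vs x - G vs y) \<le> (M + 1) * (2 * l powr r)"
              using i Box_subset_CBox by (intro diff[of _ "c i"]) blast+
            also have "\<dots> \<le> l powr r * (2 * (M + 2))" by (simp add: algebra_simps)
            finally show "ennreal (norm (G vs x - G vs y)) \<le> ennreal (l powr r * (2 * (M + 2))) + ennreal (1 * l ^ 2) * 0"
              by (simp add: ennreal_leI)
          qed (use M2 in auto)
        qed
        then show "AE x in lebesgue. x \<in> U \<longrightarrow> ennreal (norm (G vs x)) \<le> ennreal (l powr r * (2 * (M + 2))) + ennreal (l powr r * 2 powr (2 + r * q)) * 0"
          by simp
      qed simp
    next
      case 3
      then have q: "q > 1" using p unfolding q_def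
        by (metis enn2real_less_iff ennreal_1 ennreal_enn2real infinity_ennreal_def less_top ennreal_less_iff zero_le_one)
      show ?thesis
      proof (rule key[where J = "\<lambda>x. ennreal (\<bar>tensor_norm k (\<lambda>vs. G vs x)\<bar> powr q)"])
        have "ennreal_root q (\<integral>\<^sup>+x. ennreal (\<bar>tensor_norm k (\<lambda>vs. G vs x)\<bar> powr q) \<partial>lebesgue) \<le> ennreal (M + 1)"
          using FG 3 unfolding F_def Lp_norm_def q_def by simp
        then show "(\<integral>\<^sup>+x. ennreal (\<bar>tensor_norm k (\<lambda>vs. G vs x)\<bar> powr q) \<partial>lebesgue) \<le> ennreal ((M + 1) powr q)"
          using q M(2) by (intro ennreal_root_le_imp) auto
        have "ennreal (norm (G vs x)) \<le> ennreal (l powr r * (2 * (M + 2))) + ennreal (l powr r * 2 powr (2 + r * q)) * ennreal (\<bar>tensor_norm k (\<lambda>vs. G vs x)\<bar> powr q)" for x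
        proof -
          define t where "t = \<bar>tensor_norm k (\<lambda>vs. G vs x)\<bar>"
          have "norm (G vs x) \<le> t" using norm_le_tensor_norm[OF vs, of "\<lambda>vs. G vs x"] by (simp add: t_def)
          also have "t \<le> 1 + t powr q" using q by (intro le_1_plus_powr) (auto simp: t_def)
          also have "\<dots> \<le> 2 * (M + 2) + 2 powr 2 * t powr q"
            using M(2) powr_ge_zero[of t q] by (intro add_mono) auto
          finally have "ennreal (norm (G vs x)) \<le> ennreal (2 * (M + 2) + 2 powr 2 * t powr q)" by (rule ennreal_leI)
          also have "\<dots> = ennreal (2 * (M + 2)) + ennreal (2 powr 2) * ennreal (t powr q)"
            using M(2) by (subst ennreal_plus) (auto simp: ennreal_mult)
          finally show ?thesis using 3 l by (simp add: t_def)
        qed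
        then show "AE x in lebesgue. x \<in> U \<longrightarrow> ennreal (norm (G vs x)) \<le> ennreal (l powr r * (2 * (M + 2))) + ennreal (l powr r * 2 powr (2 + r * q)) * ennreal (\<bar>tensor_norm k (\<lambda>vs. G vs x)\<bar> powr q)"
          by blast
      qed
    next
      case 4
      then have q: "q > 1" using p unfolding q_def
        by (metis enn2real_less_iff ennreal_1 ennreal_enn2real infinity_ennreal_def less_top ennreal_less_iff zero_le_one)
      \<comment> \<open>\<open>K\<close> involves the single component \<open>vs\<close>, whose
        measurability in \<open>y\<close> the averaging lemma needs; the integrand \<open>K'\<close>
        of the seminorm dominates it.\<close>
      define K where "K x y = ennreal (norm (G vs x - G vs y) powr q / norm (x - y) powr (2 + r * q))" for x y
      define K' where "K' x y = ennreal (tensor_norm k (\<lambda>vs. G vs x - G vs y) powr q / norm (x - y) powr (2 + r * q))" for x y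
      have KK': "K x y \<le> K' x y" for x y
        unfolding K_def K'_def using norm_le_tensor_norm[OF vs, of "\<lambda>vs. G vs x - G vs y"] q
        by (intro ennreal_leI divide_right_mono powr_mono2) auto
      have Km: "K x \<in> borel_measurable lebesgue" for x
      proof -
        have "(\<lambda>y. norm (x - y) powr (2 + r * q)) \<in> borel_measurable borel" by measurable
        then have [measurable]: "(\<lambda>y. norm (x - y) powr (2 + r * q)) \<in> borel_measurable lebesgue"
          by (intro measurable_completion) simp
        show ?thesis unfolding K_def by measurable
      qed
      show ?thesis
      proof (rule key[where J = "\<lambda>x. \<integral>\<^sup>+y. K' x y \<partial>lebesgue"])
        have "ennreal_root q (\<integral>\<^sup>+x. \<integral>\<^sup>+y. K' x y \<partial>lebesgue \<partial>lebesgue) \<le> ennreal (M + 1)"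
          using FG 4 unfolding F_def frac_seminorm_def q_def[symmetric] K'_def by simp
        then show "(\<integral>\<^sup>+x. \<integral>\<^sup>+y. K' x y \<partial>lebesgue \<partial>lebesgue) \<le> ennreal ((M + 1) powr q)"
          using q M(2) by (intro ennreal_root_le_imp) auto
        have "ennreal (norm (G vs x)) \<le> ennreal (l powr r * (2 * (M + 2))) + ennreal (l powr r * 2 powr (2 + r * q)) * (\<integral>\<^sup>+y. K' x y \<partial>lebesgue)" if "x \<in> U" for x
        proof -
          obtain i where i: "i \<in> I" "x \<in> Box (c i) l" using \<open>x \<in> U\<close> unfolding U by blast
          have "ennreal (norm (G vs x)) \<le> ennreal (l powr r * (2 * (M + 2))) + ennreal (l powr r * 2 powr (2 + r * q)) * (\<integral>\<^sup>+y. K x y \<partial>lebesgue)"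
          proof (rule norm_le_average_of_differences[OF gl l mean[OF i(1)]])
            fix y assume y: "y \<in> Box (c i) l"
            define t where "t = norm (G vs x - G vs y) powr q / norm (x - y) powr (2 + r * q)"
            define B where "B = l powr r * 2 powr (2 + r * q) * l ^ 2"
            have B: "B \<ge> 0" "t \<ge> 0" by (auto simp: B_def t_def)
            have "norm (G vs x - G vs y) \<le> l powr r + B * t"
            proof (cases "x = y")
              case False
              have "norm (x - y) \<le> 2 * l"
                using i y Box_subset_CBox by (intro norm_diff_le_CBox[of _ "c i"]) blast+
              then show ?thesis
                unfolding B_def t_def using False q l r by (intro powr_difference_bound) auto
            qed (use B in simp)
            also have "l powr r \<le> l powr r * (2 * (M + 2))"
              using mult_left_mono[of 1 "2 * (M + 2)" "l powr r"] M(2) by simp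
            finally have "ennreal (norm (G vs x - G vs y)) \<le> ennreal (l powr r * (2 * (M + 2)) + B * t)"
              by (intro ennreal_leI) simp
            also have "\<dots> = ennreal (l powr r * (2 * (M + 2))) + ennreal B * ennreal t"
              using M2 B by (subst ennreal_plus) (auto simp: ennreal_mult)
            finally show "ennreal (norm (G vs x - G vs y)) \<le> ennreal (l powr r * (2 * (M + 2))) + ennreal (l powr r * 2 powr (2 + r * q) * l ^ 2) * K x y"
              by (simp add: B_def t_def K_def)
          qed (use M2 Km l in auto)
          also have "(\<integral>\<^sup>+y. K x y \<partial>lebesgue) \<le> (\<integral>\<^sup>+y. K' x y \<partial>lebesgue)"
            by (rule nn_integral_mono[OF KK'])
          finally show ?thesis by (simp add: add_left_mono mult_left_mono)
        qed
        then show "AE x in lebesgue. x \<in> U \<longrightarrow> ennreal (norm (G vs x)) \<le> ennreal (l powr r * (2 * (M + 2))) + ennreal (l powr r * 2 powr (2 + r * q)) * (\<integral>\<^sup>+y. K' x y \<partial>lebesgue)"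
          by blast
      qed
    qed
  qed
  show thesis
  proof (rule that[of G])
    show "weak_gradient (nat \<lfloor>s\<rfloor>) u G" using G by (simp add: k_def)
  next
    fix l and I :: "'i set" and c g
    assume "0 < l" "finite I" "emeasure lebesgue (\<Union>i\<in>I. Box (c i) l) \<le> 1"
      and g: "g = G (replicate (nat \<lfloor>s\<rfloor>) e1)"
      and "\<And>i. i \<in> I \<Longrightarrow> (LINT y:Box (c i) l|lebesgue. g y) = 0"
    then show "(\<integral>\<^sup>+x. indicator (\<Union>i\<in>I. Box (c i) l) x * ennreal (norm (g x)) \<partial>lebesgue)
        \<le> ennreal (energy_const s p M * l powr frac s)"
      using energy[of l I "\<Union>i\<in>I. Box (c i) l" c] by (simp add: vs_def k_def Ce_def r_def)
  qed
qed

text \<open>Inside tile \<open>i\<close> the gradient of \<open>u\<close> is that of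
  \<open>v i\<close>, which has mean zero because \<open>v i\<close> vanishes outside the tile;
  hence the energy estimate applies to \<open>u\<close>. Poincare's inequality on each tile
  contributes \<open>l ^ k\<close> and the energy \<open>l powr frac s\<close>, together
  \<open>l powr s\<close>. Testing with all \<open>h\<close> bounded by one is a dual form of an L^1
  bound, the form in which the transport estimate consumes it.\<close>

lemma tiled_duality:
  fixes u :: "plane \<Rightarrow> 'b::euclidean_space" and I :: "'i set"
  assumes M: "sobolev_seminorm s p u \<le> ennreal M" "M \<ge> 0" and p: "p > 1" and s: "s > 1"
    and l: "l > 0" and fin: "finite I" and U1: "emeasure lebesgue (\<Union>i\<in>I. Box (c i) l) \<le> 1"
    and disj: "\<And>i j. i \<in> I \<Longrightarrow> j \<in> I \<Longrightarrow> i \<noteq> j \<Longrightarrow> Box (c i) l \<inter> CBox (c j) l = {}"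
    and v: "\<And>i. i \<in> I \<Longrightarrow> \<exists>G. weak_gradient (nat \<lfloor>s\<rfloor>) (v i) G"
    and v0: "\<And>i x. i \<in> I \<Longrightarrow> x \<notin> Box (c i) l \<Longrightarrow> v i x = 0"
    and uv: "AE x in lebesgue. u x = (\<Sum>i\<in>I. v i x)"
    and h: "h \<in> borel_measurable lebesgue" "\<And>x. \<bar>h x\<bar> \<le> (1::real)"
  shows "norm (LINT x|lebesgue. h x *\<^sub>R u x) \<le> 2 * energy_const s p M * l powr s"
proof -
  define k where "k = nat \<lfloor>s\<rfloor>"
  define vs where "vs = replicate k e1"
  have k: "k \<ge> 1" "real k + frac s = s" using s by (auto simp: k_def frac_def le_nat_iff)
  have vs: "vs \<in> dirs k" by (simp add: vs_def)
  obtain G where G: "weak_gradient k u G" and energy: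
    "\<And>g. g = G vs \<Longrightarrow> (\<And>i. i \<in> I \<Longrightarrow> (LINT y:Box (c i) l|lebesgue. g y) = 0) \<Longrightarrow>
      (\<integral>\<^sup>+x. indicator (\<Union>i\<in>I. Box (c i) l) x * ennreal (norm (g x)) \<partial>lebesgue)
        \<le> ennreal (energy_const s p M * l powr frac s)"
  proof (rule sobolev_energy[OF M p, where ?'i = 'i], goal_cases)
    case (1 G)
    show ?case
    proof (rule 1(1))
      show "weak_gradient k u G" using 1(2) by (simp add: k_def)
    next
      fix g assume "g = G vs" "\<And>i. i \<in> I \<Longrightarrow> (LINT y:Box (c i) l|lebesgue. g y) = 0"
      then show "(\<integral>\<^sup>+x. indicator (\<Union>i\<in>I. Box (c i) l) x * ennreal (norm (g x)) \<partial>lebesgue)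
        \<le> ennreal (energy_const s p M * l powr frac s)"
        using l fin U1 by (intro 1(3)) (simp_all add: k_def vs_def)
    qed
  qed
  obtain F where F: "\<And>i. i \<in> I \<Longrightarrow> weak_gradient k (v i) (F i)"
    using v unfolding k_def by metis
  have Gm[measurable]: "G vs \<in> borel_measurable lebesgue" by (rule locally_integrable_measurable[OF weak_gradientD(2)[OF G vs]])
  have Fm: "F i vs \<in> borel_measurable lebesgue" if "i \<in> I" for i
    by (rule locally_integrable_measurable[OF weak_gradientD(2)[OF F[OF that] vs]])
  have "weak_gradient k u (\<lambda>vs x. \<Sum>i\<in>I. F i vs x)"
  proof (rule weak_gradient_AE_cong)
    show "weak_gradient k (\<lambda>x. \<Sum>i\<in>I. v i x) (\<lambda>vs x. \<Sum>i\<in>I. F i vs x)"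
      by (rule weak_gradient_sum[OF fin F])
    show "AE x in lebesgue. (\<Sum>i\<in>I. v i x) = u x" using uv by eventually_elim simp
  qed
  from weak_gradient_unique[OF G this vs] have sum: "AE x in lebesgue. G vs x = (\<Sum>i\<in>I. F i vs x)" .
  have "AE x in lebesgue. \<forall>j\<in>I. x \<notin> CBox (c j) l \<longrightarrow> F j vs x = 0"
    using fin weak_gradient_support[OF F v0 vs] by (intro AE_finite_allI) auto
  \<comment> \<open>The gradient of \<open>v j\<close> is supported in the closed tile
    \<open>j\<close>, which does not meet the open tile \<open>i\<close>; one summand
    remains.\<close>
  with sum have GF: "AE x in lebesgue. \<forall>i\<in>I. x \<in> Box (c i) l \<longrightarrow> G vs x = F i vs x"
  proof eventually_elim
    case (elim x)
    show ?case
    proof safe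
      fix i assume i: "i \<in> I" "x \<in> Box (c i) l"
      have "(\<Sum>j\<in>I. F j vs x) = (\<Sum>j\<in>I. if j = i then F i vs x else 0)"
        using elim i disj by (intro sum.cong) auto
      then show "G vs x = F i vs x" using elim i fin by simp
    qed
  qed
  have mean: "(LINT y:Box (c i) l|lebesgue. G vs y) = 0" if i: "i \<in> I" for i
  proof -
    have "(LINT y:Box (c i) l|lebesgue. G vs y) = (LINT y:CBox (c i) l|lebesgue. F i vs y)"
      using GF i by (intro set_integral_Box_CBox Gm Fm) (auto elim: eventually_mono)
    also have "\<dots> = 0" by (rule weak_gradient_mean_zero[OF F[OF i] v0[OF i] vs k(1)])
    finally show ?thesis .
  qed
  define J where "J i = (LINT x:CBox (c i) l|lebesgue. norm (F i vs x))" for i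
  have J0: "J i \<ge> 0" for i unfolding J_def set_lebesgue_integral_def by (rule integral_nonneg_AE) simp
  have Jle: "(\<Sum>i\<in>I. J i) \<le> energy_const s p M * l powr frac s"
  proof -
    have "ennreal (J i) = (\<integral>\<^sup>+x. indicator (Box (c i) l) x * ennreal (norm (G vs x)) \<partial>lebesgue)" if i: "i \<in> I" for i
    proof -
      have "J i = (LINT x:Box (c i) l|lebesgue. norm (G vs x))"
        unfolding J_def using GF i Fm[OF i]
        by (intro set_integral_Box_CBox[symmetric]) (auto elim: eventually_mono)
      moreover have "set_integrable lebesgue (Box (c i) l) (G vs)"
      proof -
        have "set_integrable lebesgue (CBox (c i) l) (G vs)"
          using weak_gradientD(2)[OF G vs] compact_CBox unfolding locally_integrable_UNIV set_integrable_def by blast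
        then show ?thesis by (rule set_integrable_subset[OF _ Box_lmeasurable Box_subset_CBox])
      qed
      ultimately have "ennreal (J i) = (\<integral>\<^sup>+x. ennreal (indicat_real (Box (c i) l) x *\<^sub>R norm (G vs x)) \<partial>lebesgue)"
        using set_integrable_norm unfolding set_lebesgue_integral_def set_integrable_def
        by (subst nn_integral_eq_integral) (auto dest: set_integrable_norm simp: set_integrable_def)
      also have "\<dots> = (\<integral>\<^sup>+x. indicator (Box (c i) l) x * ennreal (norm (G vs x)) \<partial>lebesgue)"
        by (intro nn_integral_cong) (simp add: indicator_def)
      finally show ?thesis .
    qed
    then have "ennreal (\<Sum>i\<in>I. J i) = (\<Sum>i\<in>I. \<integral>\<^sup>+x. indicator (Box (c i) l) x * ennreal (norm (G vs x)) \<partial>lebesgue)"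
      using J0 by (simp flip: sum_ennreal)
    also have "\<dots> = (\<integral>\<^sup>+x. (\<Sum>i\<in>I. indicator (Box (c i) l) x * ennreal (norm (G vs x))) \<partial>lebesgue)"
      by (rule nn_integral_sum[symmetric])
        (intro borel_measurable_times_ennreal borel_measurable_indicator Box_lmeasurable measurable_compose[OF Gm] measurable_compose[OF borel_measurable_norm] measurable_ennreal)
    also have "\<dots> = (\<integral>\<^sup>+x. indicator (\<Union>i\<in>I. Box (c i) l) x * ennreal (norm (G vs x)) \<partial>lebesgue)"
    proof (rule nn_integral_cong)
      fix x
      have "disjoint_family_on (\<lambda>i. Box (c i) l) I"
        unfolding disjoint_family_on_def using disj Box_subset_CBox by (meson disjoint_iff subsetD)
      then show "(\<Sum>i\<in>I. indicator (Box (c i) l) x * ennreal (norm (G vs x))) =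
          indicator (\<Union>i\<in>I. Box (c i) l) x * ennreal (norm (G vs x))"
        by (subst indicator_UN_disjoint[OF fin]) (simp_all add: sum_distrib_right)
    qed
    also have "\<dots> \<le> ennreal (energy_const s p M * l powr frac s)"
      using mean by (intro energy) auto
    finally show ?thesis
      using M(2) by (subst (asm) ennreal_le_iff) (auto simp: energy_const_def)
  qed
  have vi: "integrable lebesgue (\<lambda>x. h x *\<^sub>R v i x)" if i: "i \<in> I" for i
  proof (rule locally_integrable_times[OF weak_gradientD(1)[OF F[OF i]] compact_CBox h(1)])
    show "h x *\<^sub>R v i x = 0" if "x \<notin> CBox (c i) l" for x
      using that v0[OF i, of x] Box_subset_CBox by auto
  qed (use h(2) in auto)
  have "(LINT x|lebesgue. h x *\<^sub>R u x) = (LINT x|lebesgue. (\<Sum>i\<in>I. h x *\<^sub>R v i x))"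
  proof (rule integral_cong_AE)
    show "(\<lambda>x. h x *\<^sub>R u x) \<in> borel_measurable lebesgue"
      by (intro borel_measurable_scaleR h locally_integrable_measurable[OF weak_gradientD(1)[OF G]])
    show "(\<lambda>x. \<Sum>i\<in>I. h x *\<^sub>R v i x) \<in> borel_measurable lebesgue"
      by (intro borel_measurable_sum borel_measurable_integrable vi)
    show "AE x in lebesgue. h x *\<^sub>R u x = (\<Sum>i\<in>I. h x *\<^sub>R v i x)"
      using uv by eventually_elim (simp add: scaleR_sum_right)
  qed
  also have "\<dots> = (\<Sum>i\<in>I. (LINT x|lebesgue. h x *\<^sub>R v i x))"
    by (rule Bochner_Integration.integral_sum[OF vi])
  finally have "norm (LINT x|lebesgue. h x *\<^sub>R u x) \<le> (\<Sum>i\<in>I. norm (LINT x|lebesgue. h x *\<^sub>R v i x))"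
    by (simp add: norm_sum)
  also have "\<dots> \<le> (\<Sum>i\<in>I. 2 * l ^ k * J i)"
    using weak_gradient_Poincare[OF F v0 h] l unfolding J_def vs_def by (intro sum_mono) auto
  also have "\<dots> = 2 * l ^ k * (\<Sum>i\<in>I. J i)" by (simp add: sum_distrib_left)
  also have "\<dots> \<le> 2 * l ^ k * (energy_const s p M * l powr frac s)"
    using Jle l by (intro mult_left_mono) auto
  also have "\<dots> = 2 * energy_const s p M * (l powr real k * l powr frac s)"
    using l by (simp add: powr_realpow)
  also have "l powr real k * l powr frac s = l powr s"
    by (simp add: powr_add[symmetric] k(2))
  finally show ?thesis .
qed

section \<open>The weak continuity equation on a time interval\<close>

subsection \<open>Fubini's theorem for the Lebesgue measure\<close>

text \<open>Completed Lebesgue measure on a product is larger than the product of the completed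
  measures, so \<open>f\<close> is replaced by a Borel function \<open>g\<close>. Almost every slice
  of \<open>f\<close> agrees almost everywhere with that of \<open>g\<close>.\<close>

lemma lebesgue_Fubini:
  fixes f :: "'a::euclidean_space \<times> 'b::euclidean_space \<Rightarrow> real"
  assumes f: "integrable lebesgue f"
  shows "AE t in lebesgue. integrable lebesgue (\<lambda>x. f (t, x))"
    and "integrable lebesgue (\<lambda>t. LINT x|lebesgue. f (t, x))"
    and "(LINT z|lebesgue. f z) = (LINT t|lebesgue. LINT x|lebesgue. f (t, x))"
proof -
  have "f \<in> borel_measurable (completion lborel)" using f by auto
  then obtain g where g[measurable]: "g \<in> borel_measurable lborel" and fg: "AE z in lborel. f z = g z"
    using completion_ex_borel_measurable_real by blast
  have fg': "AE z in lebesgue. f z = g z" using fg by (rule AE_completion)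
  have gi: "integrable lborel g"
  proof -
    have "integrable lebesgue g"
      using f fg' g by (intro integrable_cong_AE_imp[of _ f g]) (auto simp: eq_commute elim: eventually_mono intro: measurable_completion)
    then show ?thesis using g by (simp add: integrable_completion)
  qed
  then have gi2: "integrable (lborel \<Otimes>\<^sub>M lborel) g" unfolding lborel_prod .
  have "AE z in lborel \<Otimes>\<^sub>M lborel. f z = g z" unfolding lborel_prod by (rule fg)
  then have AE: "AE t in lborel. AE x in lborel. f (t, x) = g (t, x)"
    by (rule lborel_pair.AE_pair)
  have gt: "(\<lambda>x. g (t, x)) \<in> borel_measurable lborel" for t
  proof -
    have "(\<lambda>x::'b. (t, x)) \<in> borel_measurable borel" by measurable
    from measurable_compose[OF this, of g borel] g show ?thesis by simp
  qed
  have slice: "integrable lebesgue (\<lambda>x. f (t, x)) \<longleftrightarrow> integrable lborel (\<lambda>x. g (t, x))"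
      "(LINT x|lebesgue. f (t, x)) = (LINT x|lborel. g (t, x))" if t: "AE x in lborel. f (t, x) = g (t, x)" for t
  proof -
    have t': "AE x in lebesgue. f (t, x) = g (t, x)" using t by (rule AE_completion)
    have gm: "(\<lambda>x. g (t, x)) \<in> borel_measurable lebesgue" using gt by (rule measurable_completion)
    have fm: "(\<lambda>x. f (t, x)) \<in> borel_measurable lebesgue"
      by (rule borel_measurable_AE[OF gm]) (use t' in \<open>auto elim: eventually_mono\<close>)
    show "integrable lebesgue (\<lambda>x. f (t, x)) \<longleftrightarrow> integrable lborel (\<lambda>x. g (t, x))"
      using integrable_cong_AE[OF fm gm t'] integrable_completion[OF gt] by simp
    show "(LINT x|lebesgue. f (t, x)) = (LINT x|lborel. g (t, x))"
      using integral_cong_AE[OF fm gm t'] integral_completion[OF gt] by simp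
  qed
  have "AE t in lborel. integrable lborel (\<lambda>x. g (t, x))"
    by (rule lborel_pair.AE_integrable_fst'[OF gi2])
  with AE have "AE t in lborel. integrable lebesgue (\<lambda>x. f (t, x))"
    by eventually_elim (simp add: slice)
  then show "AE t in lebesgue. integrable lebesgue (\<lambda>x. f (t, x))" by (rule AE_completion)
  have gI: "integrable lborel (\<lambda>t. LINT x|lborel. g (t, x))" by (rule lborel_pair.integrable_fst'[OF gi2])
  then have gm: "(\<lambda>t. LINT x|lborel. g (t, x)) \<in> borel_measurable lborel" by auto
  have "AE t in lborel. (LINT x|lborel. g (t, x)) = (LINT x|lebesgue. f (t, x))"
    using AE by eventually_elim (simp add: slice)
  then have eq: "AE t in lebesgue. (LINT x|lborel. g (t, x)) = (LINT x|lebesgue. f (t, x))" by (rule AE_completion)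
  have gI': "integrable lebesgue (\<lambda>t. LINT x|lborel. g (t, x))" using gI gm by (simp add: integrable_completion)
  have fm: "(\<lambda>t. LINT x|lebesgue. f (t, x)) \<in> borel_measurable lebesgue"
    by (rule borel_measurable_AE[OF measurable_completion[OF gm] eq])
  show "integrable lebesgue (\<lambda>t. LINT x|lebesgue. f (t, x))"
    by (rule integrable_cong_AE_imp[OF gI' fm]) (use eq in \<open>auto elim: eventually_mono\<close>)
  have "(LINT z|lebesgue. f z) = (LINT z|lebesgue. g z)"
    using f fg' g by (intro integral_cong_AE) (auto intro: measurable_completion)
  also have "\<dots> = (LINT z|(lborel \<Otimes>\<^sub>M lborel). g z)" using g by (simp add: integral_completion lborel_prod)
  also have "\<dots> = (LINT t|lborel. LINT x|lborel. g (t, x))" by (rule lborel_pair.integral_fst'[OF gi2, symmetric])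
  also have "\<dots> = (LINT t|lebesgue. LINT x|lborel. g (t, x))" using gm by (simp add: integral_completion)
  also have "\<dots> = (LINT t|lebesgue. LINT x|lebesgue. f (t, x))"
    by (rule integral_cong_AE[OF measurable_completion[OF gm] fm eq])
  finally show "(LINT z|lebesgue. f z) = (LINT t|lebesgue. LINT x|lebesgue. f (t, x))" .
qed

subsection \<open>Test functions in space-time\<close>

lemma smooth_fst: "smooth f \<Longrightarrow> smooth (\<lambda>z::real \<times> 'b::euclidean_space. f (fst z) :: real)"
  by (rule smooth_compose) (auto intro: smooth_bounded_linear bounded_linear_fst)

lemma has_derivative_snd_compose:
  "smooth g \<Longrightarrow> ((\<lambda>z::'a::euclidean_space \<times> 'b::euclidean_space. g (snd z)) has_derivative
    (\<lambda>w. frechet_derivative g (at (snd z)) (snd w))) (at z)"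
  by (rule has_derivative_compose[OF bounded_linear_imp_has_derivative[OF bounded_linear_snd] smooth_has_derivative])

lemma smooth_snd:
  assumes "smooth f"
  shows "smooth (\<lambda>z::'a::euclidean_space \<times> 'b::euclidean_space. f (snd z))"
proof (rule smooth_coinduct[where F = "{\<lambda>z. g (snd z) | g. smooth g}"])
  show "(\<lambda>z. f (snd z)) \<in> {\<lambda>z. g (snd z) | g. smooth g}" using assms by blast
next
  fix h :: "'a \<times> 'b \<Rightarrow> real" and z and b :: "'a \<times> 'b"
  assume "h \<in> {\<lambda>z. g (snd z) | g. smooth g}"
  then obtain g where h: "h = (\<lambda>z. g (snd z))" and g: "smooth g" by blast
  show "h differentiable (at z)"
    unfolding h differentiable_def using has_derivative_snd_compose[OF g] by blast
  assume "b \<in> Basis"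
  then have b: "snd b = 0 \<or> snd b \<in> Basis" by (auto simp: Basis_prod_def)
  define g' where "g' x = frechet_derivative g (at x) (snd b)" for x
  have "g' = (\<lambda>x. 0)" if "snd b = 0"
    using that linear_0[OF linear_frechet_derivative[OF smooth_differentiable[OF g]]] by (auto simp: g'_def)
  then have "smooth g'" using b smooth_partial[OF g] by (auto simp: g'_def[abs_def])
  moreover have "partial b h = (\<lambda>z. g' (snd z))"
    unfolding h g'_def using partial_eqI[OF has_derivative_snd_compose[OF g]] by blast
  ultimately show "partial b h \<in> {\<lambda>z. g (snd z) | g. smooth g}" by blast
qed

lemma frechet_derivative_space_time:
  fixes \<theta> :: "real \<Rightarrow> real" and \<psi> :: "'b::euclidean_space \<Rightarrow> real"
  assumes \<theta>: "smooth \<theta>" and \<psi>: "smooth \<psi>"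
  shows "frechet_derivative (\<lambda>z. \<theta> (fst z) * \<psi> (snd z)) (at (t, x)) (1, w) =
    partial 1 \<theta> t * \<psi> x + \<theta> t * frechet_derivative \<psi> (at x) w"
proof -
  have 1: "((\<lambda>z::real \<times> 'b. \<theta> (fst z)) has_derivative (\<lambda>w. frechet_derivative \<theta> (at (fst (t, x))) (fst w))) (at (t, x))"
    by (rule has_derivative_compose[OF bounded_linear_imp_has_derivative[OF bounded_linear_fst] smooth_has_derivative[OF \<theta>]])
  have 2: "((\<lambda>z::real \<times> 'b. \<psi> (snd z)) has_derivative (\<lambda>w. frechet_derivative \<psi> (at (snd (t, x))) (snd w))) (at (t, x))"
    by (rule has_derivative_snd_compose[OF \<psi>])
  show ?thesis
    using partial_eqI[OF has_derivative_mult[OF 1 2], where b = "(1, w)"] by simp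
qed

lemma test_function_space_time:
  fixes \<theta> :: "real \<Rightarrow> real"
  assumes \<theta>: "smooth \<theta>" "\<And>t. t \<notin> {a..b} \<Longrightarrow> \<theta> t = 0" and \<psi>: "test_function UNIV \<psi>" and ab: "{a..b} \<subseteq> S"
  shows "test_function (S \<times> UNIV) (\<lambda>z. \<theta> (fst z) * \<psi> (snd z))"
proof -
  obtain K where K: "compact K" "\<And>x. x \<notin> K \<Longrightarrow> \<psi> x = 0" and s: "smooth \<psi>"
    using \<psi> unfolding test_function_def by blast
  have "\<theta> (fst z) * \<psi> (snd z) = 0" if "z \<notin> {a..b} \<times> K" for z
    using that \<theta>(2)[of "fst z"] K(2)[of "snd z"] by (cases z) auto
  moreover have "compact ({a..b} \<times> K)" using K(1) by (intro compact_Times) auto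
  ultimately show ?thesis
    unfolding test_function_def using smooth_mult[OF smooth_fst[OF \<theta>(1)] smooth_snd[OF s]] ab
    by (intro conjI exI[of _ "{a..b} \<times> K"]) auto
qed

subsection \<open>Smooth approximation of the value at a time\<close>

lemma smooth_step_scaled_DERIV:
  assumes "\<epsilon> > 0"
  shows "((\<lambda>t. smooth_step ((t - a) / \<epsilon>)) has_real_derivative
    partial 1 smooth_step ((t - a) / \<epsilon>) / \<epsilon>) (at t)"
proof -
  have "((\<lambda>t. (t - a) / \<epsilon>) has_real_derivative 1 / \<epsilon>) (at t)"
    using assms by (auto intro!: derivative_eq_intros)
  from DERIV_chain2[OF smooth_step_DERIV this] show ?thesis by simp
qed

text \<open>\<open>\<beta>\<close> is the derivative of a step that rises over
  \<open>[a, a + \<epsilon>]\<close>: it has integral one, and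
  \<open>\<bar>\<beta> t\<bar> \<le> K / \<epsilon>\<close> on an interval of length
  \<open>\<epsilon>\<close>, whence the factor \<open>K\<close> in the error.\<close>

lemma smooth_step_average:
  assumes \<epsilon>: "\<epsilon> > 0" and m: "continuous_on {a..a + \<epsilon>} m" and K: "\<And>t. \<bar>partial 1 smooth_step t\<bar> \<le> K"
    and \<eta>: "\<And>t. t \<in> {a..a + \<epsilon>} \<Longrightarrow> \<bar>m t - m0\<bar> \<le> \<eta>"
  defines "\<beta> \<equiv> \<lambda>t. partial 1 smooth_step ((t - a) / \<epsilon>) / \<epsilon>"
  shows "integrable lebesgue (\<lambda>t. \<beta> t * m t)" "\<bar>(LINT t|lebesgue. \<beta> t * m t) - m0\<bar> \<le> K * \<eta>"
proof -
  let ?S = "{a..a + \<epsilon>}"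
  have K0: "K \<ge> 0" using K[of 0] by linarith
  have \<beta>0: "\<beta> t = 0" if "t \<notin> ?S" for t
    using that \<epsilon> partial_smooth_step_eq_0[of "(t - a) / \<epsilon>"] by (auto simp: \<beta>_def field_simps)
  have \<beta>K: "\<bar>\<beta> t\<bar> \<le> K / \<epsilon>" for t
    using K[of "(t - a) / \<epsilon>"] \<epsilon> by (simp add: \<beta>_def divide_right_mono)
  have "continuous_on UNIV (partial 1 smooth_step)"
    by (rule smooth_continuous_on[OF smooth_partial[OF smooth_smooth_step]]) simp
  then have \<beta>c: "continuous_on ?S \<beta>"
    unfolding \<beta>_def using \<epsilon> by (auto intro!: continuous_intros continuous_on_compose2[of UNIV "partial 1 smooth_step"])
  have int: "integrable lebesgue (\<lambda>t. \<beta> t * g t)" and eqS: "(LINT t|lebesgue. \<beta> t * g t) = integral ?S (\<lambda>t. \<beta> t * g t)"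
    if g: "continuous_on ?S g" for g
  proof -
    have "(\<lambda>t. \<beta> t * g t) absolutely_integrable_on ?S"
      by (intro absolutely_integrable_continuous_real continuous_on_mult \<beta>c g)
    then have si: "integrable lebesgue (\<lambda>t. indicat_real ?S t *\<^sub>R (\<beta> t * g t))" unfolding set_integrable_def .
    have eq: "(\<lambda>t. indicat_real ?S t *\<^sub>R (\<beta> t * g t)) = (\<lambda>t. \<beta> t * g t)"
    proof (rule ext)
      show "indicat_real ?S t *\<^sub>R (\<beta> t * g t) = \<beta> t * g t" for t
        using \<beta>0[of t] by (cases "t \<in> ?S") simp_all
    qed
    show "integrable lebesgue (\<lambda>t. \<beta> t * g t)" using si unfolding eq .
    have "(LINT t:?S|lebesgue. \<beta> t * g t) = integral ?S (\<lambda>t. \<beta> t * g t)"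
      by (intro set_lebesgue_integral_eq_integral) (use si in \<open>simp add: set_integrable_def\<close>)
    then show "(LINT t|lebesgue. \<beta> t * g t) = integral ?S (\<lambda>t. \<beta> t * g t)"
      unfolding set_lebesgue_integral_def eq .
  qed
  show "integrable lebesgue (\<lambda>t. \<beta> t * m t)" by (rule int[OF m])
  have "(\<beta> has_integral (smooth_step ((a + \<epsilon> - a) / \<epsilon>) - smooth_step ((a - a) / \<epsilon>))) ?S"
  proof (rule fundamental_theorem_of_calculus)
    fix t assume "t \<in> ?S"
    have "((\<lambda>t. smooth_step ((t - a) / \<epsilon>)) has_real_derivative \<beta> t) (at t)"
      unfolding \<beta>_def by (rule smooth_step_scaled_DERIV[OF \<epsilon>])
    then show "((\<lambda>t. smooth_step ((t - a) / \<epsilon>)) has_vector_derivative \<beta> t) (at t within ?S)"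
      by (simp add: has_real_derivative_iff_has_vector_derivative has_vector_derivative_at_within)
  qed (use \<epsilon> in simp)
  then have \<beta>1: "integral ?S \<beta> = 1" using \<epsilon> by (simp add: integral_unique)
  have "(LINT t|lebesgue. \<beta> t * m t) - m0 = integral ?S (\<lambda>t. \<beta> t * (m t - m0))"
  proof -
    have "integral ?S (\<lambda>t. \<beta> t * (m t - m0)) = integral ?S (\<lambda>t. \<beta> t * m t - \<beta> t * m0)"
      by (simp add: right_diff_distrib)
    also have "\<dots> = integral ?S (\<lambda>t. \<beta> t * m t) - integral ?S (\<lambda>t. \<beta> t * m0)"
      by (intro Henstock_Kurzweil_Integration.integral_diff integrable_continuous_real continuous_intros \<beta>c m)
    finally show ?thesis using \<beta>1 eqS[OF m] by simp
  qed
  also have "\<bar>\<dots>\<bar> \<le> (K / \<epsilon> * \<eta>) * (a + \<epsilon> - a)"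
  proof -
    have "norm (integral ?S (\<lambda>t. \<beta> t * (m t - m0))) \<le> (K / \<epsilon> * \<eta>) * (a + \<epsilon> - a)"
    proof (rule integral_bound)
      show "norm (\<beta> t * (m t - m0)) \<le> K / \<epsilon> * \<eta>" if "t \<in> ?S" for t
        unfolding norm_mult using \<beta>K[of t] \<eta>[OF that] K0 \<epsilon> by (intro mult_mono) auto
    qed (use \<epsilon> in \<open>auto intro!: continuous_intros \<beta>c m\<close>)
    then show ?thesis by simp
  qed
  also have "\<dots> = K * \<eta>" using \<epsilon> by simp
  finally show "\<bar>(LINT t|lebesgue. \<beta> t * m t) - m0\<bar> \<le> K * \<eta>" .
qed

subsection \<open>Transport cost of one time interval\<close>

text \<open>Test the equation with \<open>\<theta> t * \<psi> x\<close>, where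
  \<open>\<theta>\<close> is a smoothed indicator of \<open>[T, T']\<close>. The time derivative
  produces averages of \<open>m\<close> near both ends, and the transport term is at most
  \<open>2 * R * L * E\<close> per unit of time, with one summand \<open>R * L * E\<close> for each
  of the two coordinate directions.\<close>

lemma continuity_solution_increment:
  fixes u :: "real \<Rightarrow> plane \<Rightarrow> plane"
  assumes sol: "continuity_solution I u f \<rho>" and vel: "velocity_field I u"
    and TT: "0 \<le> T" "T < T'" "{T..T'} \<subseteq> I" and I: "\<And>t. t \<in> {T..T'} \<Longrightarrow> \<exists>t'\<in>I. t < t'"
    and R: "\<And>t x. t \<in> I \<Longrightarrow> \<bar>\<rho> t x\<bar> \<le> R" and R0: "R > 0"
    and \<psi>: "test_function UNIV \<psi>" and L: "\<And>x b. b \<in> Basis \<Longrightarrow> \<bar>partial b \<psi> x\<bar> \<le> L" and L0: "L > 0"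
    and E: "AE t in lebesgue. t \<in> {T..T'} \<longrightarrow> (\<forall>h. h \<in> borel_measurable lebesgue \<longrightarrow> (\<forall>x. \<bar>h x\<bar> \<le> (1::real)) \<longrightarrow>
        norm (LINT x|lebesgue. h x *\<^sub>R u t x) \<le> E) \<and> locally_integrable_on (u t) UNIV"
    and E0: "E \<ge> 0"
  shows "\<bar>(LINT x|lebesgue. \<rho> T' x * \<psi> x) - (LINT x|lebesgue. \<rho> T x * \<psi> x)\<bar> \<le> 2 * R * L * E * (T' - T)"
proof -
  define m where "m t = (LINT x|lebesgue. \<rho> t x * \<psi> x)" for t
  define J where "J = {T..T'}"
  have J: "J \<subseteq> I" using TT by (simp add: J_def)
  have \<psi>s: "smooth \<psi>" using \<psi> by (simp add: test_function_def)
  have mc: "continuous_on J m"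
    using sol \<psi> J unfolding continuity_solution_def m_def by (blast intro: continuous_on_subset)
  have \<rho>m: "\<rho> t \<in> borel_measurable lebesgue" if "t \<in> I" for t
    using sol that unfolding continuity_solution_def by blast
  have weak: "test_function ({t. \<exists>t'\<in>I. t < t'} \<times> UNIV) \<phi> \<Longrightarrow>
      (LINT (t, x):I \<times> UNIV|lebesgue. \<rho> t x * frechet_derivative \<phi> (at (t, x)) (1, u t x)) +
      (LINT x|lebesgue. f x * \<phi> (0, x)) = 0" for \<phi>
    using sol unfolding continuity_solution_def by blast
  \<comment> \<open>Density and velocity are given on \<open>I\<close> only. Cutting both off
    outside the closed strip over \<open>J\<close> makes them functions on all of space-time, to
    which Fubini's theorem applies.\<close>
  define P where "P z = indicat_real (J \<times> UNIV) z * \<rho> (fst z) (snd z)" for z :: "real \<times> plane"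
  have JU: "closed (J \<times> (UNIV :: plane set))" by (intro closed_Times) (auto simp: J_def)
  then have JUm: "J \<times> (UNIV :: plane set) \<in> sets lebesgue" by (intro sets_completionI_sets) (simp add: borel_closed)
  have Pm: "P \<in> borel_measurable lebesgue"
  proof -
    have "(\<lambda>(t, x). \<rho> t x) \<in> borel_measurable (lebesgue_on (I \<times> UNIV))"
      using sol unfolding continuity_solution_def by blast
    then have "(\<lambda>(t, x). \<rho> t x) \<in> borel_measurable (lebesgue_on (J \<times> UNIV))"
      by (rule measurable_restrict_mono) (use J in auto)
    then show ?thesis
      using borel_measurable_restrict_space_iff[of "J \<times> UNIV" lebesgue "\<lambda>(t, x). \<rho> t x"] JUm
      by (simp add: P_def[abs_def] case_prod_beta)
  qed
  have PR: "\<bar>P z\<bar> \<le> R" for z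
    using R[of "fst z" "snd z"] J R0 by (cases z) (auto simp: P_def indicator_def)
  define V where "V z = indicat_real (J \<times> UNIV) z *\<^sub>R u (fst z) (snd z)" for z :: "real \<times> plane"
  have Vl: "locally_integrable_on V UNIV"
    unfolding locally_integrable_UNIV
  proof safe
    fix K :: "(real \<times> plane) set" assume K: "compact K"
    have "compact (K \<inter> (J \<times> UNIV))" using K JU by (rule compact_Int_closed)
    moreover have "K \<inter> (J \<times> UNIV) \<subseteq> I \<times> UNIV" using J by auto
    ultimately have "(\<lambda>(t, x). u t x) absolutely_integrable_on (K \<inter> (J \<times> UNIV))"
      using vel unfolding velocity_field_def locally_integrable_on_def by blast
    then have "integrable lebesgue (\<lambda>z. indicat_real (K \<inter> (J \<times> UNIV)) z *\<^sub>R (case z of (t, x) \<Rightarrow> u t x))"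
      unfolding set_integrable_def .
    also have "(\<lambda>z. indicat_real (K \<inter> (J \<times> UNIV)) z *\<^sub>R (case z of (t, x) \<Rightarrow> u t x)) = (\<lambda>z. indicat_real K z *\<^sub>R V z)"
      by (auto simp: V_def indicator_def)
    finally show "integrable lebesgue (\<lambda>z. indicat_real K z *\<^sub>R V z)" .
  qed
  have Vm: "V \<in> borel_measurable lebesgue" by (rule locally_integrable_measurable[OF Vl])
  have Pl: "locally_integrable_on (\<lambda>z. P z * g z) UNIV" if g: "locally_integrable_on g UNIV" for g :: "real \<times> plane \<Rightarrow> real"
    unfolding locally_integrable_UNIV
  proof safe
    fix K :: "(real \<times> plane) set" assume K: "compact K"
    then have gi: "integrable lebesgue (\<lambda>x. indicat_real K x *\<^sub>R g x)" using g unfolding locally_integrable_UNIV by blast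
    have "integrable lebesgue (\<lambda>x. R * (indicat_real K x *\<^sub>R g x))" using gi by (rule integrable_mult_right)
    then show "integrable lebesgue (\<lambda>x. indicat_real K x *\<^sub>R (P x * g x))"
    proof (rule Bochner_Integration.integrable_bound)
      have "(\<lambda>x. P x * (indicat_real K x *\<^sub>R g x)) \<in> borel_measurable lebesgue"
        by (intro borel_measurable_times Pm borel_measurable_integrable gi)
      then show "(\<lambda>x. indicat_real K x *\<^sub>R (P x * g x)) \<in> borel_measurable lebesgue" by (simp add: mult_ac)
      have "norm (indicat_real K x *\<^sub>R (P x * g x)) \<le> norm (R * (indicat_real K x *\<^sub>R g x))" for x
        using PR[of x] R0 by (auto simp: abs_mult indicator_def intro!: mult_right_mono)
      then show "AE x in lebesgue. norm (indicat_real K x *\<^sub>R (P x * g x)) \<le> norm (R * (indicat_real K x *\<^sub>R g x))" by simp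
    qed
  qed
  have Vb: "locally_integrable_on (\<lambda>z. V z \<bullet> b) UNIV" for b
    unfolding locally_integrable_UNIV
  proof safe
    fix K :: "(real \<times> plane) set" assume "compact K"
    then have "integrable lebesgue (\<lambda>z. indicat_real K z *\<^sub>R V z)" using Vl unfolding locally_integrable_UNIV by blast
    from integrable_inner_left[OF this, of b]
    show "integrable lebesgue (\<lambda>z. indicat_real K z *\<^sub>R (V z \<bullet> b))" by (simp only: inner_scaleR_left real_scaleR_def)
  qed
  obtain K where K: "K > 0" "\<And>t. \<bar>partial 1 smooth_step t\<bar> \<le> K"
    using partial_smooth_step_bounded by blast
  define B where "B = 2 * R * L * E * (T' - T)"
  have main: "\<bar>m T' - m T\<bar> \<le> B + 2 * K * \<eta>" if \<eta>: "\<eta> > 0" for \<eta>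
  proof -
    have "uniformly_continuous_on J m" by (rule compact_uniformly_continuous[OF mc]) (simp add: J_def)
    then obtain \<delta> where \<delta>: "\<delta> > 0" "\<And>s t. s \<in> J \<Longrightarrow> t \<in> J \<Longrightarrow> \<bar>t - s\<bar> < \<delta> \<Longrightarrow> \<bar>m t - m s\<bar> < \<eta>"
      using \<eta> unfolding uniformly_continuous_on_def dist_real_def by blast
    \<comment> \<open>Ramps shorter than \<open>\<delta>\<close> keep \<open>m\<close> within
      \<open>\<eta>\<close> of its values at the ends; ramps of at most half the interval do not
      overlap.\<close>
    define \<epsilon> where "\<epsilon> = min (\<delta> / 2) ((T' - T) / 2)"
    have "\<epsilon> > 0" "\<epsilon> < \<delta>" using \<delta>(1) TT(2) by (auto simp: \<epsilon>_def)
    moreover have "\<epsilon> \<le> (T' - T) / 2" unfolding \<epsilon>_def by (rule min.cobounded2)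
    ultimately have \<epsilon>: "\<epsilon> > 0" "\<epsilon> < \<delta>" "\<epsilon> \<le> (T' - T) / 2" by blast+
    define \<theta> where "\<theta> t = smooth_step ((t - T) / \<epsilon>) - smooth_step ((t - (T' - \<epsilon>)) / \<epsilon>)" for t
    have ss: "smooth (\<lambda>t. smooth_step ((t - a) / \<epsilon>))" for a
      using smooth_affine[OF smooth_smooth_step, of "- a / \<epsilon>" "1 / \<epsilon>"] by (simp add: diff_divide_distrib)
    have \<theta>s: "smooth \<theta>" unfolding \<theta>_def by (intro smooth_diff ss)
    have ge1: "t \<ge> a + \<epsilon> \<Longrightarrow> (t - a) / \<epsilon> \<ge> 1" for t a using \<epsilon> by (simp add: field_simps)
    have le0: "t \<le> a \<Longrightarrow> (t - a) / \<epsilon> \<le> 0" for t a using \<epsilon> by (simp add: field_simps)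
    have \<theta>0: "\<theta> t = 0" if "t \<le> T \<or> t \<ge> T'" for t
    proof (cases "t \<le> T")
      case True
      then show ?thesis using le0[of t T] le0[of t "T' - \<epsilon>"] \<epsilon> by (simp add: \<theta>_def)
    next
      case False
      then have "t \<ge> T'" using that by simp
      then show ?thesis using ge1[of T t] ge1[of "T' - \<epsilon>" t] \<epsilon> by (simp add: \<theta>_def)
    qed
    have \<theta>J: "\<theta> t = 0" if "t \<notin> J" for t
      using \<theta>0[of t] that by (auto simp: J_def)
    have \<theta>1: "\<bar>\<theta> t\<bar> \<le> 1" for t
    proof -
      have "\<theta> t \<ge> 0"
      proof (cases "t \<le> T' - \<epsilon>")
        case True
        then show ?thesis using le0[of t "T' - \<epsilon>"] smooth_step_range by (simp add: \<theta>_def)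
      next
        case False
        then show ?thesis using ge1[of T t] \<epsilon> smooth_step_range by (simp add: \<theta>_def)
      qed
      moreover have "\<theta> t \<le> 1"
        using smooth_step_range(2)[of "(t - T) / \<epsilon>"] smooth_step_range(1)[of "(t - (T' - \<epsilon>)) / \<epsilon>"]
        unfolding \<theta>_def by linarith
      ultimately show ?thesis by simp
    qed
    define \<beta> where "\<beta> a t = partial 1 smooth_step ((t - a) / \<epsilon>) / \<epsilon>" for a t
    have \<theta>d: "partial 1 \<theta> t = \<beta> T t - \<beta> (T' - \<epsilon>) t" for t
    proof -
      have "(\<theta> has_real_derivative \<beta> T t - \<beta> (T' - \<epsilon>) t) (at t)"
        unfolding \<theta>_def \<beta>_def
        by (intro DERIV_diff smooth_step_scaled_DERIV \<epsilon>)
      then show ?thesis using smooth_real_DERIV[OF \<theta>s] DERIV_unique by blast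
    qed
    \<comment> \<open>The integrand of the weak equation splits into its time derivative
      \<open>F1\<close> and its transport part \<open>F2\<close>, the latter written in coordinates
      so that each summand is a test function times a locally integrable function.\<close>
    define F1 where "F1 z = (partial 1 \<theta> (fst z) * \<psi> (snd z)) * P z" for z
    define F2 where "F2 z = (\<Sum>b\<in>Basis. (\<theta> (fst z) * partial b \<psi> (snd z)) * (P z * (V z \<bullet> b)))" for z
    have \<theta>'J: "partial 1 \<theta> t = 0" if "t \<notin> J" for t
    proof -
      have "iter_deriv [1] \<theta> t = 0"
        by (rule iter_deriv_zero_open[of "- J"]) (use that \<theta>J in \<open>auto simp: J_def open_Compl\<close>)
      then show ?thesis by simp
    qed
    have test1: "test_function UNIV (\<lambda>z::real \<times> plane. partial 1 \<theta> (fst z) * \<psi> (snd z))"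
      using test_function_space_time[OF smooth_partial[OF \<theta>s] _ \<psi>, of 1 T T' UNIV] \<theta>'J by (auto simp: J_def)
    have test2: "test_function UNIV (\<lambda>z::real \<times> plane. \<theta> (fst z) * partial b \<psi> (snd z))" if b: "b \<in> Basis" for b
    proof -
      have "test_function UNIV (iter_deriv [b] \<psi>)" using b by (intro test_function_iter_deriv \<psi>) auto
      then show ?thesis
        using test_function_space_time[OF \<theta>s, of T T' _ UNIV] \<theta>J by (auto simp: J_def)
    qed
    have F1i: "integrable lebesgue F1"
      using locally_integrable_times_test[OF Pl[OF locally_integrable_1] test1] by (simp add: F1_def[abs_def])
    have F2i: "integrable lebesgue F2"
      unfolding F2_def
      by (intro Bochner_Integration.integrable_sum)
        (use locally_integrable_times_test[OF Pl[OF Vb] test2] in simp)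
    have "test_function ({t. \<exists>t'\<in>I. t < t'} \<times> UNIV) (\<lambda>z. \<theta> (fst z) * \<psi> (snd z))"
      using \<theta>J I by (intro test_function_space_time[OF \<theta>s _ \<psi>, of T T']) (auto simp: J_def)
    note weak[OF this]
    \<comment> \<open>Hence the term with the initial datum drops out, also for
      \<open>T = 0\<close>, where the ramp begins at time \<open>0\<close>.\<close>
    moreover have "\<theta> 0 = 0" using TT by (intro \<theta>0) simp
    moreover have "(LINT (t, x):I \<times> UNIV|lebesgue. \<rho> t x * frechet_derivative (\<lambda>z. \<theta> (fst z) * \<psi> (snd z)) (at (t, x)) (1, u t x))
       = (LINT z|lebesgue. F1 z + F2 z)"
      unfolding set_lebesgue_integral_def
    proof (rule Bochner_Integration.integral_cong[OF refl])
      fix z :: "real \<times> plane"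
      obtain t x where z: "z = (t, x)" by (cases z)
      show "indicat_real (I \<times> UNIV) z *\<^sub>R (case z of (t, x) \<Rightarrow> \<rho> t x * frechet_derivative (\<lambda>z. \<theta> (fst z) * \<psi> (snd z)) (at (t, x)) (1, u t x)) = F1 z + F2 z"
      proof (cases "t \<in> J")
        case True
        then have "t \<in> I" using J by blast
        have fd: "frechet_derivative (\<lambda>z. \<theta> (fst z) * \<psi> (snd z)) (at (t, x)) (1, u t x) =
            partial 1 \<theta> t * \<psi> x + \<theta> t * (\<Sum>b\<in>Basis. (u t x \<bullet> b) * partial b \<psi> x)"
          unfolding frechet_derivative_space_time[OF \<theta>s \<psi>s]
          by (subst frechet_derivative_sum_partial[OF smooth_differentiable[OF \<psi>s], of x "u t x"]) simp
        show ?thesis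
          unfolding z F1_def F2_def P_def V_def prod.case fd using True \<open>t \<in> I\<close>
          by (simp add: distrib_left sum_distrib_left mult_ac)
      next
        case False
        then show ?thesis
          unfolding z F1_def F2_def P_def V_def frechet_derivative_space_time[OF \<theta>s \<psi>s] prod.case
          by (simp add: \<theta>J \<theta>'J)
      qed
    qed
    ultimately have zero: "(LINT z|lebesgue. F1 z) + (LINT z|lebesgue. F2 z) = 0"
      using F1i F2i by simp
    have F1eq: "(LINT z|lebesgue. F1 z) = (LINT t|lebesgue. partial 1 \<theta> t * m t)"
    proof -
      have "(LINT z|lebesgue. F1 z) = (LINT t|lebesgue. LINT x|lebesgue. F1 (t, x))"
        by (rule lebesgue_Fubini(3)[OF F1i])
      also have "\<dots> = (LINT t|lebesgue. partial 1 \<theta> t * m t)"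
      proof (rule Bochner_Integration.integral_cong[OF refl])
        fix t
        show "(LINT x|lebesgue. F1 (t, x)) = partial 1 \<theta> t * m t"
        proof (cases "t \<in> J")
          case True
          then have "F1 (t, x) = partial 1 \<theta> t * (\<rho> t x * \<psi> x)" for x by (simp add: F1_def P_def)
          then show ?thesis by (simp add: m_def)
        next
          case False
          then show ?thesis by (simp add: F1_def \<theta>'J)
        qed
      qed
      finally show ?thesis .
    qed
    have F2le: "\<bar>LINT z|lebesgue. F2 z\<bar> \<le> B"
    proof -
      define w where "w t = (LINT x|lebesgue. F2 (t, x))" for t
      have "AE t in lebesgue. norm (w t) \<le> indicat_real J t * (2 * R * L * E)"
        using E
      proof eventually_elim
        case (elim t)
        show ?case
        proof (cases "t \<in> J")
          case False
          then show ?thesis by (simp add: w_def F2_def \<theta>J)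
        next
          case True
          then have tI: "t \<in> I" using J by blast
          have Et: "\<And>h. h \<in> borel_measurable lebesgue \<Longrightarrow> (\<And>x. \<bar>h x\<bar> \<le> (1::real)) \<Longrightarrow>
              norm (LINT x|lebesgue. h x *\<^sub>R u t x) \<le> E" and ul: "locally_integrable_on (u t) UNIV"
            using elim True by (auto simp: J_def)
          \<comment> \<open>Density and gradient of the test function, normalised to be bounded by
            one, form the multiplier for the dual bound \<open>E\<close>.\<close>
          define h where "h b x = \<rho> t x * partial b \<psi> x / (R * L)" for b x
          have hm: "h b \<in> borel_measurable lebesgue" if "b \<in> Basis" for b
            unfolding h_def using that
            by (intro borel_measurable_divide borel_measurable_times \<rho>m[OF tI] smooth_lebesgue_measurable smooth_partial \<psi>s borel_measurable_const)
          have h1: "\<bar>h b x\<bar> \<le> 1" if b: "b \<in> Basis" for b x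
          proof -
            have "\<bar>\<rho> t x\<bar> * \<bar>partial b \<psi> x\<bar> \<le> R * L"
              using R[OF tI, of x] L[OF b, of x] R0 by (intro mult_mono) auto
            then show ?thesis using R0 L0 by (simp add: h_def abs_mult)
          qed
          have hi: "integrable lebesgue (\<lambda>x. h b x *\<^sub>R u t x)" if b: "b \<in> Basis" for b
          proof -
            have t: "test_function UNIV (iter_deriv [b] \<psi>)" using b by (intro test_function_iter_deriv \<psi>) auto
            then obtain S where S: "compact S" "\<And>x. x \<notin> S \<Longrightarrow> partial b \<psi> x = 0"
              unfolding test_function_def by auto
            show ?thesis
              by (rule locally_integrable_times[OF ul S(1) hm[OF b] h1[OF b]]) (simp add: h_def S(2))
          qed
          have F2t: "F2 (t, x) = (\<Sum>b\<in>Basis. (\<theta> t * (R * L)) * ((h b x *\<^sub>R u t x) \<bullet> b))" for x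
            using True R0 L0 by (simp add: F2_def P_def V_def h_def mult_ac)
          have "w t = (\<Sum>b\<in>Basis. (\<theta> t * (R * L)) * ((LINT x|lebesgue. h b x *\<^sub>R u t x) \<bullet> b))"
            unfolding w_def F2t
            by (subst Bochner_Integration.integral_sum)
              (auto intro!: integrable_mult_right integrable_inner_left hi simp del: inner_scaleR_left simp: hi)
          also have "norm \<dots> \<le> (\<Sum>b\<in>(Basis::plane set). R * L * E)"
          proof (rule order_trans[OF norm_sum], rule sum_mono)
            fix b :: plane assume b: "b \<in> Basis"
            have 1: "\<bar>(LINT x|lebesgue. h b x *\<^sub>R u t x) \<bullet> b\<bar> \<le> E"
              using Et[OF hm[OF b] h1[OF b]] Basis_le_norm[OF b] order_trans by blast
            have "\<bar>\<theta> t\<bar> * (R * L) * \<bar>(LINT x|lebesgue. h b x *\<^sub>R u t x) \<bullet> b\<bar> \<le> 1 * (R * L) * E"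
              using \<theta>1[of t] 1 R0 L0 by (intro mult_mono) auto
            then show "norm ((\<theta> t * (R * L)) * ((LINT x|lebesgue. h b x *\<^sub>R u t x) \<bullet> b)) \<le> R * L * E"
              using R0 L0 by (simp add: abs_mult)
          qed
          also have "\<dots> = 2 * R * L * E" by simp
          finally show ?thesis using True by simp
        qed
      qed
      moreover have "integrable lebesgue w" unfolding w_def by (rule lebesgue_Fubini(2)[OF F2i])
      moreover have "integrable lebesgue (\<lambda>t. indicat_real J t * (2 * R * L * E))"
        unfolding J_def
        by (intro integrable_mult_left) (simp add: lmeasurable_compact flip: lmeasurable_iff_integrable)
      ultimately have "norm (LINT t|lebesgue. w t) \<le> (LINT t|lebesgue. indicat_real J t * (2 * R * L * E))"
        by (intro order_trans[OF integral_norm_bound] integral_mono_AE) auto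
      also have "\<dots> = B" using TT by (simp add: J_def B_def)
      finally show ?thesis unfolding w_def using lebesgue_Fubini(3)[OF F2i] by simp
    qed
    have J1: "{T..T + \<epsilon>} \<subseteq> J" "{T' - \<epsilon>..T' - \<epsilon> + \<epsilon>} \<subseteq> J" and "T \<in> J" "T' \<in> J" using \<epsilon> TT by (auto simp: J_def)
    have a1: "integrable lebesgue (\<lambda>t. \<beta> T t * m t)" "\<bar>(LINT t|lebesgue. \<beta> T t * m t) - m T\<bar> \<le> K * \<eta>"
    proof -
      have *: "\<bar>m t - m T\<bar> \<le> \<eta>" if "t \<in> {T..T + \<epsilon>}" for t
        using \<delta>(2)[of T t] that J1 \<open>T \<in> J\<close> \<epsilon> by (intro less_imp_le) auto
      show "integrable lebesgue (\<lambda>t. \<beta> T t * m t)" "\<bar>(LINT t|lebesgue. \<beta> T t * m t) - m T\<bar> \<le> K * \<eta>"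
        unfolding \<beta>_def using smooth_step_average[OF \<epsilon>(1) continuous_on_subset[OF mc J1(1)] K(2) *] by auto
    qed
    have a2: "integrable lebesgue (\<lambda>t. \<beta> (T' - \<epsilon>) t * m t)" "\<bar>(LINT t|lebesgue. \<beta> (T' - \<epsilon>) t * m t) - m T'\<bar> \<le> K * \<eta>"
    proof -
      have *: "\<bar>m t - m T'\<bar> \<le> \<eta>" if "t \<in> {T' - \<epsilon>..T' - \<epsilon> + \<epsilon>}" for t
        using \<delta>(2)[of T' t] that J1 \<open>T' \<in> J\<close> \<epsilon> by (intro less_imp_le) auto
      show "integrable lebesgue (\<lambda>t. \<beta> (T' - \<epsilon>) t * m t)" "\<bar>(LINT t|lebesgue. \<beta> (T' - \<epsilon>) t * m t) - m T'\<bar> \<le> K * \<eta>"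
        unfolding \<beta>_def using smooth_step_average[OF \<epsilon>(1) continuous_on_subset[OF mc J1(2)] K(2) *] by auto
    qed
    have "(LINT t|lebesgue. partial 1 \<theta> t * m t) = (LINT t|lebesgue. \<beta> T t * m t) - (LINT t|lebesgue. \<beta> (T' - \<epsilon>) t * m t)"
      unfolding \<theta>d left_diff_distrib by (rule Bochner_Integration.integral_diff[OF a1(1) a2(1)])
    then show ?thesis using zero F1eq F2le a1(2) a2(2) by linarith
  qed
  have "\<bar>m T' - m T\<bar> \<le> B"
  proof (rule field_le_epsilon)
    fix e :: real assume "e > 0"
    then show "\<bar>m T' - m T\<bar> \<le> B + e" using main[of "e / (2 * K)"] K(1) by simp
  qed
  then show ?thesis by (simp add: m_def B_def)
qed

section \<open>Mixing scales of a density that is almost one on a ball\<close>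

subsection \<open>Radial bumps\<close>

lemma measure_ball_plane: "R \<ge> 0 \<Longrightarrow> measure lebesgue (ball (y::plane) R) = pi * R ^ 2"
  by (simp add: content_ball unit_ball_vol_2)

text \<open>Using the square of the norm keeps the function smooth at the centre. The plateau is the
  concentric disc of radius \<open>sqrt (1 - d) * R\<close>, so \<open>d\<close> is the proportion
  of the area that is lost.\<close>

definition bump :: "real \<Rightarrow> plane \<Rightarrow> real \<Rightarrow> plane \<Rightarrow> real" where
  "bump d y R x = smooth_step ((1 - (norm (x - y))\<^sup>2 / R\<^sup>2) / d)"

lemma norm_square_plane: "(norm (x - y :: plane))\<^sup>2 = (x $ 1 - y $ 1) ^ 2 + (x $ 2 - y $ 2) ^ 2"
  unfolding power2_norm_eq_inner by (simp add: inner_vec_def sum_2 power2_eq_square)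

lemma smooth_bump_arg: "smooth (\<lambda>x::plane. (1 - (norm (x - y))\<^sup>2 / R\<^sup>2) / d)"
proof -
  have "smooth (\<lambda>x::plane. (1 / d) * (1 - (1 / R\<^sup>2) * ((x $ 1 - y $ 1) ^ 2 + (x $ 2 - y $ 2) ^ 2)))"
    by (rule smooth_cmult, rule smooth_diff[OF smooth_const], rule smooth_cmult)
      (intro smooth_add smooth_power smooth_diff smooth_nth smooth_const)
  then show ?thesis by (simp add: norm_square_plane)
qed

lemma smooth_bump: "smooth (bump d y R)"
  unfolding bump_def[abs_def] by (rule smooth_compose[OF smooth_smooth_step smooth_bump_arg])

lemma bump_range: "0 \<le> bump d y R x" "bump d y R x \<le> 1"
  unfolding bump_def by (rule smooth_step_range)+

lemma bump_arg_le_0: "d > 0 \<Longrightarrow> R > 0 \<Longrightarrow> norm (x - y) \<ge> R \<Longrightarrow> (1 - (norm (x - y))\<^sup>2 / R\<^sup>2) / d \<le> 0"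
  by (simp add: divide_le_0_iff power_mono)

lemma bump_eq_0: "d > 0 \<Longrightarrow> R > 0 \<Longrightarrow> x \<notin> ball y R \<Longrightarrow> bump d y R x = 0"
  using bump_arg_le_0[of d R x y] by (simp add: bump_def dist_norm norm_minus_commute)

lemma bump_eq_1: "d > 0 \<Longrightarrow> R > 0 \<Longrightarrow> (norm (x - y))\<^sup>2 \<le> (1 - d) * R\<^sup>2 \<Longrightarrow> bump d y R x = 1"
  unfolding bump_def by (rule smooth_step_eq_1) (simp add: field_simps)

lemma bump_test_function: "d > 0 \<Longrightarrow> R > 0 \<Longrightarrow> test_function UNIV (bump d y R)"
  unfolding test_function_def
  by (intro conjI smooth_bump exI[of _ "cball y R"])
    (auto simp: bump_eq_0 not_le dist_norm intro!: bump_eq_0)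

lemma partial_bump:
  assumes "d > 0" "R > 0"
  shows "partial b (bump d y R) x =
    partial 1 smooth_step ((1 - (norm (x - y))\<^sup>2 / R\<^sup>2) / d) * (- (2 * ((x - y) \<bullet> b)) / (R\<^sup>2 * d))"
proof -
  have "((\<lambda>x. (1 - (norm (x - y))\<^sup>2 / R\<^sup>2) / d) has_derivative (\<lambda>v. - (2 * ((x - y) \<bullet> v)) / (R\<^sup>2 * d))) (at x)"
    unfolding power2_norm_eq_inner using assms
    by (auto intro!: derivative_eq_intros simp: field_simps inner_commute fun_eq_iff)
  note d = partial_eqI[OF this, where b = b]
  have "(\<lambda>x. (1 - (norm (x - y))\<^sup>2 / R\<^sup>2) / d) differentiable (at x)"
    by (rule smooth_differentiable[OF smooth_bump_arg])
  from partial_compose[OF this smooth_differentiable[OF smooth_smooth_step], where b = b]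
  show ?thesis unfolding bump_def[abs_def] by (simp only: d)
qed

lemma partial_bump_eq_0:
  assumes "d > 0" "R > 0" "x \<notin> ball y R" shows "partial b (bump d y R) x = 0"
  using assms bump_arg_le_0[of d R x y] partial_smooth_step_eq_0
  by (simp add: partial_bump dist_norm norm_minus_commute)

lemma partial_bump_bound:
  assumes "d > 0" "R > 0" "b \<in> Basis" and K: "\<And>t. \<bar>partial 1 smooth_step t\<bar> \<le> K"
  shows "\<bar>partial b (bump d y R) x\<bar> \<le> 2 * K / (d * R)"
proof (cases "x \<in> ball y R")
  case True
  have K0: "K \<ge> 0" using K[of 0] by linarith
  have "\<bar>(x - y) \<bullet> b\<bar> \<le> R"
    using Basis_le_norm[OF assms(3), of "x - y"] True by (simp add: dist_norm norm_minus_commute)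
  then have "2 * \<bar>(x - y) \<bullet> b\<bar> / (R\<^sup>2 * d) \<le> 2 * R / (R\<^sup>2 * d)"
    using assms by (intro divide_right_mono) auto
  also have "\<dots> = 2 / (d * R)" using assms by (simp add: power2_eq_square field_simps)
  finally have "\<bar>- (2 * ((x - y) \<bullet> b)) / (R\<^sup>2 * d)\<bar> \<le> 2 / (d * R)" using assms by (simp add: abs_mult)
  then have "\<bar>partial b (bump d y R) x\<bar> \<le> K * (2 / (d * R))"
    unfolding partial_bump[OF assms(1,2)] abs_mult[of "partial 1 smooth_step _"] using K K0 by (intro mult_mono) auto
  then show ?thesis by (simp add: mult_ac)
next
  case False
  have "K \<ge> 0" using K[of 0] by linarith
  with False show ?thesis using assms by (simp add: partial_bump_eq_0)
qed

subsection \<open>Functions that are mostly one on a ball\<close>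

text \<open>The condition in the characteristic length scale, stated for a function rather than a
  set: \<open>\<beta>\<close> bounds the proportion of the exceptional set \<open>D\<close>, and
  equality almost everywhere makes it independent of the representative.\<close>

definition mostly_one :: "real \<Rightarrow> plane \<Rightarrow> real \<Rightarrow> (plane \<Rightarrow> real) \<Rightarrow> bool" where
  "mostly_one \<beta> y R f \<longleftrightarrow> R > 0 \<and> (\<exists>D\<in>sets lebesgue. D \<subseteq> ball y R \<and>
     measure lebesgue D \<le> \<beta> * (pi * R ^ 2) \<and> (AE x in lebesgue. x \<in> ball y R - D \<longrightarrow> f x = 1))"

lemma integrable_bounded_ball:
  fixes f :: "plane \<Rightarrow> real"
  assumes "f \<in> borel_measurable lebesgue" "AE x in lebesgue. \<bar>f x\<bar> \<le> B" "\<And>x. x \<notin> ball y R \<Longrightarrow> f x = 0"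
  shows "integrable lebesgue f"
proof (rule Bochner_Integration.integrable_bound)
  show "integrable lebesgue (\<lambda>x. B * indicat_real (ball y R) x)"
    by (intro integrable_mult_right) (simp flip: lmeasurable_iff_integrable)
  show "AE x in lebesgue. norm (f x) \<le> norm (B * indicat_real (ball y R) x)"
    using assms(2)
  proof eventually_elim
    case (elim x)
    then show ?case using assms(3)[of x] by (cases "x \<in> ball y R") auto
  qed
qed fact

text \<open>Off \<open>D\<close> the product \<open>f * w\<close> is \<open>w\<close>. On
  \<open>D\<close> it is at least \<open>-1\<close>, hence at least \<open>w - 2\<close>, so the
  loss is at most twice the measure of \<open>D\<close>.\<close>

lemma mostly_one_integral:
  assumes f: "f \<in> borel_measurable lebesgue" "AE x in lebesgue. \<bar>f x\<bar> \<le> 1" and mo: "mostly_one \<beta> y R f"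
    and w: "w \<in> borel_measurable lebesgue" "\<And>x. 0 \<le> w x" "\<And>x. w x \<le> 1" "\<And>x. x \<notin> ball y R \<Longrightarrow> w x = 0"
  shows "integrable lebesgue w" "integrable lebesgue (\<lambda>x. f x * w x)"
    "(LINT x|lebesgue. f x * w x) \<ge> (LINT x|lebesgue. w x) - 2 * \<beta> * (pi * R ^ 2)"
proof -
  obtain D where D: "D \<in> sets lebesgue" "D \<subseteq> ball y R" "measure lebesgue D \<le> \<beta> * (pi * R ^ 2)"
    "AE x in lebesgue. x \<in> ball y R - D \<longrightarrow> f x = 1"
    using mo unfolding mostly_one_def by blast
  show wi: "integrable lebesgue w"
    by (rule integrable_bounded_ball[where B = 1, OF w(1) _ w(4)]) (use w in auto)
  show fwi: "integrable lebesgue (\<lambda>x. f x * w x)"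
  proof (rule integrable_bounded_ball[where B = 1 and y = y and R = R])
    show "AE x in lebesgue. \<bar>f x * w x\<bar> \<le> 1"
      using f(2)
    proof eventually_elim
      case (elim x)
      then show ?case using w(2,3)[of x] by (simp add: abs_mult mult_le_one)
    qed
    show "(\<lambda>x. f x * w x) \<in> borel_measurable lebesgue" by (intro borel_measurable_times f w)
    show "f x * w x = 0" if "x \<notin> ball y R" for x using w(4)[OF that] by simp
  qed
  have Dl: "D \<in> lmeasurable"
    by (rule fmeasurableI2[OF lmeasurable_ball D(2,1)])
  then have Di: "integrable lebesgue (indicat_real D)" by (simp add: lmeasurable_iff_integrable)
  have "(LINT x|lebesgue. w x - 2 * indicat_real D x) \<le> (LINT x|lebesgue. f x * w x)"
  proof (rule integral_mono_AE)
    show "AE x in lebesgue. w x - 2 * indicat_real D x \<le> f x * w x"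
      using D(4) f(2)
    proof eventually_elim
      case (elim x)
      consider "x \<notin> ball y R" | "x \<in> ball y R - D" | "x \<in> D" by blast
      then show ?case
      proof cases
        case 3
        have "\<bar>f x * w x\<bar> \<le> 1" using elim w(2,3)[of x] by (simp add: abs_mult mult_le_one)
        then show ?thesis using 3 w(3)[of x] by simp
      qed (use elim w(4) in simp_all)
    qed
    show "integrable lebesgue (\<lambda>x. w x - 2 * indicat_real D x)"
      by (intro Bochner_Integration.integrable_diff wi integrable_mult_right Di)
  qed (rule fwi)
  also have "(LINT x|lebesgue. w x - 2 * indicat_real D x) = (LINT x|lebesgue. w x) - 2 * measure lebesgue D"
    using wi Di D(1) by (subst Bochner_Integration.integral_diff) auto
  finally show "(LINT x|lebesgue. f x * w x) \<ge> (LINT x|lebesgue. w x) - 2 * \<beta> * (pi * R ^ 2)"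
    using D(3) by linarith
qed

lemma measure_le_integral:
  assumes "integrable lebesgue w" "\<And>x. 0 \<le> w x" "\<And>x. x \<in> ball (y::plane) r \<Longrightarrow> w x = (1::real)" "r \<ge> 0"
  shows "pi * r ^ 2 \<le> (LINT x|lebesgue. w x)"
proof -
  have "integrable lebesgue (indicat_real (ball y r))" by (simp flip: lmeasurable_iff_integrable)
  then have "(LINT x|lebesgue. indicat_real (ball y r) x) \<le> (LINT x|lebesgue. w x)"
    using assms(1) by (rule integral_mono) (use assms in \<open>auto simp: indicator_def\<close>)
  then show ?thesis using measure_ball_plane[OF assms(4), of y] by simp
qed

text \<open>The plateau contributes \<open>(1 - d) * (pi * R ^ 2)\<close> to the integral of the
  bump, and the exceptional set takes away at most
  \<open>2 * \<beta> * (pi * R ^ 2)\<close>.\<close>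

lemma mostly_one_bump:
  assumes f: "f \<in> borel_measurable lebesgue" "AE x in lebesgue. \<bar>f x\<bar> \<le> 1" and mo: "mostly_one \<beta> y R f"
    and d: "0 < d" "d < 1"
  shows "integrable lebesgue (\<lambda>x. f x * bump d y R x)"
    "(LINT x|lebesgue. f x * bump d y R x) \<ge> (1 - d - 2 * \<beta>) * (pi * R ^ 2)"
proof -
  have R: "R > 0" using mo by (simp add: mostly_one_def)
  note * = mostly_one_integral[OF f mo smooth_lebesgue_measurable[OF smooth_bump[of d y R]]
      bump_range[of d y R] bump_eq_0[OF d(1) R]]
  show "integrable lebesgue (\<lambda>x. f x * bump d y R x)" using *(2) by blast
  have "pi * (sqrt (1 - d) * R) ^ 2 \<le> (LINT x|lebesgue. bump d y R x)"
  proof (rule measure_le_integral[OF _ bump_range(1)])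
    show "integrable lebesgue (bump d y R)" using *(1) by blast
    fix x assume "x \<in> ball y (sqrt (1 - d) * R)"
    then have "norm (x - y) \<le> sqrt (1 - d) * R" by (simp add: dist_norm norm_minus_commute)
    then have "(norm (x - y))\<^sup>2 \<le> (sqrt (1 - d) * R)\<^sup>2" by (rule power_mono) simp
    then show "bump d y R x = 1" using d R by (intro bump_eq_1) (auto simp: power_mult_distrib)
  qed (use d R in auto)
  moreover have "(sqrt (1 - d) * R) ^ 2 = (1 - d) * R ^ 2" using d by (simp add: power_mult_distrib)
  ultimately have "pi * ((1 - d) * R ^ 2) \<le> (LINT x|lebesgue. bump d y R x)" by (simp only:)
  then show "(LINT x|lebesgue. f x * bump d y R x) \<ge> (1 - d - 2 * \<beta>) * (pi * R ^ 2)"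
    using *(3) by (simp add: algebra_simps)
qed

subsection \<open>The geometric mixing scale\<close>

text \<open>If all averages over discs of radius \<open>\<epsilon>\<close> were at most
  \<open>\<kappa>\<close>, integrate them over the centres in
  \<open>ball y (R - \<epsilon>)\<close>. By Fubini's theorem this is the integral of
  \<open>f\<close> against a weight between \<open>0\<close> and \<open>1\<close> that is one on
  \<open>ball y (R - 2 * \<epsilon>)\<close> and zero outside \<open>ball y R\<close>. Comparison
  with \<open>mostly_one_integral\<close> gives \<open>(R - 2 * \<epsilon>) ^ 2 \<le> (\<kappa> + 2
  * \<beta>) * R ^ 2\<close>, contrary to the choice of \<open>\<epsilon>\<close>. Averaging over
  centres avoids any covering argument.\<close>

lemma mostly_one_small_ball:
  assumes f: "f \<in> borel_measurable lebesgue" "AE x in lebesgue. \<bar>f x\<bar> \<le> 1" and mo: "mostly_one \<beta> y R f"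
    and \<epsilon>: "0 < \<epsilon>" "4 * \<epsilon> < (1 - 2 * \<beta> - \<kappa>) * R" and \<kappa>: "\<kappa> \<ge> 0" and \<beta>: "\<beta> \<ge> 0"
  shows "\<exists>x. (LINT z:ball x \<epsilon>|lebesgue. f z) > \<kappa> * (pi * \<epsilon> ^ 2)"
proof (rule ccontr)
  assume "\<not> ?thesis"
  then have avg: "(LINT z:ball x \<epsilon>|lebesgue. f z) \<le> \<kappa> * (pi * \<epsilon> ^ 2)" for x by (auto simp: not_less)
  have R: "R > 0" using mo by (simp add: mostly_one_def)
  have "(1 - 2 * \<beta> - \<kappa>) * R \<le> 1 * R" using R \<kappa> \<beta> by (intro mult_right_mono) auto
  then have \<epsilon>R: "4 * \<epsilon> < R" using \<epsilon> by simp
  obtain g0 where g0: "g0 \<in> borel_measurable lborel" and fg0: "AE x in lborel. f x = g0 x"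
    using completion_ex_borel_measurable_real[of f lborel] f(1) by blast
  \<comment> \<open>A Borel version with values in \<open>[-1, 1]\<close> everywhere, so that the
    integrand over pairs of points is jointly measurable and bounded.\<close>
  define g where "g x = max (- 1) (min 1 (g0 x))" for x
  have g[measurable]: "g \<in> borel_measurable borel" using g0 unfolding g_def[abs_def] by measurable
  have fg: "AE x in lebesgue. f x = g x"
    using AE_completion[OF fg0] f(2) by eventually_elim (auto simp: g_def)
  have g1: "\<bar>g x\<bar> \<le> 1" for x by (auto simp: g_def)
  define F where "F x z = indicat_real (ball y (R - \<epsilon>)) x * (indicat_real (ball x \<epsilon>) z * g z)" for x z
  have dm: "Measurable.pred (borel \<Otimes>\<^sub>M borel) (\<lambda>p::plane \<times> plane. snd p \<in> ball (fst p) \<epsilon>)"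
    unfolding mem_ball by measurable
  have Fm[measurable]: "case_prod F \<in> borel_measurable (borel \<Otimes>\<^sub>M borel)"
  proof -
    have "(\<lambda>p::plane \<times> plane. indicat_real {p. snd p \<in> ball (fst p) \<epsilon>} p) \<in> borel_measurable (borel \<Otimes>\<^sub>M borel)"
      using dm by (intro borel_measurable_indicator) (simp add: pred_def space_pair_measure)
    then have b: "(\<lambda>p::plane \<times> plane. indicat_real (ball (fst p) \<epsilon>) (snd p)) \<in> borel_measurable (borel \<Otimes>\<^sub>M borel)"
      by (simp add: indicator_def)
    have a: "(\<lambda>p::plane \<times> plane. indicat_real (ball y (R - \<epsilon>)) (fst p)) \<in> borel_measurable (borel \<Otimes>\<^sub>M borel)"
      by (rule measurable_compose[OF measurable_fst]) (auto intro!: borel_measurable_indicator)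
    have c: "(\<lambda>p::plane \<times> plane. g (snd p)) \<in> borel_measurable (borel \<Otimes>\<^sub>M borel)"
      by (rule measurable_compose[OF measurable_snd g])
    show ?thesis
      unfolding F_def[abs_def] case_prod_beta' by (intro borel_measurable_times a b c)
  qed
  have Fint: "integrable (lborel \<Otimes>\<^sub>M lborel) (case_prod F)"
  proof (rule Bochner_Integration.integrable_bound)
    have "bounded (ball y R \<times> ball y R)" by (intro bounded_Times) auto
    then have "emeasure lborel (ball y R \<times> ball y R) < \<infinity>" by (rule emeasure_bounded_finite)
    then show "integrable (lborel \<Otimes>\<^sub>M lborel) (indicat_real (ball y R \<times> ball y R))"
      unfolding lborel_prod by (intro integrable_real_indicator) (auto simp: open_Times borel_open)
    show "AE p in lborel \<Otimes>\<^sub>M lborel. norm (case_prod F p) \<le> norm (indicat_real (ball y R \<times> ball y R) p)"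
    proof (intro always_eventually allI)
      fix p :: "plane \<times> plane" obtain x z where p: "p = (x, z)" by (cases p)
      have "z \<in> ball y R" "x \<in> ball y R" if "x \<in> ball y (R - \<epsilon>)" "z \<in> ball x \<epsilon>"
        using that dist_triangle[of y z x] \<epsilon> by auto
      then show "norm (case_prod F p) \<le> norm (indicat_real (ball y R \<times> ball y R) p)"
        unfolding p F_def using g1[of z] by (auto simp: indicator_def)
    qed
  qed (use Fm in simp)
  have gball: "(LINT z|lborel. indicat_real (ball x \<epsilon>) z * g z) \<le> \<kappa> * (pi * \<epsilon> ^ 2)" for x
  proof -
    have gb: "(\<lambda>z. indicat_real (ball x \<epsilon>) z * g z) \<in> borel_measurable lborel"
      by (intro borel_measurable_times borel_measurable_indicator) (use g in auto)
    have "(LINT z|lborel. indicat_real (ball x \<epsilon>) z * g z) = (LINT z|lebesgue. indicat_real (ball x \<epsilon>) z * g z)"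
      using gb by (simp only: integral_completion)
    also have "\<dots> = (LINT z|lebesgue. indicat_real (ball x \<epsilon>) z *\<^sub>R f z)"
    proof (rule integral_cong_AE)
      show "(\<lambda>z. indicat_real (ball x \<epsilon>) z * g z) \<in> borel_measurable lebesgue"
        using gb by (rule measurable_completion)
      show "(\<lambda>z. indicat_real (ball x \<epsilon>) z *\<^sub>R f z) \<in> borel_measurable lebesgue"
        by (intro borel_measurable_scaleR borel_measurable_indicator f) auto
      show "AE z in lebesgue. indicat_real (ball x \<epsilon>) z * g z = indicat_real (ball x \<epsilon>) z *\<^sub>R f z"
        using fg by eventually_elim simp
    qed
    finally show ?thesis using avg[of x] by (simp add: set_lebesgue_integral_def)
  qed
  have upper: "(LINT x|lborel. LINT z|lborel. F x z) \<le> (pi * (R - \<epsilon>) ^ 2) * (\<kappa> * (pi * \<epsilon> ^ 2))"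
  proof -
    have "(LINT x|lborel. LINT z|lborel. F x z) \<le> (LINT x|lborel. indicat_real (ball y (R - \<epsilon>)) x * (\<kappa> * (pi * \<epsilon> ^ 2)))"
    proof (rule integral_mono)
      show "integrable lborel (\<lambda>x. LINT z|lborel. F x z)"
        using lborel_pair.integrable_fst'[OF Fint] by simp
      show "integrable lborel (\<lambda>x. indicat_real (ball y (R - \<epsilon>)) x * (\<kappa> * (pi * \<epsilon> ^ 2)))"
        by (intro integrable_mult_left integrable_real_indicator)
          (auto intro!: emeasure_bounded_finite[unfolded infinity_ennreal_def])
      show "(LINT z|lborel. F x z) \<le> indicat_real (ball y (R - \<epsilon>)) x * (\<kappa> * (pi * \<epsilon> ^ 2))" for x
        using gball[of x] by (simp add: F_def indicator_def[of "ball y (R - \<epsilon>)"])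
    qed
    also have "\<dots> = measure lebesgue (ball y (R - \<epsilon>)) * (\<kappa> * (pi * \<epsilon> ^ 2))" by simp
    also have "\<dots> = (pi * (R - \<epsilon>) ^ 2) * (\<kappa> * (pi * \<epsilon> ^ 2))"
      using \<epsilon>R \<epsilon> by (subst measure_ball_plane) auto
    finally show ?thesis .
  qed
  \<comment> \<open>The share of the disc of radius \<open>\<epsilon>\<close> around
    \<open>z\<close> that lies in the set of centres, obtained by exchanging the integrals.\<close>
  define W where "W z = (LINT x|lborel. indicat_real (ball y (R - \<epsilon>)) x * indicat_real (ball x \<epsilon>) z) / (pi * \<epsilon> ^ 2)" for z
  have Weq: "W z = measure lebesgue (ball y (R - \<epsilon>) \<inter> ball z \<epsilon>) / (pi * \<epsilon> ^ 2)" for z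
  proof -
    have "indicat_real (ball y (R - \<epsilon>)) x * indicat_real (ball x \<epsilon>) z = indicat_real (ball y (R - \<epsilon>) \<inter> ball z \<epsilon>) x" for x
      by (auto simp: indicator_def dist_commute)
    then show ?thesis by (simp add: W_def)
  qed
  have Wb: "W \<in> borel_measurable borel"
  proof -
    have "(\<lambda>p::plane \<times> plane. indicat_real {p. fst p \<in> ball (snd p) \<epsilon>} p) \<in> borel_measurable (borel \<Otimes>\<^sub>M borel)"
      unfolding mem_ball borel_prod
      by (intro borel_measurable_indicator borel_open open_Collect_less continuous_intros)
    then have i: "(\<lambda>p::plane \<times> plane. indicat_real (ball (snd p) \<epsilon>) (fst p)) \<in> borel_measurable (borel \<Otimes>\<^sub>M borel)"
      by (simp add: indicator_def)
    have "(\<lambda>p::plane \<times> plane. indicat_real (ball y (R - \<epsilon>)) (snd p)) \<in> borel_measurable (borel \<Otimes>\<^sub>M borel)"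
      by (rule measurable_compose[OF measurable_snd]) (auto intro!: borel_measurable_indicator)
    from borel_measurable_times[OF this i]
    have "(\<lambda>(z, x). indicat_real (ball y (R - \<epsilon>)) x * indicat_real (ball x \<epsilon>) z) \<in> borel_measurable (borel \<Otimes>\<^sub>M borel)"
      by (simp add: case_prod_beta')
    moreover have "sets (borel \<Otimes>\<^sub>M lborel :: (plane \<times> plane) measure) = sets (borel \<Otimes>\<^sub>M borel)"
      by (intro sets_pair_measure_cong) auto
    ultimately have "(\<lambda>(z, x). indicat_real (ball y (R - \<epsilon>)) x * indicat_real (ball x \<epsilon>) z) \<in> borel_measurable (borel \<Otimes>\<^sub>M lborel)"
      using measurable_cong_sets[OF _ refl] by blast
    from lborel.borel_measurable_lebesgue_integral[OF this]
    show ?thesis unfolding W_def[abs_def] by (intro borel_measurable_divide) auto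
  qed
  then have Wm: "W \<in> borel_measurable lebesgue" by (intro measurable_completion) simp
  have \<epsilon>pi: "pi * \<epsilon> ^ 2 > 0" using \<epsilon> by simp
  have W0: "W z \<ge> 0" for z using \<epsilon>pi by (simp add: Weq)
  have W1: "W z \<le> 1" for z
  proof -
    have "measure lebesgue (ball y (R - \<epsilon>) \<inter> ball z \<epsilon>) \<le> measure lebesgue (ball z \<epsilon>)"
      by (intro measure_mono_fmeasurable) auto
    then show ?thesis using \<epsilon>pi measure_ball_plane[of \<epsilon> z] \<epsilon> by (simp add: Weq)
  qed
  have Wout: "W z = 0" if "z \<notin> ball y R" for z
  proof -
    have "ball y (R - \<epsilon>) \<inter> ball z \<epsilon> = {}"
    proof (rule equals0I)
      fix x assume "x \<in> ball y (R - \<epsilon>) \<inter> ball z \<epsilon>"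
      then show False using that dist_triangle2[of y z x] by simp
    qed
    then show ?thesis by (simp add: Weq)
  qed
  have Win: "W z = 1" if "z \<in> ball y (R - 2 * \<epsilon>)" for z
  proof -
    have "ball y (R - \<epsilon>) \<inter> ball z \<epsilon> = ball z \<epsilon>"
    proof (rule Int_absorb1, rule subsetI)
      fix x assume "x \<in> ball z \<epsilon>"
      then show "x \<in> ball y (R - \<epsilon>)" using that dist_triangle[of y x z] by simp
    qed
    then show ?thesis using \<epsilon>pi measure_ball_plane[of \<epsilon> z] \<epsilon> by (simp add: Weq)
  qed
  note M = mostly_one_integral[OF f mo Wm W0 W1 Wout]
  have "(LINT x|lborel. LINT z|lborel. F x z) = (LINT z|lborel. LINT x|lborel. F x z)"
    by (rule lborel_pair.Fubini_integral[OF Fint, symmetric])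
  also have "\<dots> = (LINT z|lborel. (pi * \<epsilon> ^ 2) * (g z * W z))"
  proof (rule Bochner_Integration.integral_cong[OF refl])
    fix z
    have "(LINT x|lborel. F x z) = (LINT x|lborel. (indicat_real (ball y (R - \<epsilon>)) x * indicat_real (ball x \<epsilon>) z) * g z)"
      by (simp add: F_def mult_ac)
    also have "\<dots> = (LINT x|lborel. indicat_real (ball y (R - \<epsilon>)) x * indicat_real (ball x \<epsilon>) z) * g z"
      by simp
    finally show "(LINT x|lborel. F x z) = (pi * \<epsilon> ^ 2) * (g z * W z)"
      using \<epsilon>pi by (simp add: W_def)
  qed
  also have "\<dots> = (pi * \<epsilon> ^ 2) * (LINT z|lebesgue. f z * W z)"
  proof -
    have "(\<lambda>z. g z * W z) \<in> borel_measurable lborel" using Wb by simp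
    then have "(LINT z|lborel. g z * W z) = (LINT z|lebesgue. g z * W z)" by (rule integral_completion[symmetric])
    moreover have "(LINT z|lebesgue. g z * W z) = (LINT z|lebesgue. f z * W z)"
      using fg f(1) Wm measurable_completion[of g lborel borel] by (intro integral_cong_AE) (auto elim: eventually_mono)
    ultimately show ?thesis by simp
  qed
  finally have "(pi * \<epsilon> ^ 2) * (LINT z|lebesgue. f z * W z) \<le> (pi * \<epsilon> ^ 2) * (\<kappa> * (pi * (R - \<epsilon>) ^ 2))"
    using upper by (simp add: mult_ac)
  then have "(LINT z|lebesgue. f z * W z) \<le> \<kappa> * (pi * (R - \<epsilon>) ^ 2)"
    using \<epsilon>pi by (simp only: mult_le_cancel_left_pos)
  also have "\<dots> \<le> \<kappa> * (pi * R ^ 2)"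
    using \<kappa> \<epsilon> \<epsilon>R by (intro mult_left_mono power_mono) auto
  finally have "(LINT x|lebesgue. W x) - 2 * \<beta> * (pi * R ^ 2) \<le> \<kappa> * (pi * R ^ 2)" using M(3) by linarith
  moreover have "pi * (R - 2 * \<epsilon>) ^ 2 \<le> (LINT x|lebesgue. W x)"
    using \<epsilon>R \<epsilon> by (intro measure_le_integral M(1) W0 Win) auto
  ultimately have "pi * (R - 2 * \<epsilon>) ^ 2 \<le> pi * ((\<kappa> + 2 * \<beta>) * R ^ 2)" by (simp add: algebra_simps)
  then have 1: "(R - 2 * \<epsilon>) ^ 2 \<le> (\<kappa> + 2 * \<beta>) * R ^ 2" by (simp add: mult_le_cancel_left_pos)
  have "(R - 2 * \<epsilon>) ^ 2 = R ^ 2 - 4 * \<epsilon> * R + (2 * \<epsilon>) ^ 2" by (simp add: power2_eq_square algebra_simps)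
  then have 2: "R ^ 2 - 4 * \<epsilon> * R \<le> (R - 2 * \<epsilon>) ^ 2" by simp
  have 3: "4 * \<epsilon> * R < (1 - 2 * \<beta> - \<kappa>) * R * R" using \<epsilon>(2) R by (rule mult_strict_right_mono)
  have "R ^ 2 - (\<kappa> + 2 * \<beta>) * R ^ 2 = (1 - 2 * \<beta> - \<kappa>) * R * R"
    by (simp add: power2_eq_square algebra_simps)
  with 1 2 3 show False by linarith
qed

text \<open>Since \<open>\<bar>f\<bar>\<close> is at most one, the threshold of the mixing scale is
  at most \<open>\<kappa>\<close>, and by \<open>mostly_one_small_ball\<close> no smaller radius is
  admissible.\<close>

lemma geometric_mixing_scale_ge:
  assumes f: "f \<in> borel_measurable lebesgue" "AE x in lebesgue. \<bar>f x\<bar> \<le> 1" and mo: "mostly_one \<beta> y R f"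
    and \<kappa>: "\<kappa> \<ge> 0" and \<beta>: "\<beta> \<ge> 0"
  shows "geometric_mixing_scale \<kappa> f \<ge> ereal ((1 - 2 * \<beta> - \<kappa>) * R / 4)"
  unfolding geometric_mixing_scale_def
proof (rule Inf_greatest)
  fix e
  assume "e \<in> {ereal \<epsilon> | \<epsilon>. \<epsilon> > 0 \<and> (\<forall>x. ennreal \<bar>(LINT y:ball x \<epsilon>|lebesgue. f y) / measure lebesgue (ball x \<epsilon>)\<bar>
    \<le> ennreal \<kappa> * Lp_norm \<infinity> f)}"
  then obtain \<epsilon> where e: "e = ereal \<epsilon>" and \<epsilon>: "\<epsilon> > 0"
    and le: "\<And>x. ennreal \<bar>(LINT y:ball x \<epsilon>|lebesgue. f y) / measure lebesgue (ball x \<epsilon>)\<bar> \<le> ennreal \<kappa> * Lp_norm \<infinity> f"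
    by blast
  have L1: "Lp_norm \<infinity> f \<le> 1"
    unfolding Lp_norm_def using f by (auto intro!: esssup_I elim!: eventually_mono)
  have "(1 - 2 * \<beta> - \<kappa>) * R / 4 \<le> \<epsilon>"
  proof (rule ccontr)
    assume "\<not> ?thesis"
    then have "4 * \<epsilon> < (1 - 2 * \<beta> - \<kappa>) * R" by simp
    from mostly_one_small_ball[OF f mo \<epsilon> this \<kappa> \<beta>] obtain x where
      x: "(LINT z:ball x \<epsilon>|lebesgue. f z) > \<kappa> * (pi * \<epsilon> ^ 2)" by blast
    have m: "measure lebesgue (ball x \<epsilon>) = pi * \<epsilon> ^ 2" using measure_ball_plane[of \<epsilon> x] \<epsilon> by simp
    have "ennreal \<bar>(LINT y:ball x \<epsilon>|lebesgue. f y) / (pi * \<epsilon> ^ 2)\<bar> \<le> ennreal \<kappa> * Lp_norm \<infinity> f"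
      using le[of x] unfolding m .
    also have "\<dots> \<le> ennreal \<kappa> * 1" using L1 by (rule mult_left_mono) simp
    finally have "\<bar>(LINT y:ball x \<epsilon>|lebesgue. f y) / (pi * \<epsilon> ^ 2)\<bar> \<le> \<kappa>"
      using \<kappa> by (simp only: mult_1_right ennreal_le_iff)
    then have "(LINT y:ball x \<epsilon>|lebesgue. f y) / (pi * \<epsilon> ^ 2) \<le> \<kappa>" by linarith
    then have "(LINT y:ball x \<epsilon>|lebesgue. f y) \<le> \<kappa> * (pi * \<epsilon> ^ 2)" using \<epsilon> by (simp add: divide_le_eq)
    with x show False by linarith
  qed
  then show "ereal ((1 - 2 * \<beta> - \<kappa>) * R / 4) \<le> e" by (simp add: e)
qed

subsection \<open>The functional mixing scale\<close>

lemma smooth_locally_integrable: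
  assumes f: "smooth f" shows "locally_integrable_on f UNIV"
  unfolding locally_integrable_UNIV
proof safe
  fix K :: "'a set" assume K: "compact K"
  then have "bounded (f ` K)"
    using compact_continuous_image[OF smooth_continuous_on[OF f]] compact_imp_bounded by blast
  then obtain B where B: "\<And>x. x \<in> K \<Longrightarrow> \<bar>f x\<bar> \<le> B" unfolding bounded_iff by auto
  have m: "(\<lambda>x. indicat_real K x * f x) \<in> borel_measurable lebesgue"
    using K by (intro borel_measurable_times borel_measurable_indicator smooth_lebesgue_measurable f)
      (simp add: lmeasurable_compact fmeasurableD)
  have "integrable lebesgue (\<lambda>x. (indicat_real K x * f x) *\<^sub>R (1::real))"
    by (rule locally_integrable_times[OF locally_integrable_1 K m, of B]) (use B in auto)
  then show "integrable lebesgue (\<lambda>x. indicat_real K x *\<^sub>R f x)" by simp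
qed

lemma test_function_integrable: "test_function UNIV f \<Longrightarrow> integrable lebesgue f"
  using locally_integrable_times_test[OF locally_integrable_1] by simp

lemma test_function_bounded:
  assumes "test_function UNIV f"
  obtains B where "B > 0" "\<And>x. \<bar>f x\<bar> \<le> B"
proof -
  obtain K where K: "compact K" "\<And>x. x \<notin> K \<Longrightarrow> f x = 0" and s: "smooth f"
    using assms unfolding test_function_def by blast
  have "bounded (f ` K)"
    using compact_continuous_image[OF smooth_continuous_on[OF s] K(1)] compact_imp_bounded by blast
  then obtain B where B: "B > 0" "\<And>x. x \<in> K \<Longrightarrow> \<bar>f x\<bar> \<le> B" unfolding bounded_pos by auto
  have "\<bar>f x\<bar> \<le> B" for x using B(2)[of x] K(2)[of x] B(1) by (cases "x \<in> K") auto
  with B(1) show thesis by (rule that)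
qed

lemma smooth_line_DERIV:
  assumes "smooth f"
  shows "((\<lambda>t. f (x + t *\<^sub>R b)) has_real_derivative partial b f (x + t *\<^sub>R b)) (at t)"
proof -
  have 1: "((\<lambda>t. x + t *\<^sub>R b) has_derivative (\<lambda>h. h *\<^sub>R b)) (at t)"
    by (auto intro!: derivative_eq_intros)
  from has_derivative_compose[OF 1 smooth_has_derivative[OF assms]]
  have "((\<lambda>t. f (x + t *\<^sub>R b)) has_derivative (\<lambda>h. frechet_derivative f (at (x + t *\<^sub>R b)) (h *\<^sub>R b))) (at t)" .
  also have "(\<lambda>h. frechet_derivative f (at (x + t *\<^sub>R b)) (h *\<^sub>R b)) = (*) (partial b f (x + t *\<^sub>R b))"
    using linear_frechet_derivative[OF smooth_differentiable[OF assms]] by (auto simp: linear_cmul)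
  finally show ?thesis by (simp add: has_field_derivative_def)
qed

lemma partial_bound_difference:
  assumes "smooth f" "\<And>x. \<bar>partial b f x\<bar> \<le> L"
  shows "\<bar>f (x + t *\<^sub>R b) - f x\<bar> \<le> L * \<bar>t\<bar>"
proof -
  have "norm ((\<lambda>t. f (x + t *\<^sub>R b)) t - (\<lambda>t. f (x + t *\<^sub>R b)) 0) \<le> L * norm (t - 0)"
    by (rule field_differentiable_bound[of UNIV "\<lambda>t. f (x + t *\<^sub>R b)" "\<lambda>t. partial b f (x + t *\<^sub>R b)"])
      (use assms in \<open>auto intro: smooth_line_DERIV\<close>)
  then show ?thesis by simp
qed

text \<open>Difference quotients have integral zero by translation invariance, and they converge to
  the partial derivative under a common bound with compact support.\<close>

lemma integral_partial_eq_0: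
  fixes f :: "'a::euclidean_space \<Rightarrow> real"
  assumes f: "test_function UNIV f" and b: "b \<in> Basis"
  shows "(LINT x|lebesgue. partial b f x) = 0"
proof -
  obtain K where K: "compact K" "\<And>x. x \<notin> K \<Longrightarrow> f x = 0" and s: "smooth f"
    using f unfolding test_function_def by blast
  have "test_function UNIV (partial b f)" using test_function_iter_deriv[OF f, of "[b]"] b by simp
  then obtain L where L: "L > 0" "\<And>x. \<bar>partial b f x\<bar> \<le> L" by (rule test_function_bounded) blast
  obtain R where R: "\<And>x. x \<in> K \<Longrightarrow> norm x \<le> R" using compact_imp_bounded[OF K(1)] unfolding bounded_iff by blast
  define h where "h n = 1 / real (Suc n)" for n
  have h: "h n > 0" "h n \<le> 1" for n by (auto simp: h_def)
  have h0: "h \<longlonglongrightarrow> 0" unfolding h_def by (rule LIMSEQ_Suc[OF lim_1_over_n])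
  have fi: "integrable lebesgue f" by (rule test_function_integrable[OF f])
  have fhi: "integrable lebesgue (\<lambda>x. f (x + h n *\<^sub>R b))" for n
    using integrable_dilation[OF _ fi, of 1 "h n *\<^sub>R b"] by (simp add: add.commute)
  have z: "(LINT x|lebesgue. (f (x + h n *\<^sub>R b) - f x) / h n) = 0" for n
  proof -
    have "(LINT x|lebesgue. f (x + h n *\<^sub>R b)) = (LINT x|lebesgue. f x)"
      using integral_dilation[of 1 f "h n *\<^sub>R b"] by (simp add: add.commute)
    then show ?thesis using fi fhi by simp
  qed
  have "(\<lambda>n. LINT x|lebesgue. (f (x + h n *\<^sub>R b) - f x) / h n) \<longlonglongrightarrow> (LINT x|lebesgue. partial b f x)"
  \<comment> \<open>The increments \<open>h n\<close> are at most one, so all quotients vanish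
    outside the ball whose radius exceeds that of the support by one.\<close>
  proof (rule integral_dominated_convergence[where w = "\<lambda>x. L * indicat_real (cball 0 (R + 1)) x"])
    show "partial b f \<in> borel_measurable lebesgue" by (rule smooth_lebesgue_measurable[OF smooth_partial[OF s b]])
    show "(\<lambda>x. (f (x + h n *\<^sub>R b) - f x) / h n) \<in> borel_measurable lebesgue" for n
      by (intro borel_measurable_divide borel_measurable_diff borel_measurable_const
        borel_measurable_integrable[OF fi] borel_measurable_integrable[OF fhi])
    show "integrable lebesgue (\<lambda>x. L * indicat_real (cball 0 (R + 1)) x)"
      by (intro integrable_mult_right) (simp add: lmeasurable_compact flip: lmeasurable_iff_integrable)
    show "AE x in lebesgue. (\<lambda>n. (f (x + h n *\<^sub>R b) - f x) / h n) \<longlonglongrightarrow> partial b f x"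
    proof (intro always_eventually allI)
      fix x
      have "((\<lambda>t. (f (x + t *\<^sub>R b) - f (x + 0 *\<^sub>R b)) / (t - 0)) \<longlongrightarrow> partial b f (x + 0 *\<^sub>R b)) (at 0)"
        using smooth_line_DERIV[OF s, of x b 0] unfolding has_field_derivative_iff .
      then have "((\<lambda>t. (f (x + t *\<^sub>R b) - f x) / t) \<longlongrightarrow> partial b f x) (at 0)" by simp
      moreover have "filterlim h (at 0) sequentially"
        using h0 h(1) by (intro filterlim_atI) (auto intro!: always_eventually simp: less_imp_neq[symmetric])
      ultimately show "(\<lambda>n. (f (x + h n *\<^sub>R b) - f x) / h n) \<longlonglongrightarrow> partial b f x"
        by (rule filterlim_compose)
    qed
    show "AE x in lebesgue. norm ((f (x + h n *\<^sub>R b) - f x) / h n) \<le> L * indicat_real (cball 0 (R + 1)) x" for n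
    proof (intro always_eventually allI)
      fix x
      show "norm ((f (x + h n *\<^sub>R b) - f x) / h n) \<le> L * indicat_real (cball 0 (R + 1)) x"
      proof (cases "x \<in> cball 0 (R + 1)")
        case True
        have "\<bar>f (x + h n *\<^sub>R b) - f x\<bar> \<le> L * h n"
          using partial_bound_difference[OF s L(2), of x "h n"] h(1)[of n] by simp
        then show ?thesis using True h(1)[of n] by (simp add: field_simps)
      next
        case False
        then have "norm x > R + 1" by simp
        moreover have "norm (h n *\<^sub>R b) \<le> 1" using h[of n] b by simp
        ultimately have "norm (x + h n *\<^sub>R b) > R" using norm_diff_ineq[of x "h n *\<^sub>R b"] by linarith
        then have "f (x + h n *\<^sub>R b) = 0" using K(2) R by force
        moreover have "f x = 0" using K(2) R \<open>norm x > R + 1\<close> by force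
        ultimately show ?thesis using L(1) by simp
      qed
    qed
  qed
  then show ?thesis unfolding z by (simp add: LIMSEQ_const_iff)
qed

lemma dirs_1: "dirs 1 = (\<lambda>b. [b]) ` Basis"
  unfolding dirs_def by (auto simp: length_Suc_conv)

lemma weak_gradient_test_function:
  fixes f :: "plane \<Rightarrow> real"
  assumes f: "test_function UNIV f"
  shows "weak_gradient 1 f (\<lambda>vs. iter_deriv vs f)"
  unfolding weak_gradient_def
proof (intro conjI ballI allI impI)
  have s: "smooth f" using f by (simp add: test_function_def)
  show "locally_integrable_on f UNIV" by (rule smooth_locally_integrable[OF s])
  fix vs :: "plane list" assume "vs \<in> dirs 1"
  then obtain b where vs: "vs = [b]" and b: "b \<in> Basis" unfolding dirs_1 by blast
  have sb: "smooth (iter_deriv vs f)" unfolding vs using smooth_partial[OF s b] by simp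
  show lb: "locally_integrable_on (iter_deriv vs f) UNIV" by (rule smooth_locally_integrable[OF sb])
  fix \<phi> :: "plane \<Rightarrow> real" assume \<phi>: "test_function UNIV \<phi>"
  have \<phi>s: "smooth \<phi>" using \<phi> by (simp add: test_function_def)
  have \<phi>b: "test_function UNIV (partial b \<phi>)" using test_function_iter_deriv[OF \<phi>, of "[b]"] b by simp
  have i1: "integrable lebesgue (\<lambda>x. \<phi> x * partial b f x)"
    using locally_integrable_times_test[OF lb \<phi>] by (simp add: vs)
  have i2: "integrable lebesgue (\<lambda>x. partial b \<phi> x * f x)"
    using locally_integrable_times_test[OF smooth_locally_integrable[OF s] \<phi>b] by simp
  have "partial b (\<lambda>x. \<phi> x * f x) = (\<lambda>x. \<phi> x * partial b f x + partial b \<phi> x * f x)"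
    by (simp add: partial_mult smooth_differentiable s \<phi>s)
  with integral_partial_eq_0[OF test_function_mult[OF \<phi> s] b]
  have "(LINT x|lebesgue. \<phi> x * partial b f x) + (LINT x|lebesgue. partial b \<phi> x * f x) = 0"
    using i1 i2 by simp
  then show "(LINT x|lebesgue. iter_deriv vs \<phi> x *\<^sub>R f x) = (-1) ^ 1 *\<^sub>R (LINT x|lebesgue. \<phi> x *\<^sub>R iter_deriv vs f x)"
    by (simp add: vs)
qed

text \<open>In the plane the Dirichlet norm is invariant under dilations, so one multiple
  \<open>\<mu>\<close>, the same for all \<open>R\<close>, makes the bump admissible. The pairing
  then grows like the area, which explains the square of the length in the bound.\<close>

lemma functional_mixing_scale_ge:
  assumes f: "f \<in> borel_measurable lebesgue" "AE x in lebesgue. \<bar>f x\<bar> \<le> 1" and mo: "mostly_one \<beta> y R f"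
    and d: "0 < d" "d < 1" and K: "K > 0" "\<And>t. \<bar>partial 1 smooth_step t\<bar> \<le> K"
  shows "functional_mixing_scale f \<ge> ereal (d / (8 * K) * ((1 - d - 2 * \<beta>) * (pi * R ^ 2)))"
proof -
  have R: "R > 0" using mo by (simp add: mostly_one_def)
  \<comment> \<open>Partial derivatives of the bump are at most \<open>2 * K / (d * R)\<close>. This
    multiple makes them at most \<open>1 / (4 * R)\<close>, the gradient at most
    \<open>1 / (2 * R)\<close>, and its squared L^2 norm at most \<open>pi / 4\<close>.\<close>
  define \<mu> where "\<mu> = d / (8 * K)"
  have \<mu>: "\<mu> > 0" using d K by (simp add: \<mu>_def)
  define \<xi> where "\<xi> x = bump d y R x * \<mu>" for x
  have \<xi>t: "test_function UNIV \<xi>"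
    unfolding \<xi>_def using bump_test_function[OF d(1) R] by (intro test_function_mult) auto
  have \<xi>p: "partial b \<xi> x = \<mu> * partial b (bump d y R) x" for b x
    unfolding \<xi>_def by (subst partial_mult) (simp_all add: smooth_differentiable smooth_bump frechet_derivative_const)
  define G where "G = (\<lambda>vs. iter_deriv vs \<xi>)"
  have tn: "tensor_norm 1 (\<lambda>vs. G vs x) \<le> indicat_real (ball y R) x * (1 / (2 * R))" for x
  proof -
    have "tensor_norm 1 (\<lambda>vs. G vs x) \<le> (\<Sum>vs\<in>dirs 1. norm (G vs x))"
      unfolding tensor_norm_def by (rule L2_set_le_sum) simp
    also have "\<dots> = (\<Sum>b\<in>Basis. \<bar>partial b \<xi> x\<bar>)"
      unfolding dirs_1 G_def by (subst sum.reindex) (auto simp: inj_on_def)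
    also have "\<dots> \<le> (\<Sum>b\<in>(Basis::plane set). indicat_real (ball y R) x * (1 / (4 * R)))"
    proof (rule sum_mono)
      fix b :: plane assume b: "b \<in> Basis"
      show "\<bar>partial b \<xi> x\<bar> \<le> indicat_real (ball y R) x * (1 / (4 * R))"
      proof (cases "x \<in> ball y R")
        case True
        have "\<mu> * \<bar>partial b (bump d y R) x\<bar> \<le> \<mu> * (2 * K / (d * R))"
          using \<mu> by (intro mult_left_mono partial_bump_bound[OF d(1) R b K(2)]) auto
        also have "\<dots> = 1 / (4 * R)" using d K R by (simp add: \<mu>_def field_simps)
        finally show ?thesis using True \<mu> by (simp add: \<xi>p abs_mult)
      qed (simp add: \<xi>p partial_bump_eq_0[OF d(1) R])
    qed
    also have "\<dots> = indicat_real (ball y R) x * (1 / (2 * R))" by simp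
    finally show ?thesis .
  qed
  have "(\<integral>\<^sup>+x. ennreal (\<bar>tensor_norm 1 (\<lambda>vs. G vs x)\<bar> powr 2) \<partial>lebesgue)
      \<le> (\<integral>\<^sup>+x. ennreal ((1 / (2 * R)) ^ 2) * indicator (ball y R) x \<partial>lebesgue)"
  proof (rule nn_integral_mono)
    fix x
    define t where "t = tensor_norm 1 (\<lambda>vs. G vs x)"
    have t: "t \<ge> 0" "t \<le> indicat_real (ball y R) x * (1 / (2 * R))"
      using tn[of x] tensor_norm_nonneg by (auto simp: t_def)
    have "\<bar>t\<bar> powr 2 = t ^ 2" using t by (simp add: powr_numeral)
    also have "\<dots> \<le> (indicat_real (ball y R) x * (1 / (2 * R))) ^ 2" using t by (intro power_mono) auto
    finally have "ennreal (\<bar>t\<bar> powr 2) \<le> ennreal ((indicat_real (ball y R) x * (1 / (2 * R))) ^ 2)" by (rule ennreal_leI)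
    then show "ennreal (\<bar>tensor_norm 1 (\<lambda>vs. G vs x)\<bar> powr 2) \<le> ennreal ((1 / (2 * R)) ^ 2) * indicator (ball y R) x"
      unfolding t_def[symmetric] by (auto simp: indicator_def split: if_splits)
  qed
  also have "\<dots> = ennreal ((1 / (2 * R)) ^ 2) * emeasure lebesgue (ball y R)"
    by (rule nn_integral_cmult_indicator) simp
  also have "emeasure lebesgue (ball y R) = ennreal (pi * R ^ 2)"
    using measure_ball_plane[of R y] R lmeasurable_ball[of y R] by (metis emeasure_eq_measure2 less_imp_le)
  also have "ennreal ((1 / (2 * R)) ^ 2) * ennreal (pi * R ^ 2) = ennreal (pi / 4)"
    using R by (simp add: ennreal_mult[symmetric] power2_eq_square field_simps)
  also have "\<dots> \<le> 1" using pi_less_4 by (simp add: ennreal_le_1)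
  finally have X: "(\<integral>\<^sup>+x. ennreal (\<bar>tensor_norm 1 (\<lambda>vs. G vs x)\<bar> powr 2) \<partial>lebesgue) \<le> 1" .
  have root: "ennreal_root 2 X \<le> 1" if "X \<le> 1" for X
  proof -
    have "X \<noteq> \<infinity>" using that ennreal_one_less_top by (metis infinity_ennreal_def leD)
    moreover have "enn2real X \<le> 1" using that by (simp add: enn2real_leI)
    ultimately show ?thesis
      unfolding ennreal_root_def by (simp add: ennreal_le_1 powr_le1)
  qed
  have "Lp_norm 2 (\<lambda>x. tensor_norm 1 (\<lambda>vs. G vs x)) \<le> 1"
    unfolding Lp_norm_def using root[OF X] by simp
  moreover have "weak_gradient 1 \<xi> G" unfolding G_def by (rule weak_gradient_test_function[OF \<xi>t])
  ultimately have "sobolev_seminorm 1 2 \<xi> \<le> 1"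
    unfolding sobolev_seminorm_def by (auto intro: INF_lower2)
  moreover note B = mostly_one_bump[OF f mo d]
  have \<xi>i: "integrable lebesgue (\<lambda>x. f x * \<xi> x)"
    using integrable_mult_right[OF B(1), of \<mu>] by (simp add: \<xi>_def mult_ac)
  ultimately have "functional_mixing_scale f \<ge> ereal (LINT x|lebesgue. f x * \<xi> x)"
    unfolding functional_mixing_scale_def by (intro Sup_upper) blast
  moreover have "(LINT x|lebesgue. f x * \<xi> x) = \<mu> * (LINT x|lebesgue. f x * bump d y R x)"
    by (simp add: \<xi>_def mult_ac)
  moreover have "\<mu> * (LINT x|lebesgue. f x * bump d y R x) \<ge> \<mu> * ((1 - d - 2 * \<beta>) * (pi * R ^ 2))"
    using B(2) \<mu> by (intro mult_left_mono) auto
  ultimately show ?thesis unfolding \<mu>_def[symmetric] by (metis ereal_less_eq(3) order_trans)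
qed

section \<open>Tilings and the profile of the density at the step times\<close>

subsection \<open>Tiles\<close>

definition corner :: "real \<Rightarrow> nat \<times> nat \<Rightarrow> plane" where
  "corner l q = vector [-1/2 + real (fst q) * l, -1/2 + real (snd q) * l]"

lemma tile_eq_Box: "tile l q = Box (corner l q) l"
  by (cases q) (auto simp: tile_def Box_def corner_def algebra_simps)

lemma unit_square_eq_Box: "unit_square = Box (vector [-1/2, -1/2]) 1"
  by (auto simp: unit_square_def Box_def)

lemma unit_square_lmeasurable: "unit_square \<in> sets lebesgue"
  by (simp add: unit_square_eq_Box Box_lmeasurable)

lemma tile_index_eq:
  assumes "m \<ge> 1" shows "tile_index (1 / real m) = {..<m} \<times> {..<m}"
proof -
  have "real k \<le> real m - 1 \<longleftrightarrow> k < m" for k using assms by linarith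
  then show ?thesis by (auto simp: tile_index_def)
qed

lemma tile_iff_rescaled:
  assumes "l > 0" shows "x \<in> tile l q \<longleftrightarrow> (1 / l) *\<^sub>R (x - tile_center l q) \<in> unit_square"
  using assms by (cases q) (auto simp: tile_def unit_square_def tile_center_def field_simps)

lemma tile_disjoint:
  assumes l: "l > 0" and ne: "q \<noteq> q'"
  shows "Box (corner l q) l \<inter> CBox (corner l q') l = {}"
proof -
  have *: False if "j \<noteq> j'" "-1/2 + real j * l < t" "t < -1/2 + real j * l + l"
    "-1/2 + real j' * l \<le> t" "t \<le> -1/2 + real j' * l + l" for j j' :: nat and t
  proof (cases "j < j'")
    case True
    then have "(real j + 1) * l \<le> real j' * l" using l by (intro mult_right_mono) auto
    then show False using that by (simp add: algebra_simps)
  next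
    case False
    then have "(real j' + 1) * l \<le> real j * l" using l that by (intro mult_right_mono) auto
    then show False using that by (simp add: algebra_simps)
  qed
  have "fst q \<noteq> fst q' \<or> snd q \<noteq> snd q'" using ne by (simp add: prod_eq_iff)
  then show ?thesis
    using *[of "fst q" "fst q'"] *[of "snd q" "snd q'"]
    by (fastforce simp: Box_def CBox_def corner_def)
qed

lemma tile_subset_unit_square:
  assumes "m \<ge> 1" "q \<in> tile_index (1 / real m)"
  shows "tile (1 / real m) q \<subseteq> unit_square"
proof -
  have *: "(real j + 1) * (1 / real m) \<le> 1" if "j < m" for j
    using that assms(1) by (simp add: field_simps)
  obtain j h where q: "q = (j, h)" by (cases q)
  then have "j < m" "h < m" using assms tile_index_eq by auto
  from *[OF this(1)] *[OF this(2)] show ?thesis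
    unfolding q tile_def unit_square_def by (auto simp: less_le_trans intro: le_less_trans[rotated])
qed

text \<open>The open tiles miss only points with a coordinate on one of countably many grid lines, a
  null set.\<close>

lemma AE_in_tile:
  assumes m: "m \<ge> 1"
  shows "AE x in lebesgue. x \<in> unit_square \<longrightarrow> (\<exists>q\<in>tile_index (1 / real m). x \<in> tile (1 / real m) q)"
proof -
  have "AE x in lebesgue. x $ i \<noteq> c" for i :: 2 and c :: real
  proof -
    have "negligible {x::plane. axis i 1 \<bullet> x = c}"
      by (rule negligible_hyperplane) (simp add: axis_eq_0_iff)
    then have "{x::plane. axis i 1 \<bullet> x = c} \<in> null_sets lebesgue" by (simp add: negligible_iff_null_sets)
    then show ?thesis by (rule AE_I') (auto simp: inner_axis')
  qed
  then have "AE x in lebesgue. \<forall>i\<in>UNIV. \<forall>k::nat. (x::plane) $ i \<noteq> -1/2 + real k * (1 / real m)"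
    by (intro AE_finite_allI AE_all_countable[THEN iffD2] allI) auto
  then show ?thesis
  proof eventually_elim
    case (elim x)
    have *: "\<exists>k<m. -1/2 + real k * (1 / real m) < x $ i \<and> x $ i < -1/2 + (real k + 1) * (1 / real m)"
      if i: "-1/2 < x $ i" "x $ i < 1/2" for i
    proof -
      define k where "k = nat \<lfloor>(x $ i + 1/2) * real m\<rfloor>"
      have pos: "(x $ i + 1/2) * real m \<ge> 0" using i by simp
      then have k: "real k \<le> (x $ i + 1/2) * real m" "(x $ i + 1/2) * real m < real k + 1"
        unfolding k_def by linarith+
      have "(x $ i + 1/2) * real m < 1 * real m" using i m by (intro mult_strict_right_mono) auto
      then have "k < m" using k by linarith
      moreover have "-1/2 + real k * (1 / real m) \<le> x $ i" "x $ i < -1/2 + (real k + 1) * (1 / real m)"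
        using k m by (simp_all add: field_simps)
      ultimately show ?thesis using elim by (metis UNIV_I order_le_less)
    qed
    show ?case
    proof
      assume "x \<in> unit_square"
      then obtain k h where "k < m" "h < m" "x \<in> tile (1 / real m) (k, h)"
        using *[of 1] *[of 2] unfolding unit_square_def tile_def by auto
      then show "\<exists>q\<in>tile_index (1 / real m). x \<in> tile (1 / real m) q"
        unfolding tile_index_eq[OF m] by blast
    qed
  qed
qed

subsection \<open>Profiles at the beginning of a step\<close>

text \<open>The bound by one is what allows the mixing scales to be computed with the normalisation
  \<open>\<bar>f\<bar> \<le> 1\<close>; it comes from the vanishing mean together with
  \<open>\<theta> \<le> 1/2\<close>.\<close>

lemma building_block_initial:
  assumes bb: "building_block \<kappa> sbar lam a p \<theta> s u0 \<rho>0" and \<theta>: "0 < \<theta>" "\<theta> \<le> 1/2" and a: "a > 0"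
  shows "\<rho>0 0 \<in> borel_measurable lebesgue" "AE x in lebesgue. \<bar>\<rho>0 0 x\<bar> \<le> 1"
    "(LINT x:unit_square|lebesgue. \<rho>0 0 x) = 0"
    "\<exists>y r. r \<ge> a / 2 \<and> ball y r \<subseteq> unit_square \<and> mostly_one ((1 - \<kappa>) / 2 * sbar) y r (\<rho>0 0)"
proof -
  obtain A c f where A: "A \<in> sets lebesgue" "A \<subseteq> unit_square"
    and LS: "length_scale \<kappa> sbar unit_square A \<ge> ereal a" and A\<theta>: "measure lebesgue A = \<theta>"
    and f: "f = (\<lambda>x. if x \<in> A then 1 else if x \<in> unit_square then c else 0)"
    and init: "initial_datum f" and sol: "continuity_solution {0..1} u0 f \<rho>0"
    using bb unfolding building_block_def by blast
  show m: "\<rho>0 0 \<in> borel_measurable lebesgue" using sol unfolding continuity_solution_def by auto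
  have \<rho>f: "AE x in lebesgue. \<rho>0 0 x = f x" using sol unfolding continuity_solution_def by blast
  have fm: "f \<in> borel_measurable lebesgue" and fmean: "(LINT x:unit_square|lebesgue. f x) = 0"
    using init unfolding initial_datum_def by blast+
  have usq: "unit_square \<in> lmeasurable" unfolding unit_square_eq_Box Box_eq_box by simp
  have us1: "measure lebesgue unit_square = 1" unfolding unit_square_eq_Box by (simp add: measure_Box del: measure_completion)
  have Al: "A \<in> lmeasurable" by (rule fmeasurableI2[OF usq A(2,1)])
  have ii: "integrable lebesgue (indicat_real A)" "integrable lebesgue (indicat_real unit_square)"
    using Al usq by (simp_all add: lmeasurable_iff_integrable)
  have "(LINT x:unit_square|lebesgue. f x) = (LINT x|lebesgue. (1 - c) * indicat_real A x + c * indicat_real unit_square x)"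
    unfolding set_lebesgue_integral_def using A(2)
    by (intro Bochner_Integration.integral_cong) (auto simp: f indicator_def)
  also have "\<dots> = (1 - c) * \<theta> + c * 1"
  proof -
    have "(LINT x|lebesgue. indicat_real A x) = \<theta>" "(LINT x|lebesgue. indicat_real unit_square x) = 1"
      using A\<theta> us1 A(1) unit_square_lmeasurable by (simp_all del: measure_completion)
    then show ?thesis using ii by simp
  qed
  \<comment> \<open>Vanishing mean forces \<open>c = - \<theta> / (1 - \<theta>)\<close>, of modulus
    at most one because \<open>A\<close> fills at most half of the square.\<close>
  finally have c: "(1 - c) * \<theta> + c = 0" using fmean by simp
  then have "c * (1 - \<theta>) = - \<theta>" by (simp add: algebra_simps)
  then have "c = - (\<theta> / (1 - \<theta>))" using \<theta> by (simp add: field_simps)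
  moreover have "\<theta> / (1 - \<theta>) \<le> 1" "\<theta> / (1 - \<theta>) \<ge> 0" using \<theta> by (auto simp: divide_le_eq)
  ultimately have c1: "\<bar>c\<bar> \<le> 1" by linarith
  show "AE x in lebesgue. \<bar>\<rho>0 0 x\<bar> \<le> 1"
    using \<rho>f by eventually_elim (use c1 in \<open>auto simp: f\<close>)
  have "(LINT x:unit_square|lebesgue. \<rho>0 0 x) = (LINT x:unit_square|lebesgue. f x)"
    unfolding set_lebesgue_integral_def
  proof (rule integral_cong_AE)
    show "AE x in lebesgue. indicat_real unit_square x *\<^sub>R \<rho>0 0 x = indicat_real unit_square x *\<^sub>R f x"
      using \<rho>f by eventually_elim simp
  qed (intro borel_measurable_scaleR borel_measurable_indicator unit_square_lmeasurable m fm)+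
  then show "(LINT x:unit_square|lebesgue. \<rho>0 0 x) = 0" using fmean by simp
  \<comment> \<open>The length scale is a supremum that need not be attained, so half of the radius
    is given away.\<close>
  have "ereal (a / 2) < length_scale \<kappa> sbar unit_square A"
    using LS a by (metis ereal_less(2) ereal_less_eq(3) less_ereal.simps(1) field_sum_of_halves less_add_same_cancel1 half_gt_zero order_less_le_trans)
  then obtain r y where r: "a / 2 < r" and B: "ball y r \<subseteq> unit_square"
    and frac: "measure lebesgue (A \<inter> ball y r) / measure lebesgue (ball y r) > 1 - (1 - \<kappa>) / 2 * sbar"
    unfolding length_scale_def less_Sup_iff by auto
  have r0: "r > 0" using r a by simp
  have bm: "measure lebesgue (ball y r) = pi * r ^ 2" using measure_ball_plane[of r y] r0 by simp
  define D where "D = ball y r - A"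
  have "measure lebesgue D = measure lebesgue (ball y r) - measure lebesgue (A \<inter> ball y r)"
  proof -
    have "D = ball y r - (A \<inter> ball y r)" by (auto simp: D_def)
    moreover have "ball y r \<in> fmeasurable lebesgue" by simp
    moreover have "A \<inter> ball y r \<in> sets lebesgue" using A(1) by auto
    ultimately show ?thesis using measurable_measure_Diff by (metis Int_lower2)
  qed
  moreover have "measure lebesgue (A \<inter> ball y r) > (1 - (1 - \<kappa>) / 2 * sbar) * (pi * r ^ 2)"
    using frac r0 unfolding bm by (simp add: less_divide_eq)
  ultimately have Dm: "measure lebesgue D \<le> (1 - \<kappa>) / 2 * sbar * (pi * r ^ 2)"
    unfolding bm left_diff_distrib mult_1 by linarith
  have "mostly_one ((1 - \<kappa>) / 2 * sbar) y r (\<rho>0 0)"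
    unfolding mostly_one_def
  proof (intro conjI bexI[of _ D])
    show "AE x in lebesgue. x \<in> ball y r - D \<longrightarrow> \<rho>0 0 x = 1"
      using \<rho>f by eventually_elim (auto simp: D_def f)
    show "D \<in> sets lebesgue" using A(1) by (auto simp: D_def)
  qed (use r0 Dm in \<open>auto simp: D_def\<close>)
  with r B show "\<exists>y r. r \<ge> a / 2 \<and> ball y r \<subseteq> unit_square \<and> mostly_one ((1 - \<kappa>) / 2 * sbar) y r (\<rho>0 0)"
    by (intro exI[of _ y] exI[of _ r]) auto
qed

lemma mostly_one_dilation:
  assumes mo: "mostly_one \<beta> y r g" and L: "L > 0"
    and f: "\<And>x. d + L *\<^sub>R x \<in> ball y r \<Longrightarrow> f x = g (d + L *\<^sub>R x)"
  shows "mostly_one \<beta> ((1 / L) *\<^sub>R (y - d)) (r / L) f"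
proof -
  obtain D where D: "D \<in> sets lebesgue" "D \<subseteq> ball y r" "measure lebesgue D \<le> \<beta> * (pi * r ^ 2)"
    "AE x in lebesgue. x \<in> ball y r - D \<longrightarrow> g x = 1" and r: "r > 0"
    using mo unfolding mostly_one_def by blast
  have L0: "L \<noteq> 0" using L by simp
  define D' where "D' = {x. d + L *\<^sub>R x \<in> D}"
  have ball: "x \<in> ball ((1 / L) *\<^sub>R (y - d)) (r / L) \<longleftrightarrow> d + L *\<^sub>R x \<in> ball y r" for x
  proof -
    have "y - (d + L *\<^sub>R x) = L *\<^sub>R ((1 / L) *\<^sub>R (y - d) - x)" using L by (simp add: algebra_simps)
    then have "dist y (d + L *\<^sub>R x) = L * dist ((1 / L) *\<^sub>R (y - d)) x" using L by (simp add: dist_norm)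
    then show ?thesis using L by (simp add: field_simps)
  qed
  have D'm: "D' \<in> sets lebesgue"
    using measurable_sets[OF lebesgue_dilation_measurable[OF L0, of d] D(1)] by (simp add: D'_def vimage_def)
  have "measure lebesgue D = L ^ 2 * measure lebesgue D'"
  proof -
    have "indicat_real D (d + L *\<^sub>R x) = indicat_real D' x" for x by (simp add: D'_def indicator_def)
    then show ?thesis
      using integral_dilation[OF L0, of "indicat_real D" d] D(1) D'm L by (simp del: measure_completion)
  qed
  then have "measure lebesgue D' \<le> \<beta> * (pi * (r / L) ^ 2)"
    using D(3) L by (simp add: field_simps power_divide)
  moreover have "AE x in lebesgue. x \<in> ball ((1 / L) *\<^sub>R (y - d)) (r / L) - D' \<longrightarrow> f x = 1"
    using AE_dilation[OF L0 D(4), of d] by eventually_elim (auto simp: ball D'_def f simp del: mem_ball)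
  moreover have "D' \<subseteq> ball ((1 / L) *\<^sub>R (y - d)) (r / L)" using D(2) ball by (auto simp: D'_def simp del: mem_ball)
  ultimately show ?thesis unfolding mostly_one_def using D'm r L by auto
qed

lemma step_time_Suc: "step_time \<tau> (Suc n) = step_time \<tau> n + \<tau> ^ n"
  by (simp add: step_time_def)

lemma step_time_mono: "\<tau> > 0 \<Longrightarrow> step_time \<tau> n < step_time \<tau> (Suc n)"
  by (simp add: step_time_Suc)

lemma step_time_nonneg: "\<tau> > 0 \<Longrightarrow> step_time \<tau> n \<ge> 0"
  by (simp add: step_time_def sum_nonneg)

lemma step_time_in_cellular_times: "\<tau> > 0 \<Longrightarrow> step_time \<tau> n \<in> cellular_times \<tau>"
  using step_time_mono[of \<tau> n] step_time_nonneg[of \<tau> n] unfolding cellular_times_def by blast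

text \<open>Every step is followed by another one, so its end point is never the end of the time
  interval, even if the interval is bounded. The test functions of the weak equation can thus cover
  a whole step.\<close>

lemma step_in_cellular_times:
  assumes "\<tau> > 0" shows "{step_time \<tau> n..step_time \<tau> (Suc n)} \<subseteq> cellular_times \<tau>"
    "\<And>t. t \<in> {step_time \<tau> n..step_time \<tau> (Suc n)} \<Longrightarrow> \<exists>t'\<in>cellular_times \<tau>. t < t'"
proof -
  have lt: "step_time \<tau> (Suc n) < step_time \<tau> (Suc (Suc n))" by (rule step_time_mono[OF assms])
  then show "{step_time \<tau> n..step_time \<tau> (Suc n)} \<subseteq> cellular_times \<tau>"
    using step_time_nonneg[OF assms, of n] unfolding cellular_times_def by (auto intro!: exI[of _ "Suc (Suc n)"])
  show "\<exists>t'\<in>cellular_times \<tau>. t < t'" if "t \<in> {step_time \<tau> n..step_time \<tau> (Suc n)}" for t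
    using that lt step_time_in_cellular_times[OF assms, of "Suc (Suc n)"] by force
qed

text \<open>The hypotheses on one pair, with the integer \<open>N\<close> in place of
  \<open>1 / lam\<close>, so that the tiles of side \<open>lam ^ n\<close> are indexed by pairs of
  numbers below \<open>N ^ n\<close>.\<close>

locale cellular_pair =
  fixes \<kappa> sbar lam a s \<tau> \<theta> :: real and p :: ennreal and N :: nat
    and u :: "real \<Rightarrow> plane \<Rightarrow> plane" and f :: "plane \<Rightarrow> real" and \<rho> :: "real \<Rightarrow> plane \<Rightarrow> real"
  assumes \<kappa>: "0 < \<kappa>" "\<kappa> < 1" and sbar: "0 < sbar" "sbar < 1"
    and N: "N \<ge> 2" and lam: "lam = 1 / real N" and a: "a > 0" and s: "s > 1"
    and \<tau>: "\<tau> > 0" and \<theta>: "0 < \<theta>" "\<theta> \<le> 1/2" and p: "1 < p"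
    and vel: "velocity_field (cellular_times \<tau>) u"
    and reg: "Linfty_sobolev (cellular_times \<tau>) s p u"
    and sol: "continuity_solution (cellular_times \<tau>) u f \<rho>"
    and cell: "cellular_type \<kappa> sbar \<tau> lam a p \<theta> s u \<rho>"
begin

abbreviation "\<beta> \<equiv> (1 - \<kappa>) / 2 * sbar"
abbreviation "T \<equiv> step_time \<tau>"
abbreviation "Q n \<equiv> tile_index (lam ^ n)"

lemma lam_pos: "lam > 0" "lam < 1" using N by (auto simp: lam)

lemma lam_pow: "lam ^ n = 1 / real (N ^ n)" by (simp add: lam power_divide)

lemma N_pow: "N ^ n \<ge> 1" using N by simp

lemma Q_eq: "Q n = {..<N ^ n} \<times> {..<N ^ n}" unfolding lam_pow by (rule tile_index_eq[OF N_pow])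

lemma finite_Q: "finite (Q n)" by (simp add: Q_eq)

lemma card_Q: "real (card (Q n)) * (lam ^ n) ^ 2 = 1"
  unfolding Q_eq using N by (simp add: lam_pow power2_eq_square)

lemma tile_in_square: "q \<in> Q n \<Longrightarrow> tile (lam ^ n) q \<subseteq> unit_square"
  unfolding lam_pow by (rule tile_subset_unit_square[OF N_pow])

lemma AE_tile: "AE x in lebesgue. x \<in> unit_square \<longrightarrow> (\<exists>q\<in>Q n. x \<in> tile (lam ^ n) q)"
  unfolding lam_pow by (rule AE_in_tile[OF N_pow])

lemma tiles_disjoint: "q \<noteq> q' \<Longrightarrow> Box (corner (lam ^ n) q) (lam ^ n) \<inter> CBox (corner (lam ^ n) q') (lam ^ n) = {}"
  using lam_pos by (intro tile_disjoint) auto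

lemma \<rho>_measurable: "\<rho> (T n) \<in> borel_measurable lebesgue"
  using sol step_time_in_cellular_times[OF \<tau>] unfolding continuity_solution_def by blast

lemma \<rho>_outside: "x \<notin> unit_square \<Longrightarrow> \<rho> (T n) x = 0"
  using sol step_time_in_cellular_times[OF \<tau>] unfolding continuity_solution_def by blast

text \<open>The translation part of the map from a tile to the unit square, in the form
  \<open>d + l *\<^sub>R x\<close> to which the dilation lemmas apply.\<close>

definition "dl n q = - ((1 / lam ^ n) *\<^sub>R tile_center (lam ^ n) q)"

lemma rescale: "(1 / lam ^ n) *\<^sub>R (x - tile_center (lam ^ n) q) = dl n q + (1 / lam ^ n) *\<^sub>R x"
  by (simp add: dl_def algebra_simps)

lemma tile_iff: "x \<in> tile (lam ^ n) q \<longleftrightarrow> dl n q + (1 / lam ^ n) *\<^sub>R x \<in> unit_square"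
  using tile_iff_rescaled[of "lam ^ n" x q] lam_pos by (simp add: rescale)

lemma block:
  assumes "q \<in> Q n"
  obtains u0 \<rho>0 where "building_block \<kappa> sbar lam a p \<theta> s u0 \<rho>0"
    "\<And>t x. T n \<le> t \<Longrightarrow> t < T (Suc n) \<Longrightarrow> x \<in> tile (lam ^ n) q \<Longrightarrow>
      u t x = (lam ^ n / \<tau> ^ n) *\<^sub>R u0 ((t - T n) / \<tau> ^ n) (dl n q + (1 / lam ^ n) *\<^sub>R x)"
    "\<And>x. x \<in> tile (lam ^ n) q \<Longrightarrow> \<rho> (T n) x = \<rho>0 0 (dl n q + (1 / lam ^ n) *\<^sub>R x)"
proof -
  obtain u0 \<rho>0 where bb: "building_block \<kappa> sbar lam a p \<theta> s u0 \<rho>0"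
    and eq: "\<And>t x. T n \<le> t \<Longrightarrow> t < T (Suc n) \<Longrightarrow> x \<in> tile (lam ^ n) q \<Longrightarrow>
      u t x = (lam ^ n / \<tau> ^ n) *\<^sub>R u0 ((t - T n) / \<tau> ^ n) (dl n q + (1 / lam ^ n) *\<^sub>R x) \<and>
      \<rho> t x = \<rho>0 ((t - T n) / \<tau> ^ n) (dl n q + (1 / lam ^ n) *\<^sub>R x)"
    using cell assms unfolding cellular_type_def rescale by metis
  show thesis
  proof (rule that[OF bb])
    show "\<rho> (T n) x = \<rho>0 0 (dl n q + (1 / lam ^ n) *\<^sub>R x)" if "x \<in> tile (lam ^ n) q" for x
      using eq[of "T n" x] that step_time_mono[OF \<tau>, of n] by simp
  qed (use eq in blast)
qed

text \<open>Time \<open>T n\<close> is the initial time of the blocks of step \<open>n\<close>, so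
  on each tile of side \<open>lam ^ n\<close> the density is a rescaled initial profile: it inherits
  the good ball, the vanishing mean and the bound by one.\<close>

lemma tile_profile:
  assumes q: "q \<in> Q n"
  shows "\<exists>y R. R \<ge> a / 2 * lam ^ n \<and> ball y R \<subseteq> tile (lam ^ n) q \<and> mostly_one \<beta> y R (\<rho> (T n))"
    "(LINT x:tile (lam ^ n) q|lebesgue. \<rho> (T n) x) = 0"
    "AE x in lebesgue. x \<in> tile (lam ^ n) q \<longrightarrow> \<bar>\<rho> (T n) x\<bar> \<le> 1"
proof -
  define L where "L = 1 / lam ^ n"
  have L: "L > 0" "L \<noteq> 0" using lam_pos by (auto simp: L_def)
  obtain u0 \<rho>0 where bb: "building_block \<kappa> sbar lam a p \<theta> s u0 \<rho>0"
    and \<rho>: "\<And>x. x \<in> tile (lam ^ n) q \<Longrightarrow> \<rho> (T n) x = \<rho>0 0 (dl n q + L *\<^sub>R x)"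
    using block[OF q] unfolding L_def by metis
  note init = building_block_initial[OF bb \<theta> a]
  obtain y r where r: "r \<ge> a / 2" and B: "ball y r \<subseteq> unit_square" and mo: "mostly_one \<beta> y r (\<rho>0 0)"
    using init(4) by blast
  have ti: "x \<in> tile (lam ^ n) q \<longleftrightarrow> dl n q + L *\<^sub>R x \<in> unit_square" for x
    unfolding L_def by (rule tile_iff)
  have "mostly_one \<beta> ((1 / L) *\<^sub>R (y - dl n q)) (r / L) (\<rho> (T n))"
    using B by (intro mostly_one_dilation[OF mo L(1)] \<rho>) (auto simp: ti simp del: mem_ball)
  moreover have "r / L \<ge> a / 2 * lam ^ n" using r lam_pos by (simp add: L_def mult_right_mono)
  moreover have "ball ((1 / L) *\<^sub>R (y - dl n q)) (r / L) \<subseteq> tile (lam ^ n) q"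
  proof
    fix x assume "x \<in> ball ((1 / L) *\<^sub>R (y - dl n q)) (r / L)"
    moreover have "y - (dl n q + L *\<^sub>R x) = L *\<^sub>R ((1 / L) *\<^sub>R (y - dl n q) - x)" using L by (simp add: algebra_simps)
    then have "dist y (dl n q + L *\<^sub>R x) = L * dist ((1 / L) *\<^sub>R (y - dl n q)) x" using L by (simp add: dist_norm)
    ultimately have "dl n q + L *\<^sub>R x \<in> ball y r" using L by (simp add: field_simps)
    with B show "x \<in> tile (lam ^ n) q" using ti by blast
  qed
  ultimately show "\<exists>y R. R \<ge> a / 2 * lam ^ n \<and> ball y R \<subseteq> tile (lam ^ n) q \<and> mostly_one \<beta> y R (\<rho> (T n))" by blast
  have "(LINT x:tile (lam ^ n) q|lebesgue. \<rho> (T n) x) =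
      (LINT x|lebesgue. indicat_real unit_square (dl n q + L *\<^sub>R x) *\<^sub>R \<rho>0 0 (dl n q + L *\<^sub>R x))"
    unfolding set_lebesgue_integral_def
    by (intro Bochner_Integration.integral_cong refl) (auto simp: indicator_def \<rho> ti)
  also have "\<dots> = 0"
    using integral_dilation[OF L(2), of "\<lambda>x. indicat_real unit_square x *\<^sub>R \<rho>0 0 x" "dl n q"] init(3) L
    by (simp add: set_lebesgue_integral_def)
  finally show "(LINT x:tile (lam ^ n) q|lebesgue. \<rho> (T n) x) = 0" .
  show "AE x in lebesgue. x \<in> tile (lam ^ n) q \<longrightarrow> \<bar>\<rho> (T n) x\<bar> \<le> 1"
    using AE_dilation[OF L(2) init(2), of "dl n q"] by eventually_elim (simp add: \<rho>)
qed

lemma \<rho>_le_1: "AE x in lebesgue. \<bar>\<rho> (T n) x\<bar> \<le> 1"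
proof -
  have "AE x in lebesgue. \<forall>q\<in>Q n. x \<in> tile (lam ^ n) q \<longrightarrow> \<bar>\<rho> (T n) x\<bar> \<le> 1"
    by (intro AE_finite_allI finite_Q tile_profile(3))
  with AE_tile[of n] show ?thesis
  proof eventually_elim
    case (elim x)
    then show ?case using \<rho>_outside[of x n] by (cases "x \<in> unit_square") auto
  qed
qed

text \<open>This identity explains the threshold in the characteristic length scale: an exceptional
  proportion \<open>\<beta>\<close> costs \<open>2 * \<beta>\<close> in an average, which leaves the
  positive margin \<open>(1 - \<kappa>) * (1 - sbar)\<close> above \<open>\<kappa>\<close>.\<close>

lemma \<gamma>: "1 - 2 * \<beta> - \<kappa> = (1 - \<kappa>) * (1 - sbar)" "1 - 2 * \<beta> > 0" "\<beta> \<ge> 0"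
proof -
  show "1 - 2 * \<beta> - \<kappa> = (1 - \<kappa>) * (1 - sbar)" by (simp add: field_simps)
  moreover have "(1 - \<kappa>) * (1 - sbar) > 0" using \<kappa> sbar by (intro mult_pos_pos) auto
  ultimately show "1 - 2 * \<beta> > 0" using \<kappa> by linarith
  show "\<beta> \<ge> 0" using \<kappa> sbar by simp
qed

text \<open>One tile suffices. The \<open>8\<close> is the \<open>2\<close> lost in the radius of
  the good ball times the \<open>4\<close> of \<open>geometric_mixing_scale_ge\<close>.\<close>

lemma geometric_lower_bound:
  "geometric_mixing_scale \<kappa> (\<rho> (T n)) \<ge> ereal ((1 - \<kappa>) * (1 - sbar) * a / 8 * lam ^ n)"
proof -
  have "(0, 0) \<in> Q n" using N by (simp add: Q_eq)
  from tile_profile(1)[OF this] obtain y R where R: "R \<ge> a / 2 * lam ^ n" and mo: "mostly_one \<beta> y R (\<rho> (T n))" by blast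
  have "(1 - \<kappa>) * (1 - sbar) * (a / 2 * lam ^ n) \<le> (1 - \<kappa>) * (1 - sbar) * R"
    using R \<kappa> sbar by (intro mult_left_mono) auto
  then have "ereal ((1 - \<kappa>) * (1 - sbar) * a / 8 * lam ^ n) \<le> ereal ((1 - 2 * \<beta> - \<kappa>) * R / 4)"
    unfolding \<gamma>(1) by (simp add: mult_ac)
  also have "\<dots> \<le> geometric_mixing_scale \<kappa> (\<rho> (T n))"
    using \<kappa> by (intro geometric_mixing_scale_ge[OF \<rho>_measurable \<rho>_le_1 mo _ \<gamma>(3)]) auto
  finally show ?thesis .
qed

end

section \<open>Exclusion of rapidly shrinking steps and the final bounds\<close>

subsection \<open>The cost of a step\<close>

text \<open>Without a weak gradient the seminorm is an infimum over the empty set, that is,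
  infinite.\<close>

lemma sobolev_seminorm_finite_imp:
  assumes "sobolev_seminorm s p f \<le> ennreal M"
  shows "\<exists>G. weak_gradient (nat \<lfloor>s\<rfloor>) f G"
proof (rule ccontr)
  assume "\<not> ?thesis"
  then have "{G. weak_gradient (nat \<lfloor>s\<rfloor>) f G} = {}" by blast
  then have "sobolev_seminorm s p f = top" by (simp add: sobolev_seminorm_def Let_def)
  with assms show False by (simp add: top_unique)
qed

lemma test_function_sum:
  assumes "finite I" "\<And>i. i \<in> I \<Longrightarrow> test_function UNIV (f i)"
  shows "test_function UNIV (\<lambda>x. \<Sum>i\<in>I. f i x)"
proof -
  obtain K where K: "\<And>i. i \<in> I \<Longrightarrow> compact (K i) \<and> (\<forall>x. x \<notin> K i \<longrightarrow> f i x = 0)"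
    using assms(2) unfolding test_function_def by metis
  have "smooth (\<lambda>x. \<Sum>i\<in>I. f i x)"
    using assms(2) by (intro smooth_sum) (auto simp: test_function_def)
  moreover have "compact (\<Union>i\<in>I. K i)" using assms(1) K by (intro compact_UN) auto
  moreover have "(\<Sum>i\<in>I. f i x) = 0" if "x \<notin> (\<Union>i\<in>I. K i)" for x
    using that K by (intro sum.neutral) auto
  ultimately show ?thesis unfolding test_function_def by blast
qed

lemma partial_sum:
  assumes "finite I" "\<And>i. i \<in> I \<Longrightarrow> smooth (f i)"
  shows "partial b (\<lambda>x. \<Sum>i\<in>I. f i x) x = (\<Sum>i\<in>I. partial b (f i) x)"
  by (rule partial_eqI) (intro has_derivative_sum smooth_has_derivative assms(2))

lemma partial_bound_Lipschitz:
  fixes f :: "plane \<Rightarrow> real"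
  assumes f: "smooth f" and L: "\<And>b x. b \<in> Basis \<Longrightarrow> \<bar>partial b f x\<bar> \<le> L"
  shows "\<bar>f x - f z\<bar> \<le> 2 * L * norm (x - z)"
proof -
  have "\<bar>partial (x - z) f w\<bar> \<le> 2 * L * norm (x - z)" for w
  proof -
    have "\<bar>partial (x - z) f w\<bar> \<le> (\<Sum>b\<in>Basis. \<bar>((x - z) \<bullet> b) * partial b f w\<bar>)"
      by (subst frechet_derivative_sum_partial[OF smooth_differentiable[OF f]]) (rule sum_abs)
    also have "\<dots> \<le> (\<Sum>b\<in>(Basis::plane set). norm (x - z) * L)"
      unfolding abs_mult using L Basis_le_norm by (intro sum_mono mult_mono) auto
    finally show ?thesis by (simp add: mult_ac)
  qed
  from partial_bound_difference[OF f this, of z 1] show ?thesis by simp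
qed

context cellular_pair
begin

lemma emeasure_tiles: "emeasure lebesgue (\<Union>q\<in>Q n. Box (corner (lam ^ n) q) (lam ^ n)) \<le> 1"
proof -
  have "(\<Union>q\<in>Q n. Box (corner (lam ^ n) q) (lam ^ n)) \<subseteq> unit_square"
    using tile_in_square unfolding tile_eq_Box by blast
  then have "emeasure lebesgue (\<Union>q\<in>Q n. Box (corner (lam ^ n) q) (lam ^ n)) \<le> emeasure lebesgue unit_square"
    by (intro emeasure_mono unit_square_lmeasurable)
  also have "\<dots> = 1" unfolding unit_square_eq_Box by (simp only: emeasure_Box zero_le_one power_one ennreal_1)
  finally show ?thesis .
qed

text \<open>During step \<open>n\<close> the field \<open>u\<close> is a sum of rescaled block
  fields, each extended by zero from its tile. The blocks contribute only the existence of weak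
  gradients of these pieces at almost every time; their own seminorm bounds may depend on the tile
  and on \<open>n\<close>. The quantitative input is the bound \<open>M\<close> on \<open>u\<close>,
  which is uniform in \<open>n\<close>.\<close>

lemma step_energy:
  assumes M: "AE t in lebesgue. t \<in> cellular_times \<tau> \<longrightarrow> sobolev_seminorm s p (u t) \<le> ennreal M" "M \<ge> 0"
  shows "AE t in lebesgue. t \<in> {T n..T (Suc n)} \<longrightarrow>
    (\<forall>h. h \<in> borel_measurable lebesgue \<longrightarrow> (\<forall>x. \<bar>h x\<bar> \<le> (1::real)) \<longrightarrow>
      norm (LINT x|lebesgue. h x *\<^sub>R u t x) \<le> 2 * energy_const s p M * (lam ^ n) powr s)
    \<and> locally_integrable_on (u t) UNIV"
proof -
  define l where "l = lam ^ n"
  have l: "l > 0" using lam_pos by (simp add: l_def)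
  have "\<exists>u0 \<rho>0. building_block \<kappa> sbar lam a p \<theta> s u0 \<rho>0 \<and> (\<forall>t x. T n \<le> t \<longrightarrow> t < T (Suc n) \<longrightarrow> x \<in> tile l q \<longrightarrow>
      u t x = (l / \<tau> ^ n) *\<^sub>R u0 ((t - T n) / \<tau> ^ n) (dl n q + (1 / l) *\<^sub>R x))" if "q \<in> Q n" for q
    using block[OF that] unfolding l_def by metis
  then obtain U where bb: "\<And>q. q \<in> Q n \<Longrightarrow> \<exists>\<rho>0. building_block \<kappa> sbar lam a p \<theta> s (U q) \<rho>0"
    and U: "\<And>q t x. q \<in> Q n \<Longrightarrow> T n \<le> t \<Longrightarrow> t < T (Suc n) \<Longrightarrow> x \<in> tile l q \<Longrightarrow>
      u t x = (l / \<tau> ^ n) *\<^sub>R U q ((t - T n) / \<tau> ^ n) (dl n q + (1 / l) *\<^sub>R x)"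
    by metis
  have \<tau>n: "\<tau> ^ n > 0" using \<tau> by simp
  have time: "- (T n / \<tau> ^ n) + (1 / \<tau> ^ n) *\<^sub>R t = (t - T n) / \<tau> ^ n" for t
    by (simp add: diff_divide_distrib)
  have "AE t in lebesgue. (t - T n) / \<tau> ^ n \<in> {0..1} \<longrightarrow> (\<exists>G. weak_gradient (nat \<lfloor>s\<rfloor>) (U q ((t - T n) / \<tau> ^ n)) G)"
    if q: "q \<in> Q n" for q
  proof -
    have "Linfty_sobolev {0..1} s p (U q)" using bb[OF q] unfolding building_block_def by blast
    then obtain M' where "AE t in lebesgue. t \<in> {0..1} \<longrightarrow> sobolev_seminorm s p (U q t) \<le> ennreal M'"
      unfolding Linfty_sobolev_def by blast
    then have "AE t in lebesgue. t \<in> {0..1} \<longrightarrow> (\<exists>G. weak_gradient (nat \<lfloor>s\<rfloor>) (U q t) G)"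
      by eventually_elim (use sobolev_seminorm_finite_imp in blast)
    moreover have "1 / \<tau> ^ n \<noteq> 0" using \<tau> by simp
    ultimately show ?thesis using AE_dilation[of "1 / \<tau> ^ n" _ "- (T n / \<tau> ^ n)"] unfolding time by blast
  qed
  then have "AE t in lebesgue. \<forall>q\<in>Q n. (t - T n) / \<tau> ^ n \<in> {0..1} \<longrightarrow> (\<exists>G. weak_gradient (nat \<lfloor>s\<rfloor>) (U q ((t - T n) / \<tau> ^ n)) G)"
    by (intro AE_finite_allI finite_Q)
  \<comment> \<open>The formula for \<open>u\<close> holds on the half-open interval of the step,
    whereas the estimate is wanted on the closed one.\<close>
  moreover have "AE t in lebesgue. t \<noteq> T (Suc n)"
    by (rule AE_I'[of "{T (Suc n)}"]) auto
  ultimately show ?thesis using M(1)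
  proof eventually_elim
    case (elim t)
    show ?case
    proof
      assume t: "t \<in> {T n..T (Suc n)}"
      then have tn: "T n \<le> t" "t < T (Suc n)" using elim(2) by auto
      have tI: "t \<in> cellular_times \<tau>" using step_in_cellular_times(1)[OF \<tau>, of n] t by blast
      define t' where "t' = (t - T n) / \<tau> ^ n"
      have t': "t' \<in> {0..1}" using tn \<tau>n by (simp add: t'_def step_time_Suc divide_le_eq)
      have Mt: "sobolev_seminorm s p (u t) \<le> ennreal M" using elim(3) tI by blast
      \<comment> \<open>The rescaled block field on the whole plane. It vanishes off its tile
        because the block field vanishes off the unit square, so no restriction of \<open>u\<close>
        to a tile has to be differentiated.\<close>
      define v where "v q x = (l / \<tau> ^ n) *\<^sub>R U q t' (dl n q + (1 / l) *\<^sub>R x)" for q x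
      have v0: "v q x = 0" if q: "q \<in> Q n" and x: "x \<notin> Box (corner l q) l" for q x
      proof -
        have "dl n q + (1 / l) *\<^sub>R x \<notin> unit_square"
          using x tile_iff[of x n q] unfolding tile_eq_Box l_def by blast
        moreover have "velocity_field {0..1} (U q)" using bb[OF q] unfolding building_block_def by blast
        ultimately show ?thesis using t' unfolding velocity_field_def v_def by simp
      qed
      have wg: "\<exists>G. weak_gradient (nat \<lfloor>s\<rfloor>) (v q) G" if q: "q \<in> Q n" for q
      proof -
        obtain G where "weak_gradient (nat \<lfloor>s\<rfloor>) (U q t') G" using elim(1) q t' unfolding t'_def by blast
        from weak_gradient_dilation[OF this, of "1 / l" "l / \<tau> ^ n" "dl n q"] l show ?thesis
          unfolding v_def by auto
      qed
      have uv: "AE x in lebesgue. u t x = (\<Sum>q\<in>Q n. v q x)"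
        using AE_tile[of n]
      proof eventually_elim
        case (elim x)
        show ?case
        proof (cases "x \<in> unit_square")
          case False
          then have "v q x = 0" if "q \<in> Q n" for q
            using v0[OF that] tile_in_square[OF that] unfolding tile_eq_Box l_def by blast
          moreover have "u t x = 0" using vel tI False unfolding velocity_field_def by blast
          ultimately show ?thesis by simp
        next
          case True
          then obtain q where q: "q \<in> Q n" "x \<in> tile l q" using elim unfolding l_def by blast
          have "v q' x = 0" if "q' \<in> Q n" "q' \<noteq> q" for q'
          proof (rule v0[OF that(1)])
            show "x \<notin> Box (corner l q') l"
              using tiles_disjoint[OF that(2), of n] q(2) Box_subset_CBox unfolding tile_eq_Box l_def by blast
          qed
          then have "(\<Sum>q'\<in>Q n. v q' x) = (\<Sum>q'\<in>Q n. if q' = q then v q x else 0)" by (intro sum.cong) auto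
          also have "\<dots> = v q x" using q(1) finite_Q by simp
          also have "v q x = u t x" using U[OF q(1) tn q(2)] by (simp add: v_def t'_def)
          finally show ?thesis by simp
        qed
      qed
      have "locally_integrable_on (u t) UNIV"
        using sobolev_seminorm_finite_imp[OF Mt] weak_gradientD(1) by blast
      moreover have "norm (LINT x|lebesgue. h x *\<^sub>R u t x) \<le> 2 * energy_const s p M * (lam ^ n) powr s"
        if "h \<in> borel_measurable lebesgue" "\<And>x. \<bar>h x\<bar> \<le> (1::real)" for h
        unfolding l_def[symmetric]
        by (rule tiled_duality[OF Mt M(2) p s l finite_Q _ _ wg v0 uv that])
          (use emeasure_tiles tiles_disjoint in \<open>auto simp: l_def\<close>)
      ultimately show "(\<forall>h. h \<in> borel_measurable lebesgue \<longrightarrow> (\<forall>x. \<bar>h x\<bar> \<le> (1::real)) \<longrightarrow>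
          norm (LINT x|lebesgue. h x *\<^sub>R u t x) \<le> 2 * energy_const s p M * (lam ^ n) powr s)
        \<and> locally_integrable_on (u t) UNIV" by blast
    qed
  qed
qed

text \<open>On each tile the density has mean zero, so the value of \<open>\<psi>\<close> at a
  corner may be subtracted. What remains of \<open>\<psi>\<close> is at most \<open>2 * L\<close>
  times the diameter bound \<open>2 * lam ^ n\<close>, and the tiles have total area one.\<close>

lemma mixed_integral_bound:
  assumes \<psi>: "test_function UNIV \<psi>" and L: "\<And>x b. b \<in> Basis \<Longrightarrow> \<bar>partial b \<psi> x\<bar> \<le> L"
  shows "\<bar>LINT x|lebesgue. \<rho> (T n) x * \<psi> x\<bar> \<le> 4 * L * lam ^ n"
proof -
  define l where "l = lam ^ n"
  have l: "l > 0" using lam_pos by (simp add: l_def)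
  have \<psi>s: "smooth \<psi>" using \<psi> by (simp add: test_function_def)
  have L0: "L \<ge> 0" using L[OF e1_Basis, of 0] by linarith
  let ?B = "\<lambda>q. Box (corner l q) l"
  have Bi: "integrable lebesgue (indicat_real (?B q))" for q
    by (simp add: Box_eq_box flip: lmeasurable_iff_integrable)
  have \<rho>i: "integrable lebesgue (\<lambda>x. indicat_real (?B q) x * \<rho> (T n) x)" for q
  proof (rule Bochner_Integration.integrable_bound[OF Bi[of q]])
    show "(\<lambda>x. indicat_real (?B q) x * \<rho> (T n) x) \<in> borel_measurable lebesgue"
      by (intro borel_measurable_times borel_measurable_indicator Box_lmeasurable \<rho>_measurable)
    show "AE x in lebesgue. norm (indicat_real (?B q) x * \<rho> (T n) x) \<le> norm (indicat_real (?B q) x)"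
      using \<rho>_le_1[of n] by eventually_elim (auto simp: indicator_def)
  qed
  obtain S where S: "\<And>x. \<bar>\<psi> x\<bar> \<le> S" using test_function_bounded[OF \<psi>] by blast
  have \<rho>\<psi>i: "integrable lebesgue (\<lambda>x. indicat_real (?B q) x * \<rho> (T n) x * \<psi> x)" for q
  proof (rule Bochner_Integration.integrable_bound[OF integrable_mult_right[OF \<rho>i[of q], of S]])
    show "(\<lambda>x. indicat_real (?B q) x * \<rho> (T n) x * \<psi> x) \<in> borel_measurable lebesgue"
      by (intro borel_measurable_times borel_measurable_indicator Box_lmeasurable \<rho>_measurable smooth_lebesgue_measurable \<psi>s)
    have "norm (indicat_real (?B q) x * \<rho> (T n) x * \<psi> x) \<le> norm (S * (indicat_real (?B q) x * \<rho> (T n) x))" for x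
    proof -
      have "\<bar>\<psi> x\<bar> \<le> \<bar>S\<bar>" using S[of x] by linarith
      from mult_right_mono[OF this, of "\<bar>indicat_real (?B q) x * \<rho> (T n) x\<bar>"]
      show ?thesis by (simp add: abs_mult mult_ac)
    qed
    then show "AE x in lebesgue. norm (indicat_real (?B q) x * \<rho> (T n) x * \<psi> x) \<le> norm (S * (indicat_real (?B q) x * \<rho> (T n) x))" by simp
  qed
  have tile: "\<bar>LINT x|lebesgue. indicat_real (?B q) x * \<rho> (T n) x * \<psi> x\<bar> \<le> 4 * L * l * l ^ 2" if q: "q \<in> Q n" for q
  proof -
    define c where "c = \<psi> (corner l q)"
    have "(LINT x|lebesgue. indicat_real (?B q) x * \<rho> (T n) x) = 0"
      using tile_profile(2)[OF q] unfolding tile_eq_Box l_def set_lebesgue_integral_def by simp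
    then have eq: "(LINT x|lebesgue. indicat_real (?B q) x * \<rho> (T n) x * \<psi> x)
        = (LINT x|lebesgue. indicat_real (?B q) x * \<rho> (T n) x * \<psi> x - c * (indicat_real (?B q) x * \<rho> (T n) x))"
      by (subst Bochner_Integration.integral_diff[OF \<rho>\<psi>i integrable_mult_right[OF \<rho>i]]) simp
    have "norm (LINT x|lebesgue. indicat_real (?B q) x * \<rho> (T n) x * \<psi> x) \<le>
        (LINT x|lebesgue. norm (indicat_real (?B q) x * \<rho> (T n) x * \<psi> x - c * (indicat_real (?B q) x * \<rho> (T n) x)))"
      unfolding eq by (rule integral_norm_bound)
    also have "\<dots> \<le> (LINT x|lebesgue. (4 * L * l) * indicat_real (?B q) x)"
    proof (rule integral_mono_AE)
      show "integrable lebesgue (\<lambda>x. norm (indicat_real (?B q) x * \<rho> (T n) x * \<psi> x - c * (indicat_real (?B q) x * \<rho> (T n) x)))"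
        by (intro integrable_norm Bochner_Integration.integrable_diff integrable_mult_right \<rho>\<psi>i \<rho>i)
      show "AE x in lebesgue. norm (indicat_real (?B q) x * \<rho> (T n) x * \<psi> x - c * (indicat_real (?B q) x * \<rho> (T n) x)) \<le> (4 * L * l) * indicat_real (?B q) x"
        using \<rho>_le_1[of n]
      proof eventually_elim
        case (elim x)
        show ?case
        proof (cases "x \<in> ?B q")
          case True
          have "norm (x - corner l q) \<le> 2 * l"
          proof (rule norm_diff_le_CBox)
            show "x \<in> CBox (corner l q) l" using True Box_subset_CBox by blast
            show "corner l q \<in> CBox (corner l q) l" using l by (simp add: CBox_def)
          qed
          then have "2 * L * norm (x - corner l q) \<le> 2 * L * (2 * l)" using L0 by (intro mult_left_mono) auto
          then have d: "\<bar>\<psi> x - c\<bar> \<le> 4 * L * l"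
            unfolding c_def using partial_bound_Lipschitz[OF \<psi>s L, of x "corner l q"] by linarith
          have "\<bar>\<rho> (T n) x\<bar> * \<bar>\<psi> x - c\<bar> \<le> 1 * (4 * L * l)"
            using elim d by (intro mult_mono) auto
          then show ?thesis using True by (simp add: abs_mult[symmetric] algebra_simps)
        qed simp
      qed
      show "integrable lebesgue (\<lambda>x. (4 * L * l) * indicat_real (?B q) x)" by (intro integrable_mult_right Bi)
    qed
    also have "\<dots> = 4 * L * l * l ^ 2"
      using measure_Box[of l "corner l q"] l Box_lmeasurable[of "corner l q" l] by (simp del: measure_completion)
    finally show ?thesis by simp
  qed
  have "(LINT x|lebesgue. \<rho> (T n) x * \<psi> x) = (LINT x|lebesgue. (\<Sum>q\<in>Q n. indicat_real (?B q) x * \<rho> (T n) x * \<psi> x))"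
  proof (rule integral_cong_AE)
    show "(\<lambda>x. \<rho> (T n) x * \<psi> x) \<in> borel_measurable lebesgue"
      by (intro borel_measurable_times \<rho>_measurable smooth_lebesgue_measurable \<psi>s)
    show "(\<lambda>x. \<Sum>q\<in>Q n. indicat_real (?B q) x * \<rho> (T n) x * \<psi> x) \<in> borel_measurable lebesgue"
      by (intro borel_measurable_sum borel_measurable_integrable \<rho>\<psi>i)
    show "AE x in lebesgue. \<rho> (T n) x * \<psi> x = (\<Sum>q\<in>Q n. indicat_real (?B q) x * \<rho> (T n) x * \<psi> x)"
      using AE_tile[of n]
    proof eventually_elim
      case (elim x)
      show ?case
      proof (cases "x \<in> unit_square")
        case False
        then show ?thesis by (simp add: \<rho>_outside)
      next
        case True
        then obtain q where q: "q \<in> Q n" "x \<in> ?B q" using elim unfolding l_def tile_eq_Box by blast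
        have "x \<notin> ?B q'" if "q' \<noteq> q" for q'
          using tiles_disjoint[OF that, of n] q(2) Box_subset_CBox unfolding l_def by blast
        then have "(\<Sum>q'\<in>Q n. indicat_real (?B q') x * \<rho> (T n) x * \<psi> x) = (\<Sum>q'\<in>Q n. if q' = q then \<rho> (T n) x * \<psi> x else 0)"
          using q(2) by (intro sum.cong) auto
        also have "\<dots> = \<rho> (T n) x * \<psi> x" using q(1) finite_Q by simp
        finally show ?thesis by simp
      qed
    qed
  qed
  also have "\<dots> = (\<Sum>q\<in>Q n. (LINT x|lebesgue. indicat_real (?B q) x * \<rho> (T n) x * \<psi> x))"
    by (rule Bochner_Integration.integral_sum[OF \<rho>\<psi>i])
  also have "\<bar>\<dots>\<bar> \<le> (\<Sum>q\<in>Q n. 4 * L * l * l ^ 2)"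
    by (rule order_trans[OF sum_abs], rule sum_mono[OF tile])
  also have "\<dots> = 4 * L * l * (real (card (Q n)) * l ^ 2)" by (simp add: mult_ac)
  also have "\<dots> = 4 * L * l" using card_Q[of n] by (simp add: l_def)
  finally show ?thesis by (simp add: l_def)
qed

end

context cellular_pair
begin

text \<open>The dual bound on \<open>u\<close> is of order \<open>(lam powr s) ^ n\<close> and the
  step lasts \<open>\<tau> ^ n\<close>. The point is that \<open>D\<close> depends on the pair
  alone, and neither on the test function nor on \<open>n\<close>.\<close>

lemma increment_bound:
  "\<exists>D\<ge>0. \<forall>\<psi> L n. test_function UNIV \<psi> \<longrightarrow> L > 0 \<longrightarrow> (\<forall>b\<in>Basis. \<forall>x. \<bar>partial b \<psi> x\<bar> \<le> L) \<longrightarrow>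
    \<bar>(LINT x|lebesgue. \<rho> (T (Suc n)) x * \<psi> x) - (LINT x|lebesgue. \<rho> (T n) x * \<psi> x)\<bar>
      \<le> D * L * (lam powr s * \<tau>) ^ n"
proof -
  obtain M0 where M0: "AE t in lebesgue. t \<in> cellular_times \<tau> \<longrightarrow> sobolev_seminorm s p (u t) \<le> ennreal M0"
    using reg unfolding Linfty_sobolev_def by blast
  \<comment> \<open>The bound in the definition may be a negative real, which is read as
    \<open>0\<close> in \<open>ennreal\<close>.\<close>
  define M where "M = max 0 M0"
  have M: "AE t in lebesgue. t \<in> cellular_times \<tau> \<longrightarrow> sobolev_seminorm s p (u t) \<le> ennreal M"
    using M0
  proof eventually_elim
    case (elim t)
    have "ennreal M0 \<le> ennreal M" by (rule ennreal_leI) (simp add: M_def)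
    with elim show ?case by (blast intro: order_trans)
  qed
  have M0: "M \<ge> 0" by (simp add: M_def)
  obtain R0 where R0: "\<And>t x. t \<in> cellular_times \<tau> \<Longrightarrow> \<bar>\<rho> t x\<bar> \<le> R0"
    using sol unfolding continuity_solution_def by blast
  define R where "R = max 1 R0"
  have R: "\<bar>\<rho> t x\<bar> \<le> R" if "t \<in> cellular_times \<tau>" for t x
    using R0[OF that, of x] by (simp add: R_def)
  have R1: "R > 0" by (simp add: R_def)
  define EC where "EC = energy_const s p M"
  have EC: "EC \<ge> 0" using M0 by (auto simp: EC_def energy_const_def)
  show ?thesis
  proof (intro exI[of _ "4 * R * EC"] conjI allI impI)
    show "4 * R * EC \<ge> 0" using R1 EC by simp
    fix \<psi> :: "plane \<Rightarrow> real" and L n assume \<psi>: "test_function UNIV \<psi>" and L0: "L > 0"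
      and L: "\<forall>b\<in>Basis. \<forall>x. \<bar>partial b \<psi> x\<bar> \<le> L"
    have E0: "2 * EC * (lam ^ n) powr s \<ge> 0" using EC by simp
    have "\<bar>(LINT x|lebesgue. \<rho> (T (Suc n)) x * \<psi> x) - (LINT x|lebesgue. \<rho> (T n) x * \<psi> x)\<bar>
        \<le> 2 * R * L * (2 * EC * (lam ^ n) powr s) * (T (Suc n) - T n)"
      by (rule continuity_solution_increment[OF sol vel step_time_nonneg[OF \<tau>] step_time_mono[OF \<tau>]
            step_in_cellular_times[OF \<tau>] R R1 \<psi> L[rule_format] L0 step_energy[OF M M0, folded EC_def] E0])
    also have "(lam ^ n) powr s = (lam powr s) ^ n"
      using lam_pos by (simp add: powr_realpow[symmetric] powr_powr mult.commute)
    also have "2 * R * L * (2 * EC * (lam powr s) ^ n) * (T (Suc n) - T n) = 4 * R * EC * L * (lam powr s * \<tau>) ^ n"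
      by (simp add: step_time_Suc power_mult_distrib)
    finally show "\<bar>(LINT x|lebesgue. \<rho> (T (Suc n)) x * \<psi> x) - (LINT x|lebesgue. \<rho> (T n) x * \<psi> x)\<bar>
        \<le> 4 * R * EC * L * (lam powr s * \<tau>) ^ n" .
  qed
qed

text \<open>The bumps have disjoint supports, so the gradient of their sum is no larger than that of
  a single one, and the number of tiles times the tile area is one, so the pairing is bounded below
  independently of \<open>n\<close>. The choice of \<open>d\<close> gives
  \<open>1 - d - 2 * \<beta> = d\<close>, and \<open>Lc\<close> is the bound
  \<open>2 * K / (d * R)\<close> at the smallest possible radius.\<close>

lemma bump_sum:
  fixes d Lc K :: real
  assumes d: "d = (1 - 2 * \<beta>) / 2" and Lc: "Lc = 4 * K / (d * a)" and K: "\<And>t. \<bar>partial 1 smooth_step t\<bar> \<le> K"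
  shows "\<exists>\<psi>. test_function UNIV \<psi> \<and> (\<forall>b\<in>Basis. \<forall>x. \<bar>partial b \<psi> x\<bar> \<le> Lc / lam ^ n) \<and>
    d * (pi * (a / 2) ^ 2) \<le> (LINT x|lebesgue. \<rho> (T n) x * \<psi> x)"
proof -
  have "0 < (1 - 2 * b) / 2 \<and> (1 - 2 * b) / 2 < 1" if "1 - 2 * b > 0" "b \<ge> 0" for b :: real
    using that by auto
  from this[OF \<gamma>(2,3)] have d01: "0 < d" "d < 1" unfolding d by blast+
  have dd: "1 - d - 2 * \<beta> = d" unfolding d by (simp add: field_simps)
  have K0: "K \<ge> 0" using K[of 0] by linarith
  have l: "lam ^ n > 0" using lam_pos by simp
  have "\<forall>q\<in>Q n. \<exists>B. snd B \<ge> a / 2 * lam ^ n \<and> ball (fst B) (snd B) \<subseteq> tile (lam ^ n) q \<and>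
      mostly_one \<beta> (fst B) (snd B) (\<rho> (T n))"
  proof
    fix q assume "q \<in> Q n"
    from tile_profile(1)[OF this] obtain y R where
      "R \<ge> a / 2 * lam ^ n \<and> ball y R \<subseteq> tile (lam ^ n) q \<and> mostly_one \<beta> y R (\<rho> (T n))" by blast
    then show "\<exists>B. snd B \<ge> a / 2 * lam ^ n \<and> ball (fst B) (snd B) \<subseteq> tile (lam ^ n) q \<and>
        mostly_one \<beta> (fst B) (snd B) (\<rho> (T n))"
      by (intro exI[of _ "(y, R)"]) simp
  qed
  from bchoice[OF this] obtain F where F: "\<forall>q\<in>Q n. snd (F q) \<ge> a / 2 * lam ^ n \<and>
      ball (fst (F q)) (snd (F q)) \<subseteq> tile (lam ^ n) q \<and> mostly_one \<beta> (fst (F q)) (snd (F q)) (\<rho> (T n))" ..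
  define y where "y q = fst (F q)" for q
  define R where "R q = snd (F q)" for q
  have R: "R q \<ge> a / 2 * lam ^ n" and B: "ball (y q) (R q) \<subseteq> tile (lam ^ n) q"
    and mo: "mostly_one \<beta> (y q) (R q) (\<rho> (T n))" if "q \<in> Q n" for q
    using F that unfolding y_def R_def by blast+
  have R0: "R q > 0" if "q \<in> Q n" for q using mo[OF that] by (simp add: mostly_one_def)
  define \<psi> where "\<psi> x = (\<Sum>q\<in>Q n. bump d (y q) (R q) x)" for x
  show ?thesis
  proof (intro exI[of _ \<psi>] conjI ballI allI)
    show "test_function UNIV \<psi>"
      unfolding \<psi>_def by (intro test_function_sum finite_Q bump_test_function d01 R0)
    fix b :: plane and x assume b: "b \<in> Basis"
    have bound: "\<bar>partial b (bump d (y q) (R q)) x\<bar> \<le> Lc / lam ^ n" if q: "q \<in> Q n" for q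
    proof -
      have "\<bar>partial b (bump d (y q) (R q)) x\<bar> \<le> 2 * K / (d * R q)"
        by (rule partial_bump_bound[OF d01(1) R0[OF q] b K])
      also have "\<dots> \<le> 2 * K / (d * (a / 2 * lam ^ n))"
        using d01 K0 a l R[OF q] R0[OF q] by (intro divide_left_mono mult_left_mono mult_pos_pos) auto
      also have "\<dots> = Lc / lam ^ n" using a d01 l by (simp add: Lc field_simps)
      finally show ?thesis .
    qed
    have "partial b \<psi> x = (\<Sum>q\<in>Q n. partial b (bump d (y q) (R q)) x)"
      unfolding \<psi>_def by (rule partial_sum[OF finite_Q smooth_bump])
    moreover have "\<bar>\<Sum>q\<in>Q n. partial b (bump d (y q) (R q)) x\<bar> \<le> Lc / lam ^ n"
    proof (cases "\<exists>q\<in>Q n. x \<in> ball (y q) (R q)")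
      case True
      then obtain q where q: "q \<in> Q n" "x \<in> ball (y q) (R q)" by blast
      have "partial b (bump d (y q') (R q')) x = 0" if q': "q' \<in> Q n" "q' \<noteq> q" for q'
      proof (rule partial_bump_eq_0[OF d01(1) R0[OF q'(1)]])
        show "x \<notin> ball (y q') (R q')"
          using tiles_disjoint[OF q'(2), of n] B[OF q(1)] B[OF q'(1)] q(2) Box_subset_CBox
          unfolding tile_eq_Box by blast
      qed
      then have "(\<Sum>q'\<in>Q n. partial b (bump d (y q') (R q')) x) =
          (\<Sum>q'\<in>Q n. if q' = q then partial b (bump d (y q) (R q)) x else 0)"
        by (intro sum.cong) auto
      also have "\<dots> = partial b (bump d (y q) (R q)) x" using q(1) finite_Q by simp
      finally show ?thesis using bound[OF q(1)] by simp
    next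
      case False
      then have "(\<Sum>q\<in>Q n. partial b (bump d (y q) (R q)) x) = 0"
        by (intro sum.neutral ballI partial_bump_eq_0 d01 R0) auto
      then show ?thesis using Lc K0 d01 a l by simp
    qed
    ultimately show "\<bar>partial b \<psi> x\<bar> \<le> Lc / lam ^ n" by simp
  next
    note MB = mostly_one_bump[OF \<rho>_measurable \<rho>_le_1 mo d01, unfolded dd]
    have "d * (pi * (a / 2) ^ 2) = (real (card (Q n)) * (lam ^ n) ^ 2) * (d * (pi * (a / 2) ^ 2))"
      unfolding card_Q by simp
    also have "\<dots> = (\<Sum>q\<in>Q n. d * (pi * (a / 2 * lam ^ n) ^ 2))" by (simp add: power_mult_distrib power_divide mult_ac)
    also have "\<dots> \<le> (\<Sum>q\<in>Q n. (LINT x|lebesgue. \<rho> (T n) x * bump d (y q) (R q) x))"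
    proof (rule sum_mono)
      fix q assume q: "q \<in> Q n"
      have "d * (pi * (a / 2 * lam ^ n) ^ 2) \<le> d * (pi * R q ^ 2)"
        using d01 R[OF q] a l by (intro mult_left_mono power_mono) auto
      then show "d * (pi * (a / 2 * lam ^ n) ^ 2) \<le> (LINT x|lebesgue. \<rho> (T n) x * bump d (y q) (R q) x)"
        using MB(2)[OF q] by linarith
    qed
    also have "\<dots> = (LINT x|lebesgue. \<rho> (T n) x * \<psi> x)"
      unfolding \<psi>_def sum_distrib_left by (rule Bochner_Integration.integral_sum[symmetric]) (rule MB(1))
    finally show "d * (pi * (a / 2) ^ 2) \<le> (LINT x|lebesgue. \<rho> (T n) x * \<psi> x)" .
  qed
qed

text \<open>If the bound failed, \<open>\<sigma>\<close> would be below one. The test function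
  adapted to the tiles of side \<open>lam ^ n\<close> has pairing at least \<open>c0\<close> at time
  \<open>T n\<close>, while at time \<open>T (n + m)\<close> it is at most
  \<open>4 * Lc * lam ^ m\<close> and has changed by at most \<open>m\<close> times a multiple of
  \<open>\<sigma> ^ n\<close>.\<close>

lemma \<tau>_lower_bound: "\<tau> \<ge> lam powr (1 - s)"
proof (rule ccontr)
  assume "\<not> ?thesis"
  then have "\<tau> * lam powr (s - 1) < lam powr (1 - s) * lam powr (s - 1)"
    using lam_pos by (intro mult_strict_right_mono) auto
  also have "\<dots> = 1" using lam_pos by (simp add: powr_add[symmetric])
  finally have \<sigma>1: "\<tau> * lam powr (s - 1) < 1" .
  define \<sigma> where "\<sigma> = \<tau> * lam powr (s - 1)"
  have \<sigma>: "0 < \<sigma>" "\<sigma> < 1" using \<sigma>1 \<tau> lam_pos by (auto simp: \<sigma>_def)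
  have ls: "lam powr s * \<tau> = lam * \<sigma>"
    using lam_pos by (simp add: \<sigma>_def powr_diff)
  obtain K where K: "K > 0" "\<And>t. \<bar>partial 1 smooth_step t\<bar> \<le> K" using partial_smooth_step_bounded by blast
  define d where "d = (1 - 2 * \<beta>) / 2"
  have d: "d > 0" using \<gamma>(2) by (simp add: d_def)
  define Lc where "Lc = 4 * K / (d * a)"
  have Lc: "Lc > 0" using K d a by (simp add: Lc_def)
  define c0 where "c0 = d * (pi * (a / 2) ^ 2)"
  have c0: "c0 > 0" using d a by (simp add: c0_def)
  obtain D where D: "D \<ge> 0" and inc: "\<forall>\<psi> L n. test_function UNIV \<psi> \<longrightarrow> L > 0 \<longrightarrow>
      (\<forall>b\<in>Basis. \<forall>x. \<bar>partial b \<psi> x\<bar> \<le> L) \<longrightarrow>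
      \<bar>(LINT x|lebesgue. \<rho> (T (Suc n)) x * \<psi> x) - (LINT x|lebesgue. \<rho> (T n) x * \<psi> x)\<bar>
        \<le> D * L * (lam * \<sigma>) ^ n"
    using increment_bound unfolding ls by blast
  have bound: "c0 \<le> 4 * Lc * lam ^ m + real m * (D * Lc * \<sigma> ^ n)" for n m
  proof -
    obtain \<psi> where \<psi>: "test_function UNIV \<psi>" "\<And>x b. b \<in> Basis \<Longrightarrow> \<bar>partial b \<psi> x\<bar> \<le> Lc / lam ^ n"
      and lower: "c0 \<le> (LINT x|lebesgue. \<rho> (T n) x * \<psi> x)"
      using bump_sum[OF d_def Lc_def K(2), of n] unfolding c0_def by blast
    have L: "Lc / lam ^ n > 0" using Lc lam_pos by simp
    define I where "I j = (LINT x|lebesgue. \<rho> (T j) x * \<psi> x)" for j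
    have step: "\<bar>I (Suc j) - I j\<bar> \<le> D * Lc * \<sigma> ^ n" if j: "j \<ge> n" for j
    proof -
      have "\<bar>I (Suc j) - I j\<bar> \<le> D * (Lc / lam ^ n) * (lam * \<sigma>) ^ j"
        unfolding I_def using inc \<psi> L by blast
      \<comment> \<open>Later steps are bounded by the first one. The large gradient
        \<open>Lc / lam ^ n\<close> is compensated by \<open>lam ^ n\<close> in the displacement,
        leaving \<open>\<sigma> ^ n\<close>.\<close>
      also have "\<dots> \<le> D * (Lc / lam ^ n) * (lam * \<sigma>) ^ n"
        using j lam_pos \<sigma> mult_nonneg_nonneg[OF D less_imp_le[OF L]]
        by (intro mult_left_mono power_decreasing) (auto intro!: mult_le_one)
      also have "\<dots> = D * Lc * \<sigma> ^ n"
        using lam_pos by (simp add: power_mult_distrib)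
      finally show ?thesis .
    qed
    have "\<bar>I (n + j) - I n\<bar> \<le> real j * (D * Lc * \<sigma> ^ n)" for j
    proof (induction j)
      case (Suc j)
      then show ?case using step[of "n + j"] by (simp add: distrib_right)
    qed simp
    from this[of m] have "I n \<le> \<bar>I (n + m)\<bar> + real m * (D * Lc * \<sigma> ^ n)" by linarith
    moreover have "\<bar>I (n + m)\<bar> \<le> 4 * (Lc / lam ^ n) * lam ^ (n + m)"
      unfolding I_def by (rule mixed_integral_bound[OF \<psi>])
    moreover have "4 * (Lc / lam ^ n) * lam ^ (n + m) = 4 * Lc * lam ^ m"
      using lam_pos by (simp add: power_add)
    ultimately show ?thesis using lower unfolding I_def by linarith
  qed
  have "(\<lambda>m. 4 * Lc * lam ^ m) \<longlonglongrightarrow> 4 * Lc * 0"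
    using lam_pos by (intro tendsto_mult tendsto_const LIMSEQ_power_zero) auto
  then have "\<forall>\<^sub>F m in sequentially. 4 * Lc * lam ^ m < c0 / 2"
    by (rule order_tendstoD) (use c0 in auto)
  \<comment> \<open>The number \<open>m\<close> of steps is fixed first, so that mixing makes the
    final pairing small; only then is \<open>n\<close> taken so large that these \<open>m\<close>
    steps move almost nothing.\<close>
  then obtain m where m: "4 * Lc * lam ^ m < c0 / 2" by (auto simp: eventually_sequentially)
  have "(\<lambda>n. real m * (D * Lc * \<sigma> ^ n)) \<longlonglongrightarrow> real m * (D * Lc * 0)"
    using \<sigma> by (intro tendsto_mult tendsto_const LIMSEQ_power_zero) auto
  then have "\<forall>\<^sub>F n in sequentially. real m * (D * Lc * \<sigma> ^ n) < c0 / 2"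
    by (rule order_tendstoD) (use c0 in auto)
  then obtain n where "real m * (D * Lc * \<sigma> ^ n) < c0 / 2" by (auto simp: eventually_sequentially)
  with m bound[of m n] show False by linarith
qed

text \<open>\<open>T n\<close> is at least its last summand \<open>\<tau> ^ (n - 1)\<close>, which
  the lower bound on \<open>\<tau>\<close> compares with a power of \<open>lam\<close>. The exponent
  is \<open>n - 1\<close>, one short of the tile size \<open>lam ^ n\<close> at that time.\<close>

lemma step_time_powr_le:
  assumes n: "n \<ge> 1"
  shows "T n powr (- (1 / (s - 1))) \<le> lam ^ (n - 1)"
proof -
  have "lam powr ((1 - s) * real (n - 1)) = (lam powr (1 - s)) ^ (n - 1)"
    using lam_pos by (simp add: powr_realpow[symmetric] powr_powr)
  also have "\<dots> \<le> \<tau> ^ (n - 1)" by (intro power_mono \<tau>_lower_bound) simp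
  also have "\<dots> \<le> T n"
    unfolding step_time_def using n \<tau> by (intro member_le_sum) auto
  finally have le: "lam powr ((1 - s) * real (n - 1)) \<le> T n" .
  have "T n powr (- (1 / (s - 1))) \<le> (lam powr ((1 - s) * real (n - 1))) powr (- (1 / (s - 1)))"
    using le lam_pos s by (intro powr_mono2') auto
  also have "\<dots> = lam powr real (n - 1)"
  proof -
    have "(1 - s) * real (n - 1) * (- (1 / (s - 1))) = real (n - 1)" using s by (simp add: field_simps)
    then show ?thesis by (simp only: powr_powr)
  qed
  also have "\<dots> = lam ^ (n - 1)" using lam_pos by (simp add: powr_realpow)
  finally show ?thesis .
qed

text \<open>Again one tile suffices; the square of \<open>lam ^ n\<close> is the area scale of its
  good ball.\<close>

lemma functional_lower_bound:
  assumes K: "K > 0" "\<And>t. \<bar>partial 1 smooth_step t\<bar> \<le> K" and d: "d = (1 - 2 * \<beta>) / 2"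
  shows "functional_mixing_scale (\<rho> (T n)) \<ge> ereal (d / (8 * K) * (d * (pi * (a / 2) ^ 2)) * (lam ^ n) ^ 2)"
proof -
  have "0 < (1 - 2 * b) / 2 \<and> (1 - 2 * b) / 2 < 1" if "1 - 2 * b > 0" "b \<ge> 0" for b :: real
    using that by auto
  from this[OF \<gamma>(2,3)] have d01: "0 < d" "d < 1" unfolding d by blast+
  have dd: "1 - d - 2 * \<beta> = d" unfolding d by (simp add: field_simps)
  have "(0, 0) \<in> Q n" using N by (simp add: Q_eq)
  from tile_profile(1)[OF this] obtain y R where R: "R \<ge> a / 2 * lam ^ n" and mo: "mostly_one \<beta> y R (\<rho> (T n))" by blast
  have "(a / 2 * lam ^ n) ^ 2 \<le> R ^ 2" using R a lam_pos by (intro power_mono) auto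
  then have "d / (8 * K) * (d * (pi * (a / 2 * lam ^ n) ^ 2)) \<le> d / (8 * K) * (d * (pi * R ^ 2))"
    using d01 K by (intro mult_left_mono) auto
  moreover have "d / (8 * K) * (d * (pi * (a / 2) ^ 2)) * (lam ^ n) ^ 2 = d / (8 * K) * (d * (pi * (a / 2 * lam ^ n) ^ 2))"
    by (simp add: power_mult_distrib power_divide)
  ultimately have "ereal (d / (8 * K) * (d * (pi * (a / 2) ^ 2)) * (lam ^ n) ^ 2) \<le> ereal (d / (8 * K) * (d * (pi * R ^ 2)))"
    by (simp only: ereal_less_eq)
  also have "\<dots> \<le> functional_mixing_scale (\<rho> (T n))"
    using functional_mixing_scale_ge[OF \<rho>_measurable \<rho>_le_1 mo d01 K] unfolding dd .
  finally show ?thesis .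
qed

end

theorem mainTheorem1:
  fixes \<kappa> sbar lam a s :: real
  assumes "0 < \<kappa>" "\<kappa> < 1" and "0 < sbar" "sbar < 1"
    and "0 < lam" "1 / lam \<in> \<nat>" "1 / lam \<ge> 2"
    and "a > 0" and "s > 1"
  shows "\<exists>C>0. \<forall>(\<tau>::real) (\<theta>::real) (p::ennreal)
           (u :: real \<Rightarrow> plane \<Rightarrow> plane) (f :: plane \<Rightarrow> real) (\<rho> :: real \<Rightarrow> plane \<Rightarrow> real).
     \<tau> > 0 \<and> 0 < \<theta> \<and> \<theta> \<le> 1/2 \<and> 1 < p \<and>
     velocity_field (cellular_times \<tau>) u \<and>
     Linfty_sobolev (cellular_times \<tau>) s p u \<and>
     initial_datum f \<and>
     continuity_solution (cellular_times \<tau>) u f \<rho> \<and>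
     cellular_type \<kappa> sbar \<tau> lam a p \<theta> s u \<rho> \<longrightarrow>
     (\<forall>n\<ge>1.
        geometric_mixing_scale \<kappa> (\<rho> (step_time \<tau> n))
          \<ge> ereal (C * step_time \<tau> n powr (- (1 / (s - 1)))) \<and>
        functional_mixing_scale (\<rho> (step_time \<tau> n))
          \<ge> ereal (C * step_time \<tau> n powr (- (2 / (s - 1)))))"
proof -
  obtain N :: nat where N: "1 / lam = real N" using assms(6) by (auto elim: Nats_cases)
  have N2: "N \<ge> 2" using assms(7) unfolding N by simp
  have "lam = 1 / (1 / lam)" by simp
  then have lam: "lam = 1 / real N" unfolding N .
  obtain K where K: "K > 0" "\<And>t. \<bar>partial 1 smooth_step t\<bar> \<le> K" using partial_smooth_step_bounded by blast
  define d where "d = (1 - 2 * ((1 - \<kappa>) / 2 * sbar)) / 2"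
  have "(1 - \<kappa>) * sbar < 1 * 1" using assms by (intro mult_strict_mono) auto
  then have d: "d > 0" by (simp add: d_def)
  define C1 where "C1 = (1 - \<kappa>) * (1 - sbar) * a / 8"
  define C2 where "C2 = d / (8 * K) * (d * (pi * (a / 2) ^ 2))"
  \<comment> \<open>The factors \<open>lam\<close> and \<open>lam ^ 2\<close> make up for the
    exponent \<open>n - 1\<close> in \<open>step_time_powr_le\<close>. All ingredients are fixed
    before \<open>\<tau>\<close>, \<open>\<theta>\<close>, \<open>p\<close> and the pair are
    introduced.\<close>
  define C where "C = min (C1 * lam) (C2 * lam ^ 2)"
  have C12: "C1 > 0" "C2 > 0" using assms d K by (auto simp: C1_def C2_def)
  then have C: "C > 0" using assms by (simp add: C_def)
  show ?thesis
  proof (intro exI[of _ C] conjI[OF C] allI impI)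
    fix \<tau> \<theta> :: real and p :: ennreal and u :: "real \<Rightarrow> plane \<Rightarrow> plane" and f :: "plane \<Rightarrow> real"
      and \<rho> :: "real \<Rightarrow> plane \<Rightarrow> real" and n :: nat
    assume H: "\<tau> > 0 \<and> 0 < \<theta> \<and> \<theta> \<le> 1/2 \<and> 1 < p \<and>
     velocity_field (cellular_times \<tau>) u \<and>
     Linfty_sobolev (cellular_times \<tau>) s p u \<and>
     initial_datum f \<and>
     continuity_solution (cellular_times \<tau>) u f \<rho> \<and>
     cellular_type \<kappa> sbar \<tau> lam a p \<theta> s u \<rho>" and n: "1 \<le> n"
    interpret cellular_pair \<kappa> sbar lam a s \<tau> \<theta> p N u f \<rho>
      by unfold_locales (use H assms N2 lam in blast)+
    define X where "X = step_time \<tau> n powr (- (1 / (s - 1)))"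
    have X: "0 \<le> X" "X \<le> lam ^ (n - 1)" using step_time_powr_le[OF n] by (auto simp: X_def)
    have ln: "lam ^ n = lam * lam ^ (n - 1)" using n by (cases n) auto
    have "C * X \<le> (C1 * lam) * lam ^ (n - 1)"
      using X C12 assms(5) by (intro mult_mono) (auto simp: C_def)
    also have "\<dots> = C1 * lam ^ n" by (simp add: ln)
    finally have "ereal (C * X) \<le> ereal (C1 * lam ^ n)" by simp
    also have "\<dots> \<le> geometric_mixing_scale \<kappa> (\<rho> (step_time \<tau> n))"
      using geometric_lower_bound[of n] by (simp add: C1_def)
    finally have G: "ereal (C * step_time \<tau> n powr (- (1 / (s - 1)))) \<le> geometric_mixing_scale \<kappa> (\<rho> (step_time \<tau> n))"
      by (simp add: X_def)
    have "step_time \<tau> n powr (- (2 / (s - 1))) = X ^ 2"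
    proof -
      have "X ^ 2 = X powr 2" using X(1) by (simp add: powr_numeral)
      also have "\<dots> = step_time \<tau> n powr (- (2 / (s - 1)))" by (simp add: X_def powr_powr)
      finally show ?thesis by simp
    qed
    moreover have "C * X ^ 2 \<le> (C2 * lam ^ 2) * (lam ^ (n - 1)) ^ 2"
      using X C12 assms(5) by (intro mult_mono power_mono) (auto simp: C_def)
    moreover have "(C2 * lam ^ 2) * (lam ^ (n - 1)) ^ 2 = C2 * (lam ^ n) ^ 2" by (simp add: ln power_mult_distrib)
    ultimately have "ereal (C * step_time \<tau> n powr (- (2 / (s - 1)))) \<le> ereal (C2 * (lam ^ n) ^ 2)"
      by (simp only: ereal_less_eq)
    also have "\<dots> \<le> functional_mixing_scale (\<rho> (step_time \<tau> n))"
      using functional_lower_bound[OF K d_def, of n] by (simp add: C2_def)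
    finally have "ereal (C * step_time \<tau> n powr (- (2 / (s - 1)))) \<le> functional_mixing_scale (\<rho> (step_time \<tau> n))" .
    with G show "geometric_mixing_scale \<kappa> (\<rho> (step_time \<tau> n))
          \<ge> ereal (C * step_time \<tau> n powr (- (1 / (s - 1)))) \<and>
        functional_mixing_scale (\<rho> (step_time \<tau> n))
          \<ge> ereal (C * step_time \<tau> n powr (- (2 / (s - 1))))" by blast
  qed
qed

end
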